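(* Let $(X,\mathcal{X},\mu,T)$ be a totally ergodic measure preserving system (i.e. $T^r$ is ergodic for every $r\in\mathbb{N}$), let $f\in L^1(\mu)$, and let $k\in\mathbb{N}$. Then the following three conditions are equivalent: (i) $f\in\mathcal{E}_k(T)^\perp$. (ii) For $\mu$-a.e. $x\in X$, for every continuous $\phi\colon \mathbb{T}\to\mathbb{C}$ and every $P\in\mathbb{R}_k[t]$, $$\lim_{N\to\infty}\frac{1}{N}\sum_{n=1}^N \phi(P(n))\, f(T^nx)=0.$$ (iii) For $\mu$-a.e. $x\in X$, for every continuous $\phi\colon\mathbb{T}\to\mathbb{C}$, $$\lim_{N\to\infty}\sup_{P\in\mathbb{R}_k[t]}\Big|\frac{1}{N}\sum_{n=1}^N \phi(P(n))\, f(T^nx)\Big|=0.$$ (In (ii) the full-measure set does not depend on $\phi$ or $P$; in (iii) it does not depend on $\phi$.)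
   Context: A measure preserving system $(X,\mathcal{X},\mu,T)$ consists of a probability space and a measurable measure preserving map $T$; $Tf$ denotes $f\circ T$. $\mathbb{T}=\mathbb{R}/\mathbb{Z}$, and $\phi(P(n))$ means $\phi$ evaluated at $P(n)\bmod 1$. $\mathbb{R}_k[t]$ denotes the set of polynomials with real coefficients of degree at most $k$. For an ergodic system, $\mathcal{E}_0(T)$ denotes the set of eigenvalues of $T$, and for $k\in\mathbb{N}$ one defines inductively $\mathcal{E}_k(T)=\{f\in L^\infty(\mu): |f|=1 \text{ and } Tf\cdot\bar f\in\mathcal{E}_{k-1}(T)\}$ (so $\mathcal{E}_1(T)$ consists of the unimodular eigenfunctions). $\mathcal{E}_k(T)^\perp$ denotes the set of $f\in L^1(\mu)$ with $\int f\,\bar g\,d\mu=0$ for all $g\in\mathcal{E}_k(T)$. *)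

theory Defs
  imports "HOL-Probability.Probability" "HOL-Computational_Algebra.Polynomial"
begin

definition mps :: "'a measure \<Rightarrow> ('a \<Rightarrow> 'a) \<Rightarrow> bool" where
  "mps M T \<longleftrightarrow> prob_space M \<and> T \<in> measurable M M \<and>
     (\<forall>A \<in> sets M. emeasure M (T -` A \<inter> space M) = emeasure M A)"

definition ergodic :: "'a measure \<Rightarrow> ('a \<Rightarrow> 'a) \<Rightarrow> bool" where
  "ergodic M T \<longleftrightarrow> mps M T \<and>
     (\<forall>A \<in> sets M. T -` A \<inter> space M = A \<longrightarrow> measure M A = 0 \<or> measure M A = 1)"

definition totally_ergodic :: "'a measure \<Rightarrow> ('a \<Rightarrow> 'a) \<Rightarrow> bool" where
  "totally_ergodic M T \<longleftrightarrow> mps M T \<and> (\<forall>r::nat. r \<ge> 1 \<longrightarrow> ergodic M (T ^^ r))"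

definition eigenvalue :: "'a measure \<Rightarrow> ('a \<Rightarrow> 'a) \<Rightarrow> complex \<Rightarrow> bool" where
  "eigenvalue M T c \<longleftrightarrow> (\<exists>g :: 'a \<Rightarrow> complex. g \<in> borel_measurable M \<and>
      integrable M (\<lambda>x. (cmod (g x))\<^sup>2) \<and> \<not> (AE x in M. g x = 0) \<and>
      (AE x in M. g (T x) = c * g x))"

text \<open>Membership in E_k(T). E_0(T) (the eigenvalues) is viewed as a set of
  constant functions, modulo mu-null sets.\<close>
fun in_E :: "'a measure \<Rightarrow> ('a \<Rightarrow> 'a) \<Rightarrow> nat \<Rightarrow> ('a \<Rightarrow> complex) \<Rightarrow> bool" where
  "in_E M T 0 f \<longleftrightarrow> f \<in> borel_measurable M \<and>
       (\<exists>c. eigenvalue M T c \<and> (AE x in M. f x = c))"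
| "in_E M T (Suc k) f \<longleftrightarrow> f \<in> borel_measurable M \<and> (AE x in M. cmod (f x) = 1) \<and>
       in_E M T k (\<lambda>x. f (T x) * cnj (f x))"

definition in_E_perp :: "'a measure \<Rightarrow> ('a \<Rightarrow> 'a) \<Rightarrow> nat \<Rightarrow> ('a \<Rightarrow> complex) \<Rightarrow> bool" where
  "in_E_perp M T k f \<longleftrightarrow> integrable M f \<and>
     (\<forall>g. in_E M T k g \<longrightarrow> (LINT x|M. f x * cnj (g x)) = 0)"

text \<open>Continuous functions on the torus R/Z, as continuous 1-periodic functions on R.\<close>
definition torus_cont :: "(real \<Rightarrow> complex) \<Rightarrow> bool" where
  "torus_cont \<phi> \<longleftrightarrow> continuous_on UNIV \<phi> \<and> (\<forall>t. \<phi> (t + 1) = \<phi> t)"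

definition wavg :: "('a \<Rightarrow> 'a) \<Rightarrow> ('a \<Rightarrow> complex) \<Rightarrow> (real \<Rightarrow> complex) \<Rightarrow> real poly \<Rightarrow> 'a \<Rightarrow> nat \<Rightarrow> complex" where
  "wavg T f \<phi> P x N = (\<Sum>n = 1..N. \<phi> (poly P (real n)) * f ((T ^^ n) x)) / of_nat N"

end

theory Submission
  imports Defs
begin

text \<open>
  The substantial implication is from (i) to (iii). Write \<open>\<Phi>\<^sub>N(x)\<close> for the supremum over \<open>P\<close> of the
  averages with \<open>\<phi>(t) = e(t)\<close>. Since \<open>N \<Phi>\<^sub>N\<close> is a subadditive cocycle, Birkhoff's theorem for the
  ergodic powers of \<open>T\<close> reduces the claim to \<open>\<integral> \<Phi>\<^sub>N d\<mu> \<longlonglongrightarrow> 0\<close>. Otherwise, choose almost optimal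
  polynomials \<open>P\<^sub>x\<close> measurably; the empirical averages of \<open>F(T\<^sup>n x, P\<^sub>x(\<sqdot> + n))\<close> have a cluster point,
  an invariant state \<open>L\<close> on the skew product of the system with the space of polynomials, such that
  \<open>L(f u) \<noteq> 0\<close> for \<open>u(x, P) = e(P(0))\<close>. The multiplicative derivative of \<open>u\<close> of order \<open>k + 1\<close> is \<open>1\<close>.
  Descending induction on the order \<open>j\<close> of the derivative that comes from the base shows that this
  is impossible when \<open>f\<close> is orthogonal to \<open>E\<^sub>k(T)\<close>. The step from \<open>j + 1\<close> to \<open>j\<close> uses van der Corput's
  inequality if no power of the \<open>j\<close>-th derivative correlates with the base; otherwise some power is
  an element of \<open>E\<^sub>k(T)\<close> times an invariant function, which is constant on a suitable extremal state,
  and one passes to a power of \<open>T\<close>.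

  For the implication from (ii) to (i), an element of \<open>E\<^sub>k(T)\<close> has the form \<open>e(P\<^sub>x(n))\<close> along the orbit
  of almost every \<open>x\<close>, with \<open>P\<^sub>x\<close> of degree at most \<open>k\<close>.
\<close>


section \<open>The pointwise ergodic theorem\<close>

text \<open>The space of polynomials is not compact, and the near-optimal choice of a polynomial at
  x is not controlled in any way. Limits of empirical averages are therefore taken among positive
  functionals instead of measures: compactness becomes Tychonoff's theorem, and no topology on
  polynomials enters the state space. The price is that disintegration is lost. Extremal functionals
  stand in for ergodic components, and conditional expectations exist over the base alone, where the
  marginal is a genuine measure and Radon-Nikodym applies.

  The obstacle in the induction is that differencing with step h turns the top derivative v into
  \<open>v ^ h\<close>, so all powers of v must be orthogonal to the base. A power may correlate
  with the base although v does not, for instance if v takes the values 1 and -1 with equal weight.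
  The r-th power of the transformation absorbs this, since its derivatives of order j are powers of
  exponent \<open>r ^ j\<close> of the original ones. Total ergodicity makes the passage harmless:
  the powers of T are ergodic and have no quasi-eigenfunctions beyond those of T. Each derivative
  moved to the base raises the class by one, and the count ends in the class of order k.\<close>

lemma mps_prob: "mps M T \<Longrightarrow> prob_space M"
  and mps_meas: "mps M T \<Longrightarrow> T \<in> measurable M M"
  by (auto simp: mps_def)

lemma mps_distr:
  assumes "mps M T"
  shows "distr M M T = M"
proof (rule measure_eqI)
  fix A assume "A \<in> sets (distr M M T)"
  then show "emeasure (distr M M T) A = emeasure M A"
    using assms by (simp add: emeasure_distr mps_def)
qed simp

lemma mps_integral:
  fixes h :: "'a \<Rightarrow> 'b::{banach, second_countable_topology}"
  assumes "mps M T" "h \<in> borel_measurable M"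
  shows "(\<integral>x. h (T x) \<partial>M) = (\<integral>x. h x \<partial>M)"
  using integral_distr[OF mps_meas[OF assms(1)] assms(2)] mps_distr[OF assms(1)] by simp

lemma mps_integrable:
  fixes h :: "'a \<Rightarrow> 'b::{banach, second_countable_topology}"
  assumes "mps M T" "integrable M h"
  shows "integrable M (\<lambda>x. h (T x))"
  using integrable_distr[OF mps_meas[OF assms(1)], of h] mps_distr[OF assms(1)] assms(2) by simp

lemma mps_AE:
  assumes "mps M T" "AE x in M. Q x"
  shows "AE x in M. Q (T x)"
proof -
  have "AE x in distr M M T. Q x"
    unfolding mps_distr[OF assms(1)] by (rule assms(2))
  from AE_distrD[OF mps_meas[OF assms(1)] this] show ?thesis .
qed

lemma mpsD: "mps M T \<Longrightarrow> A \<in> sets M \<Longrightarrow> emeasure M (T -` A \<inter> space M) = emeasure M A"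
  by (simp add: mps_def)

lemma mps_comp:
  assumes "mps M T" "mps M U"
  shows "mps M (T \<circ> U)"
  unfolding mps_def
proof (intro conjI ballI)
  show "prob_space M" "T \<circ> U \<in> measurable M M"
    using assms by (auto simp: mps_def)
  fix A assume A: "A \<in> sets M"
  have B: "T -` A \<inter> space M \<in> sets M"
    using mps_meas[OF assms(1)] A by (rule measurable_sets)
  have "(T \<circ> U) -` A \<inter> space M = U -` (T -` A \<inter> space M) \<inter> space M"
    using measurable_space[OF mps_meas[OF assms(2)]] by auto
  also have "emeasure M \<dots> = emeasure M A"
    unfolding mpsD[OF assms(2) B] by (rule mpsD[OF assms(1) A])
  finally show "emeasure M ((T \<circ> U) -` A \<inter> space M) = emeasure M A" .
qed

lemma mps_funpow:
  assumes "mps M T"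
  shows "mps M (T ^^ n)"
proof (induction n)
  case 0
  have "id -` A \<inter> space M = A" if "A \<in> sets M" for A
    using sets.sets_into_space[OF that] by auto
  then show ?case using mps_prob[OF assms] unfolding mps_def by simp
next
  case (Suc n)
  then show ?case unfolding funpow.simps by (rule mps_comp[OF assms])
qed

lemma mps_space: "mps M T \<Longrightarrow> x \<in> space M \<Longrightarrow> T x \<in> space M"
  by (rule measurable_space[OF mps_meas])

lemma mps_AE_funpow:
  assumes "mps M T" "AE x in M. Q x"
  shows "AE x in M. \<forall>n. Q ((T ^^ n) x)"
  using mps_AE[OF mps_funpow[OF assms(1)] assms(2)] by (simp add: AE_all_countable)

lemma ergodic_mps: "ergodic M T \<Longrightarrow> mps M T"
  by (simp add: ergodic_def)

text \<open>
  The maximum of \<open>0\<close> and the first \<open>N\<close> Birkhoff sums, in the recursive form on which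
  Garsia's proof of the maximal ergodic theorem rests.
\<close>

fun garsia :: "('a \<Rightarrow> 'a) \<Rightarrow> ('a \<Rightarrow> real) \<Rightarrow> nat \<Rightarrow> 'a \<Rightarrow> real" where
  "garsia T h 0 x = 0"
| "garsia T h (Suc N) x = max 0 (h x + garsia T h N (T x))"

lemma garsia_nonneg: "0 \<le> garsia T h N x"
  by (cases N) auto

lemma garsia_mono: "garsia T h N x \<le> garsia T h (Suc N) x"
proof (induction N arbitrary: x)
  case (Suc N)
  then show ?case by (smt (verit) garsia.simps(2))
qed simp

lemma garsia_mono_le: "N \<le> N' \<Longrightarrow> garsia T h N x \<le> garsia T h N' x"
  by (rule lift_Suc_mono_le[where f="\<lambda>N. garsia T h N x"]) (rule garsia_mono)

lemma birkhoff_sum_le_garsia: "(\<Sum>i<n. h ((T ^^ i) x)) \<le> garsia T h n x"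
proof (induction n arbitrary: x)
  case (Suc n)
  have "(\<Sum>i<Suc n. h ((T ^^ i) x)) = h x + (\<Sum>i<n. h ((T ^^ i) (T x)))"
    by (simp only: sum.lessThan_Suc_shift) (simp add: funpow_swap1)
  then show ?case using Suc[of "T x"] by simp
qed simp

lemma garsia_integrable:
  assumes "mps M T" "integrable M h"
  shows "integrable M (garsia T h N)"
proof (induction N)
  case (Suc N)
  have "integrable M (\<lambda>x. garsia T h N (T x))"
    using mps_integrable[OF assms(1) Suc] .
  then have "integrable M (\<lambda>x. max 0 (h x + garsia T h N (T x)))"
    using assms(2) by (intro integrable_max) auto
  then show ?case by simp
qed simp

text \<open>Where \<open>garsia T h (Suc N)\<close> is positive it equals h plus the translate of
  \<open>garsia T h N\<close>, which is at most h plus its own translate. A function minus its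
  translate has integral 0, so h has nonnegative integral over that set, and by \<open>pos\<close>
  these sets exhaust almost all of the space.\<close>

lemma maximal_ergodic:
  fixes h :: "'a \<Rightarrow> real"
  assumes T: "mps M T" and h: "integrable M h"
    and pos: "AE x in M. \<exists>n. (\<Sum>i<n. h ((T ^^ i) x)) > 0"
  shows "0 \<le> (\<integral>x. h x \<partial>M)"
proof -
  let ?m = "garsia T h"
  let ?g = "\<lambda>N x. indicator {y. ?m (Suc N) y > 0} x * h x"
  have [measurable]: "?m N \<in> borel_measurable M" for N
    using garsia_integrable[OF T h] by (rule borel_measurable_integrable)
  have [measurable]: "h \<in> borel_measurable M" using h by (rule borel_measurable_integrable)
  have int: "0 \<le> (\<integral>x. ?g N x \<partial>M)" for N
  proof -
    have gi: "integrable M (?g N)"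
      by (rule Bochner_Integration.integrable_bound[OF h])
         (measurable, auto simp: indicator_def simp del: garsia.simps)
    have mi: "integrable M (?m (Suc N))" "integrable M (\<lambda>x. ?m (Suc N) (T x))"
      by (rule garsia_integrable[OF T h], rule mps_integrable[OF T garsia_integrable[OF T h]])
    have "(\<integral>x. ?m (Suc N) x - ?m (Suc N) (T x) \<partial>M) \<le> (\<integral>x. ?g N x \<partial>M)"
    proof (rule integral_mono)
      fix x
      show "?m (Suc N) x - ?m (Suc N) (T x) \<le> ?g N x"
      proof (cases "?m (Suc N) x > 0")
        case True
        then have "?m (Suc N) x = h x + ?m N (T x)" by auto
        moreover have "?m N (T x) \<le> ?m (Suc N) (T x)" by (rule garsia_mono)
        ultimately show ?thesis using True by (simp del: garsia.simps)
      next
        case False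
        then show ?thesis using garsia_nonneg[of T h "Suc N" "T x"]
          by (simp del: garsia.simps)
      qed
    qed (use mi gi in \<open>auto simp del: garsia.simps\<close>)
    moreover have "(\<integral>x. ?m (Suc N) x - ?m (Suc N) (T x) \<partial>M) = 0"
      using mi mps_integral[OF T, of "?m (Suc N)"] by (simp del: garsia.simps)
    ultimately show ?thesis by simp
  qed
  have lim: "(\<lambda>N. \<integral>x. ?g N x \<partial>M) \<longlonglongrightarrow> (\<integral>x. h x \<partial>M)"
  proof (rule integral_dominated_convergence[where w="\<lambda>x. \<bar>h x\<bar>"])
    show "AE x in M. (\<lambda>N. ?g N x) \<longlonglongrightarrow> h x"
      using pos
    proof eventually_elim
      case (elim x)
      then obtain n where n: "(\<Sum>i<n. h ((T ^^ i) x)) > 0" by blast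
      have "?g N x = h x" if "N \<ge> n" for N
      proof -
        have "0 < ?m n x" using n birkhoff_sum_le_garsia[of h T x n] by linarith
        also have "\<dots> \<le> ?m (Suc N) x" using that by (intro garsia_mono_le) auto
        finally show ?thesis by (simp del: garsia.simps)
      qed
      then show ?case
        by (intro tendsto_eventually eventually_sequentiallyI[of n]) auto
    qed
    show "?g N \<in> borel_measurable M" for N by measurable
    show "integrable M (\<lambda>x. \<bar>h x\<bar>)" using h by simp
    show "AE x in M. norm (?g N x) \<le> \<bar>h x\<bar>" for N
      by (auto simp: indicator_def simp del: garsia.simps)
  qed fact
  show ?thesis by (rule LIMSEQ_le_const[OF lim]) (use int in auto)
qed

text \<open>Since \<open>h - c\<close> has negative integral, the maximal inequality forbids that
  its sums are unbounded above almost everywhere, and the zero-one law for invariant sets then makes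
  them bounded above almost everywhere. The bound K may depend on x; division by n removes it
  later.\<close>

lemma ergodic_birkhoff_upper:
  fixes h :: "'a \<Rightarrow> real"
  assumes T: "ergodic M T" and h: "integrable M h" and c: "(\<integral>x. h x \<partial>M) < c"
  shows "AE x in M. \<exists>K::nat. \<forall>n. (\<Sum>i<n. h ((T ^^ i) x)) \<le> c * n + K"
proof -
  have mp: "mps M T" using T by (rule ergodic_mps)
  interpret prob_space M using mp by (rule mps_prob)
  define h' where "h' = (\<lambda>x. h x - c)"
  define s where "s = (\<lambda>n x. \<Sum>i<n. h' ((T ^^ i) x))"
  \<comment> \<open>Unlike a set of large upper averages, this set is strictly invariant for trivial reasons.\<close>
  define A where "A = {x \<in> space M. \<forall>K::nat. \<exists>n. s n x > K}"
  have "h' \<in> borel_measurable M" unfolding h'_def using h by auto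
  then have "(\<lambda>x. h' ((T ^^ i) x)) \<in> borel_measurable M" for i
    by (rule measurable_compose[OF mps_meas[OF mps_funpow[OF mp]]])
  then have [measurable]: "s n \<in> borel_measurable M" for n
    unfolding s_def by (rule borel_measurable_sum)
  have A: "A \<in> sets M" unfolding A_def by measurable
  have s_Suc: "s (Suc n) x = h' x + s n (T x)" for n x
    unfolding s_def by (simp only: sum.lessThan_Suc_shift) (simp add: funpow_swap1)
  have "T -` A \<inter> space M = A"
  proof (intro set_eqI iffI)
    fix x assume "x \<in> T -` A \<inter> space M"
    then have x: "x \<in> space M" and u: "\<And>K::nat. \<exists>n. s n (T x) > K" by (auto simp: A_def)
    have "\<exists>n. s n x > K" for K :: nat
    proof -
      obtain n where "s n (T x) > nat \<lceil>K - h' x\<rceil>" using u by blast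
      then have "s (Suc n) x > K" unfolding s_Suc by linarith
      then show ?thesis by blast
    qed
    then show "x \<in> A" using x by (simp add: A_def)
  next
    fix x assume "x \<in> A"
    then have x: "x \<in> space M" and u: "\<And>K::nat. \<exists>n. s n x > K" by (auto simp: A_def)
    have "\<exists>n. s n (T x) > K" for K :: nat
    proof -
      obtain n where n: "s n x > nat \<lceil>K + h' x\<rceil>" using u by blast
      then obtain m where "n = Suc m" by (cases n) (auto simp: s_def)
      then have "h' x + s m (T x) > nat \<lceil>K + h' x\<rceil>" using n s_Suc[of m x] by simp
      then have "s m (T x) > K" by linarith
      then show ?thesis by blast
    qed
    then show "x \<in> T -` A \<inter> space M" using x mps_space[OF mp x] by (simp add: A_def)
  qed
  then have "prob A = 0 \<or> prob A = 1" using T A by (simp add: ergodic_def)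
  moreover have "prob A \<noteq> 1"
  proof
    assume "prob A = 1"
    then have "AE x in M. x \<in> A" using A by (simp add: prob_eq_1)
    then have "AE x in M. \<exists>n. (\<Sum>i<n. h' ((T ^^ i) x)) > 0"
    proof eventually_elim
      case (elim x)
      then obtain n where "s n x > real 0" unfolding A_def by blast
      then show ?case by (auto simp: s_def)
    qed
    then have "0 \<le> (\<integral>x. h' x \<partial>M)"
      using h by (intro maximal_ergodic[OF mp]) (auto simp: h'_def)
    then show False using c h by (simp add: h'_def prob_space)
  qed
  ultimately have "prob A = 0" by blast
  then have "AE x in M. x \<notin> A" using A by (simp add: prob_eq_0)
  then show ?thesis
  proof (rule AE_mp, intro AE_I2 impI)
    fix x assume "x \<in> space M" "x \<notin> A"
    then obtain K :: nat where "\<forall>n. s n x \<le> K" by (auto simp: A_def not_less)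
    moreover have "s n x = (\<Sum>i<n. h ((T ^^ i) x)) - c * n" for n
      by (simp add: s_def h'_def sum_subtractf)
    ultimately have "(\<Sum>i<n. h ((T ^^ i) x)) \<le> c * n + K" for n
      by (simp add: diff_le_eq add.commute)
    then show "\<exists>K::nat. \<forall>n. (\<Sum>i<n. h ((T ^^ i) x)) \<le> c * n + K" by blast
  qed
qed

lemma ergodic_birkhoff_eventually:
  fixes h :: "'a \<Rightarrow> real"
  assumes T: "ergodic M T" and h: "integrable M h"
  shows "AE x in M. \<forall>e>0. \<forall>\<^sub>F n in sequentially. (\<Sum>i<n. h ((T ^^ i) x)) / real n < (\<integral>x. h x \<partial>M) + e"
proof -
  \<comment> \<open>The null set depends on the slope, so the slopes are taken from a countable
    family.\<close>
  have "AE x in M. \<forall>j::nat. \<exists>K::nat. \<forall>n. (\<Sum>i<n. h ((T ^^ i) x)) \<le> ((\<integral>x. h x \<partial>M) + 1 / Suc j) * n + K"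
  proof -
    have "AE x in M. \<exists>K::nat. \<forall>n. (\<Sum>i<n. h ((T ^^ i) x)) \<le> ((\<integral>x. h x \<partial>M) + 1 / Suc j) * n + K" for j
      by (rule ergodic_birkhoff_upper[OF T h]) simp
    then show ?thesis by (subst AE_all_countable) blast
  qed
  then show ?thesis
  proof (rule AE_mp, intro AE_I2 impI)
    fix x assume elim: "\<forall>j::nat. \<exists>K::nat. \<forall>n. (\<Sum>i<n. h ((T ^^ i) x)) \<le> ((\<integral>x. h x \<partial>M) + 1 / Suc j) * n + K"
    show "\<forall>e>0. \<forall>\<^sub>F n in sequentially. (\<Sum>i<n. h ((T ^^ i) x)) / real n < (\<integral>x. h x \<partial>M) + e"
    proof (intro allI impI)
      fix e :: real assume "e > 0"
      then have "e / 2 > 0" by simp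
      from reals_Archimedean[OF this] obtain j :: nat where j: "1 / Suc j < e / 2"
        unfolding inverse_eq_divide by blast
      obtain K :: nat where K: "\<And>n. (\<Sum>i<n. h ((T ^^ i) x)) \<le> ((\<integral>x. h x \<partial>M) + 1 / Suc j) * n + K"
        using elim by blast
      have "(\<lambda>n. real K / real n) \<longlonglongrightarrow> 0" by (rule lim_const_over_n)
      then have "\<forall>\<^sub>F n in sequentially. real K / real n < e / 2"
        by (rule order_tendstoD(2)) (use \<open>e > 0\<close> in simp)
      then show "\<forall>\<^sub>F n in sequentially. (\<Sum>i<n. h ((T ^^ i) x)) / real n < (\<integral>x. h x \<partial>M) + e"
        using eventually_gt_at_top[of 0]
      proof eventually_elim
        case (elim n)
        have "(\<Sum>i<n. h ((T ^^ i) x)) / real n \<le> (((\<integral>x. h x \<partial>M) + 1 / Suc j) * n + K) / n"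
          by (rule divide_right_mono[OF K]) simp
        also have "\<dots> = (\<integral>x. h x \<partial>M) + 1 / Suc j + K / n"
          using elim by (simp add: add_divide_distrib)
        finally show ?case using j elim by linarith
      qed
    qed
  qed
qed

lemma ergodic_birkhoff_real:
  fixes h :: "'a \<Rightarrow> real"
  assumes T: "ergodic M T" and h: "integrable M h"
  shows "AE x in M. (\<lambda>n. (\<Sum>i<n. h ((T ^^ i) x)) / real n) \<longlonglongrightarrow> (\<integral>x. h x \<partial>M)"
proof -
  have "integrable M (\<lambda>x. - h x)" using h by simp
  from ergodic_birkhoff_eventually[OF T this] ergodic_birkhoff_eventually[OF T h]
  show ?thesis
  proof eventually_elim
    case (elim x)
    show ?case
    proof (rule order_tendstoI)
      fix a assume "a < (\<integral>x. h x \<partial>M)"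
      then have "\<forall>\<^sub>F n in sequentially. (\<Sum>i<n. - h ((T ^^ i) x)) / real n < - a"
        using elim(1)[rule_format, of "(\<integral>x. h x \<partial>M) - a"] by simp
      then show "\<forall>\<^sub>F n in sequentially. a < (\<Sum>i<n. h ((T ^^ i) x)) / real n"
        by eventually_elim (simp add: sum_negf)
    next
      fix a assume "(\<integral>x. h x \<partial>M) < a"
      then show "\<forall>\<^sub>F n in sequentially. (\<Sum>i<n. h ((T ^^ i) x)) / real n < a"
        using elim(2)[rule_format, of "a - (\<integral>x. h x \<partial>M)"] by simp
    qed
  qed
qed

theorem ergodic_birkhoff:
  fixes h :: "'a \<Rightarrow> complex"
  assumes T: "ergodic M T" and h: "integrable M h"
  shows "AE x in M. (\<lambda>n. (\<Sum>i<n. h ((T ^^ i) x)) / of_nat n) \<longlonglongrightarrow> (\<integral>x. h x \<partial>M)"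
  using ergodic_birkhoff_real[OF T integrable_Re[OF h]] ergodic_birkhoff_real[OF T integrable_Im[OF h]]
proof eventually_elim
  case (elim x)
  then show ?case
    unfolding tendsto_complex_iff integral_Re[OF h, symmetric] integral_Im[OF h, symmetric]
      Re_divide_of_nat Im_divide_of_nat Re_sum Im_sum by blast
qed

text \<open>The averages in \<open>wavg\<close> start at n = 1; they are the sums from 0 seen from
  \<open>T x\<close>, and \<open>mps_AE\<close> carries the ergodic theorem over to them.\<close>

lemma birkhoff_shift:
  "(\<Sum>i<n. h ((T ^^ i) (T x))) = (\<Sum>i=1..n. h ((T ^^ i) x))"
proof -
  have "(\<Sum>i=1..n. h ((T ^^ i) x)) = (\<Sum>i<n. h ((T ^^ Suc i) x))"
    by (rule sum.reindex_bij_witness[of _ Suc "\<lambda>i. i - 1"]) auto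
  then show ?thesis by (simp add: funpow_swap1)
qed

lemma ergodic_birkhoff_from_1:
  fixes h :: "'a \<Rightarrow> complex"
  assumes T: "ergodic M T" and h: "integrable M h"
  shows "AE x in M. (\<lambda>n. (\<Sum>i=1..n. h ((T ^^ i) x)) / of_nat n) \<longlonglongrightarrow> (\<integral>x. h x \<partial>M)"
  using mps_AE[OF ergodic_mps[OF T] ergodic_birkhoff[OF T h]] unfolding birkhoff_shift .

lemma ergodic_birkhoff_real_from_1:
  fixes h :: "'a \<Rightarrow> real"
  assumes T: "ergodic M T" and h: "integrable M h"
  shows "AE x in M. (\<lambda>n. (\<Sum>i=1..n. h ((T ^^ i) x)) / real n) \<longlonglongrightarrow> (\<integral>x. h x \<partial>M)"
  using mps_AE[OF ergodic_mps[OF T] ergodic_birkhoff_real[OF T h]] unfolding birkhoff_shift .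

text \<open>Along almost every orbit h is constant, so its averages equal \<open>h x\<close> and at
  the same time converge to the integral.\<close>

lemma ergodic_invariant_const:
  fixes h :: "'a \<Rightarrow> complex"
  assumes T: "ergodic M T" and h: "integrable M h" and inv: "AE x in M. h (T x) = h x"
  shows "AE x in M. h x = (\<integral>x. h x \<partial>M)"
  using mps_AE_funpow[OF ergodic_mps[OF T] inv] ergodic_birkhoff[OF T h]
proof eventually_elim
  case (elim x)
  have "h ((T ^^ n) x) = h x" for n
    by (induction n) (use elim(1) in auto)
  then have "(\<lambda>n. h x * of_nat n / of_nat n) \<longlonglongrightarrow> (\<integral>x. h x \<partial>M)"
    using elim(2) by (simp add: mult.commute)
  moreover have "(\<lambda>n. h x * of_nat n / of_nat n) \<longlonglongrightarrow> h x"
    by (intro tendsto_eventually eventually_sequentiallyI[of 1]) auto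
  ultimately show ?case by (rule LIMSEQ_unique[rotated])
qed

section \<open>Multiplicative derivatives and quasi-eigenfunctions\<close>

text \<open>A quotient written with the conjugate as inverse: for F = e(G) with real G it is e of
  the difference of G along \<tau>.\<close>

definition mder :: "('c \<Rightarrow> 'c) \<Rightarrow> ('c \<Rightarrow> complex) \<Rightarrow> 'c \<Rightarrow> complex" where
  "mder \<tau> F = (\<lambda>\<omega>. F (\<tau> \<omega>) * cnj (F \<omega>))"

lemma mult_cnj_unimodular: "cmod z = 1 \<Longrightarrow> z * cnj z = 1"
  using complex_norm_square[of z] by simp

lemma borel_measurable_cnj [measurable (raw)]:
  "g \<in> borel_measurable M \<Longrightarrow> (\<lambda>x. cnj (g x)) \<in> borel_measurable M"
  by (erule measurable_compose) (auto intro!: borel_measurable_continuous_onI continuous_intros)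

lemma mder_mult: "mder \<tau> (\<lambda>\<omega>. F \<omega> * G \<omega>) = (\<lambda>\<omega>. mder \<tau> F \<omega> * mder \<tau> G \<omega>)"
  by (auto simp: mder_def)

lemma mder_cnj: "mder \<tau> (\<lambda>\<omega>. cnj (F \<omega>)) = (\<lambda>\<omega>. cnj (mder \<tau> F \<omega>))"
  by (auto simp: mder_def)

lemma mder_comp:
  assumes "\<And>\<omega>. \<tau> (\<sigma> \<omega>) = \<sigma> (\<tau> \<omega>)"
  shows "mder \<tau> (\<lambda>\<omega>. F (\<sigma> \<omega>)) = (\<lambda>\<omega>. mder \<tau> F (\<sigma> \<omega>))"
  using assms by (auto simp: mder_def)

text \<open>Telescoping: the quotient over r steps is the product of the quotients over single
  steps.\<close>

lemma mder_funpow: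
  assumes "\<And>\<omega>. cmod (F \<omega>) = 1"
  shows "mder (\<tau> ^^ r) F = (\<lambda>\<omega>. \<Prod>l<r. mder \<tau> F ((\<tau> ^^ l) \<omega>))"
proof (induction r)
  case 0
  then show ?case using assms by (auto simp: mder_def mult_cnj_unimodular)
next
  case (Suc r)
  show ?case
  proof
    fix \<omega>
    have "cnj (F ((\<tau> ^^ r) \<omega>)) * F ((\<tau> ^^ r) \<omega>) = 1"
      using mult_cnj_unimodular[OF assms] by (simp add: mult.commute)
    then have "F (\<tau> ((\<tau> ^^ r) \<omega>)) * cnj (F ((\<tau> ^^ r) \<omega>)) * (F ((\<tau> ^^ r) \<omega>) * cnj (F \<omega>))
        = F (\<tau> ((\<tau> ^^ r) \<omega>)) * cnj (F \<omega>)"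
      by (metis mult.assoc mult.left_neutral)
    then have "mder (\<tau> ^^ Suc r) F \<omega> = mder \<tau> F ((\<tau> ^^ r) \<omega>) * mder (\<tau> ^^ r) F \<omega>"
      by (simp add: mder_def)
    also have "\<dots> = (\<Prod>l<Suc r. mder \<tau> F ((\<tau> ^^ l) \<omega>))"
      unfolding Suc by (simp add: mult.commute)
    finally show "mder (\<tau> ^^ Suc r) F \<omega> = (\<Prod>l<Suc r. mder \<tau> F ((\<tau> ^^ l) \<omega>))" .
  qed
qed

text \<open>
  \<open>qeig M T (Suc k)\<close> is the class \<open>E\<^sub>k(T)\<close> of the paper for \<open>k \<ge> 1\<close>, with representatives
  that are unimodular everywhere; starting the recursion one level lower, at the constant \<open>1\<close>,
  makes the constants the next class and avoids eigenvalues.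
\<close>

primrec qeig :: "'a measure \<Rightarrow> ('a \<Rightarrow> 'a) \<Rightarrow> nat \<Rightarrow> ('a \<Rightarrow> complex) \<Rightarrow> bool" where
  "qeig M T 0 g \<longleftrightarrow> g \<in> borel_measurable M \<and> (\<forall>x. cmod (g x) = 1) \<and> (AE x in M. g x = 1)"
| "qeig M T (Suc d) g \<longleftrightarrow> g \<in> borel_measurable M \<and> (\<forall>x. cmod (g x) = 1) \<and> qeig M T d (mder T g)"

lemma qeig_measurable: "qeig M T d g \<Longrightarrow> g \<in> borel_measurable M"
  by (cases d) auto

lemma qeig_cmod: "qeig M T d g \<Longrightarrow> cmod (g x) = 1"
  by (cases d) auto

lemma mder_measurable:
  assumes "mps M T" "g \<in> borel_measurable M"
  shows "mder T g \<in> borel_measurable M"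
  unfolding mder_def
  by (intro borel_measurable_times borel_measurable_cnj assms(2)
      measurable_compose[OF mps_meas[OF assms(1)] assms(2)])

lemma qeig_mult:
  assumes "qeig M T d f" "qeig M T d g"
  shows "qeig M T d (\<lambda>x. f x * g x)"
  using assms
proof (induction d arbitrary: f g)
  case 0
  then have "AE x in M. f x = 1" "AE x in M. g x = 1" by auto
  then have "AE x in M. f x * g x = 1" by eventually_elim simp
  with 0 show ?case by (auto simp: norm_mult)
next
  case (Suc d)
  then show ?case by (auto simp: norm_mult mder_mult)
qed

lemma qeig_cnj:
  assumes "qeig M T d f"
  shows "qeig M T d (\<lambda>x. cnj (f x))"
  using assms
proof (induction d arbitrary: f)
  case 0
  then have "AE x in M. f x = 1" by auto
  then have "AE x in M. cnj (f x) = 1" by eventually_elim simp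
  with 0 show ?case by auto
next
  case (Suc d)
  then show ?case by (auto simp: mder_cnj)
qed

lemma qeig_shift:
  assumes "mps M T" "qeig M T d f"
  shows "qeig M T d (\<lambda>x. f (T x))"
  using assms(2)
proof (induction d arbitrary: f)
  case 0
  then have "AE x in M. f (T x) = 1" by (intro mps_AE[OF assms(1)]) auto
  with 0 show ?case using measurable_compose[OF mps_meas[OF assms(1)]] by auto
next
  case (Suc d)
  then show ?case
    using measurable_compose[OF mps_meas[OF assms(1)]] by (auto simp: mder_comp)
qed

lemma qeig_shift_funpow:
  assumes "mps M T" "qeig M T d f"
  shows "qeig M T d (\<lambda>x. f ((T ^^ n) x))"
proof (induction n)
  case (Suc n)
  from qeig_shift[OF assms(1) Suc] show ?case by (simp add: funpow_swap1)
qed (use assms in simp)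

lemma qeig_one: "qeig M T d (\<lambda>x. 1)"
proof (induction d)
  case (Suc d)
  then show ?case by (simp add: mder_def)
qed simp

lemma qeig_power:
  assumes "qeig M T d f"
  shows "qeig M T d (\<lambda>x. f x ^ n)"
proof (induction n)
  case (Suc n)
  then show ?case using qeig_mult[OF assms Suc] by simp
qed (simp add: qeig_one)

lemma qeig_Suc:
  assumes "mps M T" "qeig M T d f"
  shows "qeig M T (Suc d) f"
  using assms(2)
proof (induction d arbitrary: f)
  case 0
  then have 1: "AE x in M. f x = 1" by auto
  from 1 mps_AE[OF assms(1) 1] have "AE x in M. mder T f x = 1"
    by eventually_elim (simp add: mder_def)
  with 0 show ?case
    using mder_measurable[OF assms(1)] by (auto simp: mder_def norm_mult)
next
  case (Suc d)
  then show ?case by auto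
qed

lemma qeig_const:
  assumes "mps M T" "cmod c = 1"
  shows "qeig M T (Suc d) (\<lambda>x. c)"
  using assms mult_cnj_unimodular[OF assms(2)] by (simp add: mder_def qeig_one)

lemma qeig_cong:
  assumes "mps M T" "qeig M T d f" "AE x in M. f x = g x"
    "g \<in> borel_measurable M" "\<And>x. cmod (g x) = 1"
  shows "qeig M T d g"
  using assms(2-)
proof (induction d arbitrary: f g)
  case 0
  then have "AE x in M. f x = 1" by auto
  with 0(2) have "AE x in M. g x = 1" by eventually_elim simp
  with 0 show ?case by auto
next
  case (Suc d)
  have "AE x in M. mder T f x = mder T g x"
    using Suc(3) mps_AE[OF assms(1) Suc(3)] by eventually_elim (simp add: mder_def)
  moreover have "cmod (mder T g x) = 1" for x using Suc(5) by (simp add: mder_def norm_mult)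
  ultimately have "qeig M T d (mder T g)"
    using Suc(1)[of "mder T f" "mder T g"] Suc(2,4) mder_measurable[OF assms(1)] by auto
  with Suc show ?case by auto
qed

lemma ergodic_unimodular_const:
  fixes g :: "'a \<Rightarrow> complex"
  assumes T: "ergodic M T" and g: "g \<in> borel_measurable M" "\<And>x. cmod (g x) = 1"
    and inv: "AE x in M. g (T x) = g x"
  obtains c where "cmod c = 1" "AE x in M. g x = c"
proof -
  interpret prob_space M using T by (intro mps_prob ergodic_mps)
  have "integrable M g"
    by (rule integrable_const_bound[where B=1]) (use g in auto)
  from ergodic_invariant_const[OF T this inv] have c: "AE x in M. g x = (\<integral>x. g x \<partial>M)" .
  then obtain x where "g x = (\<integral>x. g x \<partial>M)"
    using AE_contr[of "\<lambda>x. g x \<noteq> (\<integral>x. g x \<partial>M)"] by (metis (mono_tags, lifting) AE_mp AE_I2)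
  then have "cmod (\<integral>x. g x \<partial>M) = 1" using g(2)[of x] by simp
  with c show thesis using that by blast
qed

text \<open>Total ergodicity enters here: \<open>T\<close> and its powers have the same quasi-eigenfunctions.\<close>

lemma qeig_root:
  assumes T: "mps M T" and Tm: "ergodic M (T ^^ m)"
    and g: "g \<in> borel_measurable M" "\<And>x. cmod (g x) = 1"
    and chi: "qeig M T d \<xi>" and eq: "AE x in M. g ((T ^^ m) x) = \<xi> x * g x"
  shows "qeig M T (Suc d) g"
  using g chi eq
proof (induction d arbitrary: g \<xi>)
  case 0
  then have "AE x in M. \<xi> x = 1" by simp
  with 0(4) have "AE x in M. g ((T ^^ m) x) = g x" by eventually_elim simp
  then obtain c where c: "cmod c = 1" "AE x in M. g x = c"
    by (rule ergodic_unimodular_const[OF Tm 0(1,2)])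
  show ?case
    by (rule qeig_cong[OF T qeig_const[OF T c(1)]]) (use c 0 in auto)
next
  case (Suc d)
  have "AE x in M. mder T g ((T ^^ m) x) = mder T \<xi> x * mder T g x"
    using Suc(5) mps_AE[OF T Suc(5)]
    by eventually_elim (simp add: mder_def funpow_swap1)
  moreover have "qeig M T d (mder T \<xi>)" using Suc(4) by simp
  moreover have "cmod (mder T g x) = 1" for x using Suc(3) by (simp add: mder_def norm_mult)
  ultimately have "qeig M T (Suc d) (mder T g)"
    using mder_measurable[OF T Suc(2)] by (intro Suc(1)) auto
  with Suc show ?case by simp
qed

section \<open>Comparison of the two hierarchies of eigenfunctions\<close>

lemma in_E_measurable: "in_E M T k f \<Longrightarrow> f \<in> borel_measurable M"
  by (cases k) auto

text \<open>The function g is a representative that is unimodular everywhere, as \<open>qeig\<close>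
  asks. The recursions match at the bottom because a unimodular constant has derivative 1.\<close>

lemma in_E_imp_qeig:
  assumes T: "mps M T" and "in_E M T k f" "AE x in M. f x = g x"
    "g \<in> borel_measurable M" "\<And>x. cmod (g x) = 1"
  shows "qeig M T (Suc k) g"
  using assms(2-)
proof (induction k arbitrary: f g)
  case 0
  then obtain c where "AE x in M. f x = c" by auto
  with 0(2) have c: "AE x in M. g x = c" by eventually_elim simp
  from c mps_AE[OF T c] have "AE x in M. mder T g x = 1"
    by eventually_elim (metis 0(4) mder_def mult_cnj_unimodular)
  with 0 show ?case
    using mder_measurable[OF T] by (auto simp: mder_def norm_mult)
next
  case (Suc k)
  have "AE x in M. f (T x) * cnj (f x) = mder T g x"
    using Suc(3) mps_AE[OF T Suc(3)] by eventually_elim (simp add: mder_def)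
  moreover have "cmod (mder T g x) = 1" for x using Suc(5) by (simp add: mder_def norm_mult)
  moreover have "mder T g \<in> borel_measurable M" using mder_measurable[OF T] Suc by auto
  ultimately have "qeig M T (Suc k) (mder T g)"
    using Suc(1)[of "\<lambda>x. f (T x) * cnj (f x)" "mder T g"] Suc(2) by auto
  then show ?case using Suc by simp
qed

lemma in_E_representative:
  assumes T: "mps M T" and f: "in_E M T (Suc k) f"
  obtains g where "qeig M T (Suc (Suc k)) g" "AE x in M. f x = g x"
proof -
  \<comment> \<open>The value 1 is placed on the null set where the modulus of f differs from
    1.\<close>
  define g where "g = (\<lambda>x. if cmod (f x) = 1 then f x else 1)"
  have [measurable]: "f \<in> borel_measurable M" using f by simp
  have "g \<in> borel_measurable M" unfolding g_def by measurable
  moreover have "AE x in M. f x = g x" using f by (auto simp: g_def)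
  moreover have "cmod (g x) = 1" for x by (simp add: g_def)
  ultimately show thesis using that in_E_imp_qeig[OF T f] by blast
qed

text \<open>At the bottom the second derivative of g is 1, so the first is invariant and by
  ergodicity a constant c. Membership also asks that c be an eigenvalue, and g itself is an
  eigenfunction for it.\<close>

lemma qeig_imp_in_E:
  assumes T: "ergodic M T" and "qeig M T (Suc (Suc k)) g"
  shows "in_E M T (Suc k) g"
  using assms(2)
proof (induction k arbitrary: g)
  case 0
  have mp: "mps M T" using T by (rule ergodic_mps)
  interpret prob_space M using mp by (rule mps_prob)
  let ?p = "mder T g"
  have g: "g \<in> borel_measurable M" "\<And>x. cmod (g x) = 1"
    and p: "?p \<in> borel_measurable M" "\<And>x. cmod (?p x) = 1"
    and pp: "AE x in M. mder T ?p x = 1" using 0 by auto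
  from pp have "AE x in M. ?p (T x) = ?p x"
  proof eventually_elim
    case (elim x)
    then have "?p (T x) * (cnj (?p x) * ?p x) = ?p x"
      by (simp add: mder_def[of T "mder T g"] mult.assoc[symmetric])
    then show ?case using mult_cnj_unimodular[OF p(2)[of x]] by (simp add: mult.commute)
  qed
  then obtain c where c: "cmod c = 1" "AE x in M. ?p x = c"
    by (rule ergodic_unimodular_const[OF T p])
  have "AE x in M. g (T x) = c * g x"
    using c(2)
  proof eventually_elim
    case (elim x)
    have "g (T x) * (cnj (g x) * g x) = c * g x"
      using elim by (simp add: mder_def mult.assoc[symmetric])
    then show ?case using mult_cnj_unimodular[OF g(2)[of x]] by (simp add: mult.commute)
  qed
  moreover have "\<not> (AE x in M. g x = 0)"
  proof
    assume "AE x in M. g x = 0"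
    then have "AE x in M. False" by eventually_elim (metis g(2) norm_zero zero_neq_one)
    then show False by simp
  qed
  moreover have "integrable M (\<lambda>x. (cmod (g x))\<^sup>2)" using g by simp
  ultimately have "eigenvalue M T c" using g by (auto simp: eigenvalue_def)
  then show ?case using g p c(2) by (auto simp: mder_def)
next
  case (Suc k)
  then have "in_E M T (Suc k) (mder T g)" by simp
  then show ?case using Suc(2) by (simp add: mder_def)
qed

lemma integral_qeig_eq_0:
  assumes "ergodic M T" "in_E_perp M T k f" "k \<ge> 1" "qeig M T (Suc k) g"
  shows "(\<integral>x. f x * g x \<partial>M) = 0"
proof -
  obtain j where k: "k = Suc j" using assms(3) by (cases k) auto
  have "in_E M T k (\<lambda>x. cnj (g x))"
    using qeig_imp_in_E[OF assms(1)] qeig_cnj[OF assms(4)] unfolding k by blast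
  then have "(\<integral>x. f x * cnj (cnj (g x)) \<partial>M) = 0"
    using assms(2) unfolding in_E_perp_def by blast
  then show ?thesis by simp
qed

text \<open>Bounded functions are dense: truncation at height n leaves a remainder that tends to 0
  in \<open>L\<^sup>1\<close>. Later arguments multiply a function on the base with its translates
  or replace it by a constant bound, which this reduction makes legitimate.\<close>

lemma L1_functional_eq_0:
  fixes L :: "('a \<Rightarrow> complex) \<Rightarrow> complex"
  assumes f: "integrable M f"
    and add: "\<And>f g. integrable M f \<Longrightarrow> integrable M g \<Longrightarrow> L (\<lambda>x. f x + g x) = L f + L g"
    and bound: "\<And>f. integrable M f \<Longrightarrow> cmod (L f) \<le> C * (\<integral>x. cmod (f x) \<partial>M)"
    and zero: "\<And>f K. integrable M f \<Longrightarrow> (\<And>x. cmod (f x) \<le> K) \<Longrightarrow> L f = 0"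
  shows "L f = 0"
proof -
  define t where "t = (\<lambda>(n::nat) x. if cmod (f x) \<le> n then f x else 0)"
  have [measurable]: "f \<in> borel_measurable M" using f by auto
  have t: "integrable M (t n)" for n
    by (rule Bochner_Integration.integrable_bound[OF f]) (auto simp: t_def)
  have d: "integrable M (\<lambda>x. f x - t n x)" for n using f t by auto
  have le: "cmod (L f) \<le> C * (\<integral>x. cmod (f x - t n x) \<partial>M)" for n
  proof -
    have "L f = L (t n) + L (\<lambda>x. f x - t n x)" using add[OF t[of n] d[of n]] by simp
    moreover have "L (t n) = 0" by (rule zero[OF t, of _ n]) (auto simp: t_def)
    ultimately show ?thesis using bound[OF d[of n]] by simp
  qed
  have "(\<lambda>n. \<integral>x. cmod (f x - t n x) \<partial>M) \<longlonglongrightarrow> (\<integral>x. 0 \<partial>M)"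
  proof (rule integral_dominated_convergence[where w="\<lambda>x. cmod (f x)"])
    show "AE x in M. (\<lambda>n. cmod (f x - t n x)) \<longlonglongrightarrow> 0"
    proof (rule AE_I2)
      fix x
      have "\<forall>\<^sub>F n in sequentially. cmod (f x - t n x) = 0"
        using eventually_ge_at_top[of "nat \<lceil>cmod (f x)\<rceil>"]
        by eventually_elim (auto simp: t_def)
      then show "(\<lambda>n. cmod (f x - t n x)) \<longlonglongrightarrow> 0" by (rule tendsto_eventually)
    qed
  qed (use f in \<open>auto simp: t_def\<close>)
  then have "(\<lambda>n. C * (\<integral>x. cmod (f x - t n x) \<partial>M)) \<longlonglongrightarrow> C * 0"
    by (intro tendsto_mult_left) simp
  from LIMSEQ_le_const[OF this, of "cmod (L f)"] le show ?thesis by auto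
qed

section \<open>States on a skew product\<close>

text \<open>
  The second factor carries no \<open>\<sigma>\<close>-algebra (it will be the set of real polynomials): only
  measurability in the first variable is required. A state is a positive linear functional, that
  is, a finitely additive measure on the skew product, whose marginal on the base is \<open>M\<close>. Its
  \<open>L\<^sup>1\<close> seminorm \<open>nrm\<close> provides the substitute \<open>aeq\<close> for almost everywhere equality.
\<close>

definition adm :: "'a measure \<Rightarrow> ('a \<times> 'b \<Rightarrow> complex) set" where
  "adm M = {F. (\<forall>b. (\<lambda>x. F (x, b)) \<in> borel_measurable M) \<and>
     (\<exists>D::'a \<Rightarrow> real. integrable M D \<and> (\<forall>x\<in>space M. \<forall>b. cmod (F (x, b)) \<le> D x))}"

text \<open>The multipliers of \<open>adm M\<close>, whose own members need not have admissible
  products.\<close>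

definition bfun :: "'a measure \<Rightarrow> ('a \<times> 'b \<Rightarrow> complex) set" where
  "bfun M = {F. (\<forall>b. (\<lambda>x. F (x, b)) \<in> borel_measurable M) \<and>
     (\<exists>C::real. \<forall>x\<in>space M. \<forall>b. cmod (F (x, b)) \<le> C)}"

text \<open>The modulus is 1 at every point, also outside \<open>space M\<close>, so that
  conjugation is an exact inverse in pointwise identities.\<close>

definition um :: "'a measure \<Rightarrow> ('a \<times> 'b \<Rightarrow> complex) set" where
  "um M = {F. (\<forall>b. (\<lambda>x. F (x, b)) \<in> borel_measurable M) \<and> (\<forall>\<omega>. cmod (F \<omega>) = 1)}"

lemma admI:
  assumes "\<And>b. (\<lambda>x. F (x, b)) \<in> borel_measurable M" "integrable M D"
    "\<And>x b. x \<in> space M \<Longrightarrow> cmod (F (x, b)) \<le> D x"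
  shows "F \<in> adm M"
  using assms by (auto simp: adm_def)

lemma admE:
  assumes "F \<in> adm M"
  obtains D :: "'a \<Rightarrow> real" where "integrable M D" "\<And>x b. x \<in> space M \<Longrightarrow> cmod (F (x, b)) \<le> D x"
  using assms by (auto simp: adm_def)

lemma adm_measurable: "F \<in> adm M \<Longrightarrow> (\<lambda>x. F (x, b)) \<in> borel_measurable M"
  by (auto simp: adm_def)

lemma bfunI:
  assumes "\<And>b. (\<lambda>x. F (x, b)) \<in> borel_measurable M"
    "\<And>x b. x \<in> space M \<Longrightarrow> cmod (F (x, b)) \<le> C"
  shows "F \<in> bfun M"
  using assms by (auto simp: bfun_def)

lemma bfunE:
  assumes "F \<in> bfun M"
  obtains C :: real where "C \<ge> 0" "\<And>x b. x \<in> space M \<Longrightarrow> cmod (F (x, b)) \<le> C"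
proof -
  obtain C where "\<And>x b. x \<in> space M \<Longrightarrow> cmod (F (x, b)) \<le> C"
    using assms by (auto simp: bfun_def)
  then have "max 0 C \<ge> 0" "\<And>x b. x \<in> space M \<Longrightarrow> cmod (F (x, b)) \<le> max 0 C"
    by (auto intro: max.coboundedI2)
  then show thesis by (rule that)
qed

lemma bfun_measurable: "F \<in> bfun M \<Longrightarrow> (\<lambda>x. F (x, b)) \<in> borel_measurable M"
  by (auto simp: bfun_def)

lemma um_measurable: "F \<in> um M \<Longrightarrow> (\<lambda>x. F (x, b)) \<in> borel_measurable M"
  by (auto simp: um_def)

lemma um_cmod: "F \<in> um M \<Longrightarrow> cmod (F \<omega>) = 1"
  unfolding um_def by blast

lemma um_bfun: "F \<in> um M \<Longrightarrow> F \<in> bfun M"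
  by (rule bfunI[where C=1]) (auto simp: um_def)

lemma adm_add:
  assumes "F \<in> adm M" "G \<in> adm M"
  shows "(\<lambda>\<omega>. F \<omega> + G \<omega>) \<in> adm M"
proof -
  from assms obtain D E where D: "integrable M D" "\<And>x b. x \<in> space M \<Longrightarrow> cmod (F (x, b)) \<le> D x"
    and E: "integrable M E" "\<And>x b. x \<in> space M \<Longrightarrow> cmod (G (x, b)) \<le> E x"
    by (metis admE)
  show ?thesis
  proof (rule admI[where D="\<lambda>x. D x + E x"])
    fix x b assume "x \<in> space M"
    then show "cmod (F (x, b) + G (x, b)) \<le> D x + E x"
      by (intro order_trans[OF norm_triangle_ineq] add_mono D E)
  qed (use D E assms[THEN adm_measurable] in auto)
qed

lemma adm_mult:
  assumes "F \<in> adm M" "G \<in> bfun M"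
  shows "(\<lambda>\<omega>. F \<omega> * G \<omega>) \<in> adm M"
proof -
  from assms(1) obtain D where D: "integrable M D" "\<And>x b. x \<in> space M \<Longrightarrow> cmod (F (x, b)) \<le> D x"
    by (metis admE)
  from assms(2) obtain C where C: "C \<ge> 0" "\<And>x b. x \<in> space M \<Longrightarrow> cmod (G (x, b)) \<le> C"
    by (metis bfunE)
  show ?thesis
  proof (rule admI[where D="\<lambda>x. D x * C"])
    fix x b assume "x \<in> space M"
    moreover have "0 \<le> D x" using D(2)[OF \<open>x \<in> space M\<close>, of b] by (rule order_trans[OF norm_ge_zero])
    ultimately show "cmod (F (x, b) * G (x, b)) \<le> D x * C"
      unfolding norm_mult by (intro mult_mono D C) auto
  qed (use D adm_measurable[OF assms(1)] bfun_measurable[OF assms(2)] in auto)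
qed

lemma adm_scale: "F \<in> adm M \<Longrightarrow> (\<lambda>\<omega>. c * F \<omega>) \<in> adm M"
  using adm_mult[of F M "\<lambda>\<omega>. c"] bfunI[of "\<lambda>\<omega>. c" M "cmod c"] by (simp add: mult.commute)

lemma adm_mult_left: "F \<in> bfun M \<Longrightarrow> G \<in> adm M \<Longrightarrow> (\<lambda>\<omega>. F \<omega> * G \<omega>) \<in> adm M"
  using adm_mult[of G M F] by (simp add: mult.commute)

lemma adm_diff: "F \<in> adm M \<Longrightarrow> G \<in> adm M \<Longrightarrow> (\<lambda>\<omega>. F \<omega> - G \<omega>) \<in> adm M"
  using adm_add[OF _ adm_scale[of G M "-1"]] by simp

lemma adm_dominated:
  assumes "F \<in> adm M" "\<And>b. (\<lambda>x. G (x, b)) \<in> borel_measurable M"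
    "\<And>x b. x \<in> space M \<Longrightarrow> cmod (G (x, b)) \<le> cmod (F (x, b))"
  shows "G \<in> adm M"
proof -
  from assms(1) obtain D where D: "integrable M D" "\<And>x b. x \<in> space M \<Longrightarrow> cmod (F (x, b)) \<le> D x"
    by (metis admE)
  show ?thesis
    by (rule admI[OF assms(2) D(1)]) (rule order_trans[OF assms(3) D(2)])
qed

lemma borel_measurable_of_real_parts:
  fixes f :: "'a \<Rightarrow> complex"
  assumes [measurable]: "f \<in> borel_measurable M"
  shows "(\<lambda>x. complex_of_real (cmod (f x))) \<in> borel_measurable M"
    "(\<lambda>x. complex_of_real (Re (f x))) \<in> borel_measurable M"
    "(\<lambda>x. complex_of_real (Im (f x))) \<in> borel_measurable M"
  by measurable

lemma adm_cmod: "F \<in> adm M \<Longrightarrow> (\<lambda>\<omega>. of_real (cmod (F \<omega>))) \<in> adm M"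
  by (rule adm_dominated) (auto intro: borel_measurable_of_real_parts borel_measurable_cnj adm_measurable)

lemma adm_Re: "F \<in> adm M \<Longrightarrow> (\<lambda>\<omega>. of_real (Re (F \<omega>))) \<in> adm M"
  by (rule adm_dominated) (auto intro: borel_measurable_of_real_parts adm_measurable simp: abs_Re_le_cmod)

lemma adm_Im: "F \<in> adm M \<Longrightarrow> (\<lambda>\<omega>. of_real (Im (F \<omega>))) \<in> adm M"
  by (rule adm_dominated) (auto intro: borel_measurable_of_real_parts adm_measurable simp: abs_Im_le_cmod)

lemma adm_fst: "integrable M g \<Longrightarrow> (\<lambda>\<omega>. g (fst \<omega>)) \<in> adm M"
  by (rule admI[where D="\<lambda>x. cmod (g x)"]) auto

lemma adm_sum: "(\<And>i. i \<in> I \<Longrightarrow> F i \<in> adm M) \<Longrightarrow> (\<lambda>\<omega>. \<Sum>i\<in>I. F i \<omega>) \<in> adm M"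
proof (induction I rule: infinite_finite_induct)
  case (insert i I)
  then show ?case using adm_add[of "F i" M "\<lambda>\<omega>. \<Sum>i\<in>I. F i \<omega>"] by simp
qed (auto intro!: admI[where D="\<lambda>_. 0"])

lemma (in prob_space) bfun_adm:
  assumes "F \<in> bfun M"
  shows "F \<in> adm M"
  using assms
proof (rule bfunE)
  fix C :: real assume "\<And>x b. x \<in> space M \<Longrightarrow> cmod (F (x, b)) \<le> C"
  then show ?thesis by (intro admI[where D="\<lambda>_. C"] bfun_measurable assms) auto
qed

lemma bfun_const: "(\<lambda>\<omega>. c) \<in> bfun M"
  by (rule bfunI[where C="cmod c"]) auto

lemma bfun_fst: "g \<in> borel_measurable M \<Longrightarrow> (\<And>x. cmod (g x) \<le> K) \<Longrightarrow> (\<lambda>\<omega>. g (fst \<omega>)) \<in> bfun M"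
  by (rule bfunI[where C=K]) auto

lemma bfun_add:
  assumes "F \<in> bfun M" "G \<in> bfun M"
  shows "(\<lambda>\<omega>. F \<omega> + G \<omega>) \<in> bfun M"
proof -
  from assms obtain C E where C: "\<And>x b. x \<in> space M \<Longrightarrow> cmod (F (x, b)) \<le> C"
    "\<And>x b. x \<in> space M \<Longrightarrow> cmod (G (x, b)) \<le> E"
    by (metis bfunE)
  show ?thesis
  proof (rule bfunI[where C="C + E"])
    fix x b assume "x \<in> space M"
    then show "cmod (F (x, b) + G (x, b)) \<le> C + E"
      by (intro order_trans[OF norm_triangle_ineq] add_mono C)
  qed (use assms[THEN bfun_measurable] in auto)
qed

lemma bfun_mult:
  assumes "F \<in> bfun M" "G \<in> bfun M"
  shows "(\<lambda>\<omega>. F \<omega> * G \<omega>) \<in> bfun M"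
proof -
  from assms obtain C E where C: "C \<ge> 0" "\<And>x b. x \<in> space M \<Longrightarrow> cmod (F (x, b)) \<le> C"
    "\<And>x b. x \<in> space M \<Longrightarrow> cmod (G (x, b)) \<le> E"
    by (metis bfunE)
  show ?thesis
  proof (rule bfunI[where C="C * E"])
    fix x b assume "x \<in> space M"
    then show "cmod (F (x, b) * G (x, b)) \<le> C * E"
      unfolding norm_mult by (intro mult_mono C) auto
  qed (use assms[THEN bfun_measurable] in auto)
qed

lemma bfun_diff: "F \<in> bfun M \<Longrightarrow> G \<in> bfun M \<Longrightarrow> (\<lambda>\<omega>. F \<omega> - G \<omega>) \<in> bfun M"
  using bfun_add[OF _ bfun_mult[OF bfun_const[of "-1"], of G]] by simp

lemma bfun_dominated:
  assumes "F \<in> bfun M" "\<And>b. (\<lambda>x. G (x, b)) \<in> borel_measurable M"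
    "\<And>x b. x \<in> space M \<Longrightarrow> cmod (G (x, b)) \<le> cmod (F (x, b))"
  shows "G \<in> bfun M"
proof -
  from assms(1) obtain C where C: "\<And>x b. x \<in> space M \<Longrightarrow> cmod (F (x, b)) \<le> C"
    by (metis bfunE)
  show ?thesis
    by (rule bfunI[OF assms(2)]) (rule order_trans[OF assms(3) C])
qed

lemma bfun_cmod: "F \<in> bfun M \<Longrightarrow> (\<lambda>\<omega>. of_real (cmod (F \<omega>))) \<in> bfun M"
  by (rule bfun_dominated) (auto intro: borel_measurable_of_real_parts borel_measurable_cnj bfun_measurable)

lemma bfun_Re: "F \<in> bfun M \<Longrightarrow> (\<lambda>\<omega>. of_real (Re (F \<omega>))) \<in> bfun M"
  by (rule bfun_dominated) (auto intro: borel_measurable_of_real_parts bfun_measurable simp: abs_Re_le_cmod)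

lemma bfun_Im: "F \<in> bfun M \<Longrightarrow> (\<lambda>\<omega>. of_real (Im (F \<omega>))) \<in> bfun M"
  by (rule bfun_dominated) (auto intro: borel_measurable_of_real_parts bfun_measurable simp: abs_Im_le_cmod)

lemma bfun_cnj: "F \<in> bfun M \<Longrightarrow> (\<lambda>\<omega>. cnj (F \<omega>)) \<in> bfun M"
  by (rule bfun_dominated) (auto intro: borel_measurable_of_real_parts borel_measurable_cnj bfun_measurable)

lemma bfun_sum: "(\<And>i. i \<in> I \<Longrightarrow> F i \<in> bfun M) \<Longrightarrow> (\<lambda>\<omega>. \<Sum>i\<in>I. F i \<omega>) \<in> bfun M"
proof (induction I rule: infinite_finite_induct)
  case (insert i I)
  then show ?case using bfun_add[of "F i" M "\<lambda>\<omega>. \<Sum>i\<in>I. F i \<omega>"] by simp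
qed (auto intro!: bfunI[where C=0])

lemma um_mult: "F \<in> um M \<Longrightarrow> G \<in> um M \<Longrightarrow> (\<lambda>\<omega>. F \<omega> * G \<omega>) \<in> um M"
  by (auto simp: um_def norm_mult intro!: borel_measurable_times)

lemma um_cnj: "F \<in> um M \<Longrightarrow> (\<lambda>\<omega>. cnj (F \<omega>)) \<in> um M"
  by (auto simp: um_def intro: borel_measurable_cnj)

lemma um_power: "F \<in> um M \<Longrightarrow> (\<lambda>\<omega>. F \<omega> ^ n) \<in> um M"
  by (auto simp: um_def norm_power intro!: borel_measurable_power)

lemma um_prod: "(\<And>i. i \<in> I \<Longrightarrow> F i \<in> um M) \<Longrightarrow> (\<lambda>\<omega>. \<Prod>i\<in>I. F i \<omega>) \<in> um M"
  by (auto simp: um_def simp flip: prod_norm intro!: borel_measurable_prod)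

lemma um_qeig: "qeig M T d g \<Longrightarrow> (\<lambda>\<omega>. g (fst \<omega>)) \<in> um M"
  by (auto simp: um_def qeig_cmod qeig_measurable)

text \<open>The affine rescaling turns a unimodular function into two weights with values in [0, 1],
  the form in which densities and reweighted states are available.\<close>

lemma um_parts:
  assumes "v \<in> um M"
  shows "(\<lambda>\<omega>. complex_of_real ((1 + Re (v \<omega>)) / 2)) \<in> bfun M"
    "(\<lambda>\<omega>. complex_of_real ((1 + Im (v \<omega>)) / 2)) \<in> bfun M"
    "0 \<le> (1 + Re (v \<omega>)) / 2" "(1 + Re (v \<omega>)) / 2 \<le> 1"
    "0 \<le> (1 + Im (v \<omega>)) / 2" "(1 + Im (v \<omega>)) / 2 \<le> 1"
proof -
  have vb: "v \<in> bfun M" by (intro um_bfun assms)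
  have "(\<lambda>\<omega>. (1/2) * (1 + of_real (Re (v \<omega>)))) \<in> bfun M" "(\<lambda>\<omega>. (1/2) * (1 + of_real (Im (v \<omega>)))) \<in> bfun M"
    by (intro bfun_mult bfun_const bfun_add bfun_Re bfun_Im vb)+
  then show "(\<lambda>\<omega>. complex_of_real ((1 + Re (v \<omega>)) / 2)) \<in> bfun M"
    "(\<lambda>\<omega>. complex_of_real ((1 + Im (v \<omega>)) / 2)) \<in> bfun M"
    by (simp_all add: field_simps)
  have "\<bar>Re (v \<omega>)\<bar> \<le> 1" "\<bar>Im (v \<omega>)\<bar> \<le> 1"
    using abs_Re_le_cmod[of "v \<omega>"] abs_Im_le_cmod[of "v \<omega>"] um_cmod[OF assms] by simp_all
  then show "0 \<le> (1 + Re (v \<omega>)) / 2" "(1 + Re (v \<omega>)) / 2 \<le> 1"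
    "0 \<le> (1 + Im (v \<omega>)) / 2" "(1 + Im (v \<omega>)) / 2 \<le> 1"
    by (simp_all add: abs_le_iff)
qed

section \<open>Functions along the skew product map\<close>

lemma map_prod_funpow:
  fixes T :: "'a \<Rightarrow> 'a" and R :: "'b \<Rightarrow> 'b"
  shows "map_prod T R ^^ n = map_prod (T ^^ n) (R ^^ n)"
  by (induction n) auto

lemma adm_map_prod:
  assumes "mps M T" "F \<in> adm M"
  shows "(\<lambda>\<omega>. F (map_prod T R \<omega>)) \<in> adm M"
proof -
  from assms(2) obtain D where D: "integrable M D" "\<And>x b. x \<in> space M \<Longrightarrow> cmod (F (x, b)) \<le> D x"
    by (metis admE)
  show ?thesis
  proof (rule admI[where D="\<lambda>x. D (T x)"])
    fix b show "(\<lambda>x. F (map_prod T R (x, b))) \<in> borel_measurable M"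
      using measurable_compose[OF mps_meas[OF assms(1)] adm_measurable[OF assms(2), of "R b"]] by simp
  qed (use D mps_integrable[OF assms(1)] mps_space[OF assms(1)] in auto)
qed

lemma bfun_map_prod:
  assumes "mps M T" "F \<in> bfun M"
  shows "(\<lambda>\<omega>. F (map_prod T R \<omega>)) \<in> bfun M"
proof -
  from assms(2) obtain C where C: "\<And>x b. x \<in> space M \<Longrightarrow> cmod (F (x, b)) \<le> C"
    by (metis bfunE)
  show ?thesis
  proof (rule bfunI[where C=C])
    fix b show "(\<lambda>x. F (map_prod T R (x, b))) \<in> borel_measurable M"
      using measurable_compose[OF mps_meas[OF assms(1)] bfun_measurable[OF assms(2), of "R b"]] by simp
  qed (use C mps_space[OF assms(1)] in auto)
qed

lemma um_map_prod:
  assumes "mps M T" "F \<in> um M"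
  shows "(\<lambda>\<omega>. F (map_prod T R \<omega>)) \<in> um M"
  using assms(2) measurable_compose[OF mps_meas[OF assms(1)] um_measurable[OF assms(2)]]
  by (auto simp: um_def)

lemma um_mder:
  assumes "mps M T" "F \<in> um M"
  shows "mder (map_prod T R) F \<in> um M"
  unfolding mder_def by (intro um_mult um_cnj um_map_prod assms)

lemmas adm_intros = adm_add adm_diff adm_scale adm_cmod adm_Re adm_Im adm_fst adm_mult
lemmas bfun_intros = bfun_const bfun_add bfun_diff bfun_mult bfun_cmod bfun_Re bfun_Im bfun_cnj um_bfun

section \<open>Positive functionals and their seminorm\<close>

definition nrm :: "(('a \<times> 'b \<Rightarrow> complex) \<Rightarrow> complex) \<Rightarrow> ('a \<times> 'b \<Rightarrow> complex) \<Rightarrow> real" where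
  "nrm L F = Re (L (\<lambda>\<omega>. of_real (cmod (F \<omega>))))"

definition aeq :: "(('a \<times> 'b \<Rightarrow> complex) \<Rightarrow> complex) \<Rightarrow> ('a \<times> 'b \<Rightarrow> complex) \<Rightarrow> ('a \<times> 'b \<Rightarrow> complex) \<Rightarrow> bool"
  where "aeq L F G \<longleftrightarrow> nrm L (\<lambda>\<omega>. F \<omega> - G \<omega>) = 0"

text \<open>The value 0 outside \<open>adm M\<close> makes every such functional a point of a
  product indexed by all functions F, in which compactness is proved. Boundedness follows from
  positivity together with the marginal.\<close>

locale prestate = prob_space M for M :: "'a measure" +
  fixes L :: "('a \<times> 'b \<Rightarrow> complex) \<Rightarrow> complex"
  assumes L_out: "F \<notin> adm M \<Longrightarrow> L F = 0"
    and L_add: "F \<in> adm M \<Longrightarrow> G \<in> adm M \<Longrightarrow> L (\<lambda>\<omega>. F \<omega> + G \<omega>) = L F + L G"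
    and L_scale: "F \<in> adm M \<Longrightarrow> L (\<lambda>\<omega>. c * F \<omega>) = c * L F"
    and L_pos: "F \<in> adm M \<Longrightarrow> (\<And>x b. x \<in> space M \<Longrightarrow> F (x, b) \<in> \<real>\<^sub>\<ge>\<^sub>0) \<Longrightarrow> L F \<in> \<real>\<^sub>\<ge>\<^sub>0"
    and L_marg: "integrable M g \<Longrightarrow> L (\<lambda>\<omega>. g (fst \<omega>)) = (\<integral>x. g x \<partial>M)"
begin

lemma L_diff: "F \<in> adm M \<Longrightarrow> G \<in> adm M \<Longrightarrow> L (\<lambda>\<omega>. F \<omega> - G \<omega>) = L F - L G"
  using L_add[of F "\<lambda>\<omega>. -1 * G \<omega>"] L_scale[of G "-1"] adm_scale[of G M "-1"] by simp

lemma L_zero: "L (\<lambda>\<omega>. 0) = 0"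
  using L_marg[of "\<lambda>_. 0"] by simp

lemma L_const: "L (\<lambda>\<omega>. c) = c"
  using L_marg[of "\<lambda>_. c"] by (simp add: prob_space)

lemma L_sum: "(\<And>i. i \<in> I \<Longrightarrow> F i \<in> adm M) \<Longrightarrow> L (\<lambda>\<omega>. \<Sum>i\<in>I. F i \<omega>) = (\<Sum>i\<in>I. L (F i))"
proof (induction I rule: infinite_finite_induct)
  case (insert i I)
  then show ?case using L_add[of "F i" "\<lambda>\<omega>. \<Sum>i\<in>I. F i \<omega>"] adm_sum[of I F M] by simp
qed (simp_all add: L_zero)

text \<open>A real F is the difference of |F| and |F| - F, both of them nonnegative.\<close>

lemma L_Reals:
  assumes "F \<in> adm M" "\<And>x b. x \<in> space M \<Longrightarrow> F (x, b) \<in> \<real>"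
  shows "L F \<in> \<real>"
proof -
  let ?A = "\<lambda>\<omega>. of_real (cmod (F \<omega>)) :: complex"
  have A: "?A \<in> adm M" "(\<lambda>\<omega>. ?A \<omega> - F \<omega>) \<in> adm M" by (intro adm_intros assms)+
  have "?A (x, b) - F (x, b) \<in> \<real>\<^sub>\<ge>\<^sub>0" if "x \<in> space M" for x b
    using assms(2)[OF that, of b] by (auto simp: Reals_def complex_nonneg_Reals_iff)
  then have "L (\<lambda>\<omega>. ?A \<omega> - F \<omega>) \<in> \<real>\<^sub>\<ge>\<^sub>0" by (rule L_pos[OF A(2)])
  moreover have "L ?A \<in> \<real>\<^sub>\<ge>\<^sub>0" by (rule L_pos[OF A(1)]) simp
  ultimately have "L ?A - L F \<in> \<real>" "L ?A \<in> \<real>"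
    unfolding L_diff[OF A(1) assms(1)] by (auto dest: nonneg_Reals_subset_Reals[THEN subsetD])
  from Reals_diff[OF this(2,1)] show ?thesis by simp
qed

lemma L_mono:
  assumes "F \<in> adm M" "G \<in> adm M" "\<And>x b. x \<in> space M \<Longrightarrow> G (x, b) - F (x, b) \<in> \<real>\<^sub>\<ge>\<^sub>0"
  shows "Re (L F) \<le> Re (L G)"
  using L_pos[OF adm_diff[OF assms(2,1)]] assms(3)
  by (simp add: L_diff[OF assms(2,1)] complex_nonneg_Reals_iff)

lemma Re_L:
  assumes "F \<in> adm M"
  shows "Re (L F) = Re (L (\<lambda>\<omega>. of_real (Re (F \<omega>))))"
proof -
  let ?R = "\<lambda>\<omega>. of_real (Re (F \<omega>)) :: complex" and ?I = "\<lambda>\<omega>. of_real (Im (F \<omega>)) :: complex"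
  have "?R \<in> adm M" "?I \<in> adm M" "(\<lambda>\<omega>. \<i> * ?I \<omega>) \<in> adm M" by (intro adm_intros assms)+
  then have "L (\<lambda>\<omega>. ?R \<omega> + \<i> * ?I \<omega>) = L ?R + \<i> * L ?I" by (simp add: L_add L_scale)
  moreover have "(\<lambda>\<omega>. ?R \<omega> + \<i> * ?I \<omega>) = F" by (simp add: complex_eq_iff fun_eq_iff)
  moreover have "L ?I \<in> \<real>" by (rule L_Reals) (use \<open>?I \<in> adm M\<close> in auto)
  ultimately show ?thesis by (auto simp: complex_is_Real_iff)
qed

lemma L_of_real:
  assumes "(\<lambda>\<omega>. of_real (p \<omega>)) \<in> adm M"
  shows "L (\<lambda>\<omega>. of_real (p \<omega>)) = of_real (Re (L (\<lambda>\<omega>. of_real (p \<omega>))))"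
  using L_Reals[OF assms] by (simp add: complex_is_Real_iff complex_eq_iff)

lemma L_of_real_mono:
  assumes "(\<lambda>\<omega>. of_real (p \<omega>)) \<in> adm M" "(\<lambda>\<omega>. of_real (q \<omega>)) \<in> adm M"
    and "\<And>x b. x \<in> space M \<Longrightarrow> p (x, b) \<le> q (x, b)"
  shows "Re (L (\<lambda>\<omega>. of_real (p \<omega>))) \<le> Re (L (\<lambda>\<omega>. of_real (q \<omega>)))"
  by (rule L_mono[OF assms(1,2)]) (use assms(3) in \<open>auto simp: complex_nonneg_Reals_iff\<close>)

lemma cmod_L_le:
  assumes "F \<in> adm M"
  shows "cmod (L F) \<le> nrm L F"
proof -
  \<comment> \<open>The factor c cancels the phase of \<open>L F\<close>, so that positivity,
    applied to the real part of \<open>c * F\<close>, bounds the modulus.\<close>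
  obtain c where c: "cmod c = 1" "c * L F = of_real (cmod (L F))"
  proof (cases "L F = 0")
    case True
    then show thesis using that[of 1] by simp
  next
    case False
    moreover have "cnj (L F) * L F = of_real (cmod (L F)) * of_real (cmod (L F))"
      using complex_norm_square[of "L F"] by (simp add: power2_eq_square mult.commute)
    ultimately show thesis using that[of "cnj (L F) / cmod (L F)"] by (simp add: norm_divide)
  qed
  have "cmod (L F) = Re (L (\<lambda>\<omega>. c * F \<omega>))" unfolding L_scale[OF assms] c(2) by simp
  also have "\<dots> = Re (L (\<lambda>\<omega>. of_real (Re (c * F \<omega>))))" by (rule Re_L) (intro adm_intros assms)
  also have "\<dots> \<le> nrm L F"
    unfolding nrm_def
  proof (rule L_of_real_mono)
    fix x b
    show "Re (c * F (x, b)) \<le> cmod (F (x, b))"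
      using complex_Re_le_cmod[of "c * F (x, b)"] c(1) by (simp add: norm_mult)
  qed (intro adm_intros assms)+
  finally show ?thesis .
qed

lemma nrm_nonneg: "F \<in> adm M \<Longrightarrow> 0 \<le> nrm L F"
  using cmod_L_le[of F] norm_ge_zero[of "L F"] by linarith

lemma nrm_mono:
  assumes "F \<in> adm M" "G \<in> adm M" "\<And>x b. x \<in> space M \<Longrightarrow> cmod (F (x, b)) \<le> cmod (G (x, b))"
  shows "nrm L F \<le> nrm L G"
  unfolding nrm_def by (rule L_of_real_mono) (use assms adm_cmod in auto)

text \<open>The marginal turns a bound that does not depend on the second coordinate into a number
  common to all states; this supplies the radii in the compactness proof.\<close>

lemma nrm_le_integral:
  assumes "F \<in> adm M" "integrable M D" "\<And>x b. x \<in> space M \<Longrightarrow> cmod (F (x, b)) \<le> D x"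
  shows "nrm L F \<le> (\<integral>x. D x \<partial>M)"
proof -
  let ?D = "\<lambda>x. complex_of_real (D x)"
  have D: "integrable M ?D" using assms(2) by simp
  have "nrm L F \<le> Re (L (\<lambda>\<omega>. ?D (fst \<omega>)))"
    unfolding nrm_def by (rule L_of_real_mono) (use assms adm_cmod adm_fst[OF D] in auto)
  also have "\<dots> = (\<integral>x. D x \<partial>M)" unfolding L_marg[OF D] by simp
  finally show ?thesis .
qed

lemma nrm_triangle:
  assumes "F \<in> adm M" "G \<in> adm M" "H \<in> adm M"
    and "\<And>x b. x \<in> space M \<Longrightarrow> cmod (F (x, b)) \<le> cmod (G (x, b)) + cmod (H (x, b))"
  shows "nrm L F \<le> nrm L G + nrm L H"
proof -
  have "nrm L F \<le> Re (L (\<lambda>\<omega>. of_real (cmod (G \<omega>) + cmod (H \<omega>))))"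
    unfolding nrm_def using assms adm_add[OF adm_cmod adm_cmod] by (intro L_of_real_mono adm_cmod) auto
  also have "\<dots> = nrm L G + nrm L H"
    unfolding nrm_def using L_add[OF adm_cmod adm_cmod, of G H] assms by simp
  finally show ?thesis .
qed

lemma nrm_fst: "integrable M g \<Longrightarrow> nrm L (\<lambda>\<omega>. g (fst \<omega>)) = (\<integral>x. cmod (g x) \<partial>M)"
  unfolding nrm_def using L_marg[of "\<lambda>x. of_real (cmod (g x))"] by simp

lemma nrm_fst_mult_le:
  assumes "integrable M g" "G \<in> bfun M" "\<And>x b. x \<in> space M \<Longrightarrow> cmod (G (x, b)) \<le> C"
  shows "nrm L (\<lambda>\<omega>. g (fst \<omega>) * G \<omega>) \<le> C * (\<integral>x. cmod (g x) \<partial>M)"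
proof -
  have "nrm L (\<lambda>\<omega>. g (fst \<omega>) * G \<omega>) \<le> (\<integral>x. C * cmod (g x) \<partial>M)"
  proof (rule nrm_le_integral)
    fix x b assume "x \<in> space M"
    then show "cmod (g (fst (x, b)) * G (x, b)) \<le> C * cmod (g x)"
      using mult_right_mono[OF assms(3), of x "cmod (g x)" b] by (simp add: norm_mult mult.commute)
  qed (use assms in \<open>auto intro: adm_mult adm_fst\<close>)
  then show ?thesis by simp
qed

lemma cmod_L_fst_mult_le:
  assumes "integrable M g" "G \<in> bfun M" "\<And>x b. x \<in> space M \<Longrightarrow> cmod (G (x, b)) \<le> C"
  shows "cmod (L (\<lambda>\<omega>. g (fst \<omega>) * G \<omega>)) \<le> C * (\<integral>x. cmod (g x) \<partial>M)"
  using cmod_L_le[OF adm_mult[OF adm_fst[OF assms(1)] assms(2)]] nrm_fst_mult_le[OF assms] by simp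

lemma L_fst_mult_eq_0:
  assumes g: "integrable M g" and G: "G \<in> bfun M"
    and zero: "\<And>g K. integrable M g \<Longrightarrow> (\<And>x. cmod (g x) \<le> K) \<Longrightarrow> L (\<lambda>\<omega>. g (fst \<omega>) * G \<omega>) = 0"
  shows "L (\<lambda>\<omega>. g (fst \<omega>) * G \<omega>) = 0"
proof -
  from G obtain C where C: "\<And>x b. x \<in> space M \<Longrightarrow> cmod (G (x, b)) \<le> C" by (metis bfunE)
  show ?thesis
  proof (rule L1_functional_eq_0[OF g, where L="\<lambda>g. L (\<lambda>\<omega>. g (fst \<omega>) * G \<omega>)" and C=C])
    fix f g :: "'a \<Rightarrow> complex" assume "integrable M f" "integrable M g"
    then show "L (\<lambda>\<omega>. (f (fst \<omega>) + g (fst \<omega>)) * G \<omega>) =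
        L (\<lambda>\<omega>. f (fst \<omega>) * G \<omega>) + L (\<lambda>\<omega>. g (fst \<omega>) * G \<omega>)"
      unfolding distrib_right by (intro L_add adm_mult adm_fst G)
  qed (use zero cmod_L_fst_mult_le[OF _ G C] in auto)
qed

text \<open>Null functions absorb even unbounded multipliers. Such an H need not be square
  integrable, so Cauchy-Schwarz does not apply; instead H is dominated by a function on the base,
  which may be taken bounded by some K, and then the product is at most K times |F|.\<close>

lemma nrm_bfun_mult_0:
  assumes "F \<in> bfun M" "nrm L F = 0" "H \<in> adm M"
  shows "nrm L (\<lambda>\<omega>. F \<omega> * H \<omega>) = 0"
proof -
  let ?A = "\<lambda>\<omega>. of_real (cmod (F \<omega>)) :: complex"
  have A: "?A \<in> bfun M" by (intro bfun_intros assms)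
  have Aadm: "?A \<in> adm M" by (rule bfun_adm[OF A])
  have nA: "nrm L ?A = 0" using assms(2) by (simp add: nrm_def)
  from assms(3) obtain D where D: "integrable M D" "\<And>x b. x \<in> space M \<Longrightarrow> cmod (H (x, b)) \<le> D x"
    by (metis admE)
  let ?D = "\<lambda>x. complex_of_real (D x)"
  have intD: "integrable M ?D" using D by simp
  have FH: "(\<lambda>\<omega>. F \<omega> * H \<omega>) \<in> adm M" by (intro adm_mult_left assms)
  have "L (\<lambda>\<omega>. ?D (fst \<omega>) * ?A \<omega>) = 0"
  proof (rule L_fst_mult_eq_0[OF intD A])
    fix g :: "'a \<Rightarrow> complex" and K :: real
    assume g: "integrable M g" "\<And>x. cmod (g x) \<le> K"
    have adm: "(\<lambda>\<omega>. g (fst \<omega>) * ?A \<omega>) \<in> adm M" by (intro adm_mult adm_fst g A)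
    have "cmod (L (\<lambda>\<omega>. g (fst \<omega>) * ?A \<omega>)) \<le> nrm L (\<lambda>\<omega>. g (fst \<omega>) * ?A \<omega>)" by (rule cmod_L_le[OF adm])
    also have "\<dots> \<le> nrm L (\<lambda>\<omega>. of_real K * ?A \<omega>)"
    proof (rule nrm_mono[OF adm adm_scale[OF Aadm]])
      fix x b
      have "cmod (g x) \<le> \<bar>K\<bar>" using g(2)[of x] by linarith
      then show "cmod (g (fst (x, b)) * ?A (x, b)) \<le> cmod (of_real K * ?A (x, b))"
        by (simp add: norm_mult mult_right_mono)
    qed
    also have "\<dots> = Re (L (\<lambda>\<omega>. of_real \<bar>K\<bar> * ?A \<omega>))" unfolding nrm_def by (simp add: norm_mult)
    also have "\<dots> = \<bar>K\<bar> * nrm L F" unfolding L_scale[OF Aadm] by (simp add: nrm_def)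
    finally show "L (\<lambda>\<omega>. g (fst \<omega>) * ?A \<omega>) = 0" using assms(2) by simp
  qed
  moreover have "nrm L (\<lambda>\<omega>. F \<omega> * H \<omega>) \<le> Re (L (\<lambda>\<omega>. ?D (fst \<omega>) * ?A \<omega>))"
    unfolding nrm_def
  proof (rule L_mono)
    fix x b assume "x \<in> space M"
    then have "cmod (F (x, b) * H (x, b)) \<le> D x * cmod (F (x, b))"
      using mult_right_mono[OF D(2)[of x b], of "cmod (F (x, b))"] by (simp add: norm_mult mult.commute)
    then show "?D (fst (x, b)) * ?A (x, b) - of_real (cmod (F (x, b) * H (x, b))) \<in> \<real>\<^sub>\<ge>\<^sub>0"
      by (simp add: complex_nonneg_Reals_iff)
  qed (intro adm_cmod FH adm_mult adm_fst A intD)+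
  ultimately show ?thesis using nrm_nonneg[OF FH] by simp
qed

lemma aeq_mult_right:
  assumes "aeq L F G" "F \<in> bfun M" "G \<in> bfun M" "H \<in> adm M"
  shows "aeq L (\<lambda>\<omega>. F \<omega> * H \<omega>) (\<lambda>\<omega>. G \<omega> * H \<omega>)"
  using nrm_bfun_mult_0[of "\<lambda>\<omega>. F \<omega> - G \<omega>" H] assms bfun_diff[OF assms(2,3)]
  by (simp add: aeq_def left_diff_distrib)

lemma aeq_L:
  assumes "aeq L F G" "F \<in> adm M" "G \<in> adm M"
  shows "L F = L G"
  using cmod_L_le[OF adm_diff[OF assms(2,3)]] assms by (simp add: aeq_def L_diff)

lemma aeq_L_mult:
  assumes "aeq L F G" "F \<in> bfun M" "G \<in> bfun M" "H \<in> adm M"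
  shows "L (\<lambda>\<omega>. F \<omega> * H \<omega>) = L (\<lambda>\<omega>. G \<omega> * H \<omega>)"
  by (intro aeq_L aeq_mult_right adm_mult_left assms)

lemma aeq_refl: "aeq L F F"
  by (simp add: aeq_def nrm_def L_zero)

lemma aeq_sym: "aeq L F G \<Longrightarrow> aeq L G F"
  by (simp add: aeq_def nrm_def norm_minus_commute)

lemma aeq_trans:
  assumes "aeq L F G" "aeq L G H" "F \<in> adm M" "G \<in> adm M" "H \<in> adm M"
  shows "aeq L F H"
proof -
  have "nrm L (\<lambda>\<omega>. F \<omega> - H \<omega>) \<le> nrm L (\<lambda>\<omega>. F \<omega> - G \<omega>) + nrm L (\<lambda>\<omega>. G \<omega> - H \<omega>)"
  proof (rule nrm_triangle)
    fix x b
    show "cmod (F (x, b) - H (x, b)) \<le> cmod (F (x, b) - G (x, b)) + cmod (G (x, b) - H (x, b))"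
      using norm_triangle_ineq[of "F (x, b) - G (x, b)" "G (x, b) - H (x, b)"] by simp
  qed (intro adm_diff assms)+
  then show ?thesis using assms(1,2) nrm_nonneg[OF adm_diff[OF assms(3,5)]] by (simp add: aeq_def)
qed

lemma aeq_um_mult:
  assumes "aeq L F G" "aeq L F' G'" "F \<in> um M" "G \<in> um M" "F' \<in> um M" "G' \<in> um M"
  shows "aeq L (\<lambda>\<omega>. F \<omega> * F' \<omega>) (\<lambda>\<omega>. G \<omega> * G' \<omega>)"
proof -
  note b = assms(3-6)[THEN um_bfun] and a = assms(3-6)[THEN um_bfun, THEN bfun_adm]
  have "aeq L (\<lambda>\<omega>. F \<omega> * F' \<omega>) (\<lambda>\<omega>. G \<omega> * F' \<omega>)"
    by (intro aeq_mult_right assms b a)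
  moreover have "aeq L (\<lambda>\<omega>. F' \<omega> * G \<omega>) (\<lambda>\<omega>. G' \<omega> * G \<omega>)"
    by (intro aeq_mult_right assms b a)
  then have "aeq L (\<lambda>\<omega>. G \<omega> * F' \<omega>) (\<lambda>\<omega>. G \<omega> * G' \<omega>)" by (simp add: mult.commute)
  ultimately show ?thesis by (rule aeq_trans) (intro adm_mult b a)+
qed

lemma aeq_um_power:
  assumes "aeq L F G" "F \<in> um M" "G \<in> um M"
  shows "aeq L (\<lambda>\<omega>. F \<omega> ^ n) (\<lambda>\<omega>. G \<omega> ^ n)"
proof (induction n)
  case (Suc n)
  show ?case using aeq_um_mult[OF assms(1) Suc assms(2,3) um_power um_power] assms by simp
qed (simp add: aeq_refl)

lemma aeq_fst:
  assumes "AE x in M. f x = g x" "f \<in> borel_measurable M" "g \<in> borel_measurable M"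
    "\<And>x. cmod (f x) = 1" "\<And>x. cmod (g x) = 1"
  shows "aeq L (\<lambda>\<omega>. f (fst \<omega>)) (\<lambda>\<omega>. g (fst \<omega>))"
proof -
  have i: "integrable M f" "integrable M g"
    by (rule integrable_const_bound[where B=1]; use assms in auto)+
  have "(\<integral>x. cmod (f x - g x) \<partial>M) = 0"
    by (rule integral_eq_zero_AE) (use assms(1) in auto)
  then show ?thesis using nrm_fst[of "\<lambda>x. f x - g x"] i by (simp add: aeq_def)
qed

text \<open>Cauchy-Schwarz against the constant 1, obtained by expanding the positive function |F -
  c| squared with \<open>c = L F\<close>.\<close>

lemma norm_L_power2_le:
  assumes "F \<in> bfun M"
  shows "(cmod (L F))\<^sup>2 \<le> Re (L (\<lambda>\<omega>. F \<omega> * cnj (F \<omega>)))"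
proof -
  let ?c = "L F"
  have adm: "F \<in> adm M" "(\<lambda>\<omega>. cnj (F \<omega>)) \<in> adm M" "(\<lambda>\<omega>. F \<omega> * cnj (F \<omega>)) \<in> adm M"
    "(\<lambda>\<omega>. of_real ((cmod ?c)\<^sup>2) :: complex) \<in> adm M"
    by (intro bfun_adm bfun_intros assms)+
  let ?G = "\<lambda>\<omega>. (F \<omega> * cnj (F \<omega>) + of_real ((cmod ?c)\<^sup>2))"
  let ?H = "\<lambda>\<omega>. of_real (Re (2 * cnj ?c * F \<omega>))"
  have H: "(\<lambda>\<omega>. 2 * cnj ?c * F \<omega>) \<in> adm M" "?H \<in> adm M" by (intro adm_intros adm)+
  have G: "?G \<in> adm M" by (intro adm_intros adm)
  have "Re (L ?H) \<le> Re (L ?G)"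
  proof (rule L_mono[OF H(2) G])
    fix x b
    have "complex_of_real ((cmod ?c)\<^sup>2) = ?c * cnj ?c" by (rule complex_norm_square)
    moreover have "complex_of_real (Re (2 * cnj ?c * F (x, b))) = cnj ?c * F (x, b) + ?c * cnj (F (x, b))"
      by (simp add: complex_eq_iff)
    ultimately have "?G (x, b) - ?H (x, b) = (F (x, b) - ?c) * cnj (F (x, b) - ?c)"
      by (simp add: algebra_simps)
    also have "\<dots> = of_real ((cmod (F (x, b) - ?c))\<^sup>2)" by (rule complex_norm_square[symmetric])
    finally show "?G (x, b) - ?H (x, b) \<in> \<real>\<^sub>\<ge>\<^sub>0" by (simp add: complex_nonneg_Reals_iff)
  qed
  moreover have "Re (L ?H) = 2 * (cmod ?c)\<^sup>2"
  proof -
    have "cnj ?c * ?c = of_real ((cmod ?c)\<^sup>2)"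
      unfolding complex_norm_square by (rule mult.commute)
    then have "L (\<lambda>\<omega>. 2 * cnj ?c * F \<omega>) = of_real (2 * (cmod ?c)\<^sup>2)"
      unfolding L_scale[OF adm(1)] by simp
    then show ?thesis using Re_L[OF H(1)] by simp
  qed
  moreover have "L (\<lambda>\<omega>. of_real ((cmod ?c)\<^sup>2)) = of_real ((cmod ?c)\<^sup>2)"
    by (rule L_const)
  moreover have "L ?G = L (\<lambda>\<omega>. F \<omega> * cnj (F \<omega>)) + L (\<lambda>\<omega>. of_real ((cmod ?c)\<^sup>2))"
    by (rule L_add[OF adm(3,4)])
  ultimately show ?thesis by (metis Re_complex_of_real add_le_cancel_right mult_2 plus_complex.sel(1))
qed

lemma nrm_eq_0I:
  assumes "F \<in> bfun M" "Re (L (\<lambda>\<omega>. of_real ((cmod (F \<omega>))\<^sup>2))) \<le> 0"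
  shows "nrm L F = 0"
proof -
  let ?A = "\<lambda>\<omega>. of_real (cmod (F \<omega>)) :: complex"
  have A: "?A \<in> bfun M" by (intro bfun_intros assms)
  have "L ?A = of_real (nrm L F)"
    unfolding nrm_def by (rule L_of_real[OF bfun_adm[OF A]])
  moreover have "(cmod (L ?A))\<^sup>2 \<le> 0"
    using norm_L_power2_le[OF A] assms(2) by (simp add: power2_eq_square)
  ultimately show ?thesis by simp
qed

end

section \<open>Densities over the base\<close>

context prestate
begin

text \<open>Although L is only finitely additive, sending A to the value of L at q restricted to A
  is countably additive: the weight is at most 1, so this set function is dominated by the marginal,
  a genuine measure. Radon-Nikodym then yields G, the conditional expectation of q on the
  base.\<close>

lemma L_weight_density:
  fixes q :: "'a \<times> 'b \<Rightarrow> real"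
  assumes Q: "(\<lambda>\<omega>. of_real (q \<omega>)) \<in> bfun M" and q: "\<And>\<omega>. 0 \<le> q \<omega>" "\<And>\<omega>. q \<omega> \<le> 1"
  obtains G :: "'a \<Rightarrow> real" where "G \<in> borel_measurable M" "\<And>x. 0 \<le> G x" "\<And>x. G x \<le> 1"
    "\<And>g. integrable M g \<Longrightarrow> L (\<lambda>\<omega>. g (fst \<omega>) * of_real (q \<omega>)) = (\<integral>x. g x * of_real (G x) \<partial>M)"
proof -
  let ?Q = "\<lambda>\<omega>. complex_of_real (q \<omega>)"
  define l where "l = (\<lambda>g. L (\<lambda>\<omega>. g (fst \<omega>) * ?Q \<omega>))"
  define \<nu> where "\<nu> = (\<lambda>A. Re (l (indicator A)))"
  have l_add: "l (\<lambda>x. f x + g x) = l f + l g" if "integrable M f" "integrable M g" for f g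
    unfolding l_def distrib_right by (intro L_add adm_mult adm_fst Q that)
  have l_scale: "l (\<lambda>x. c * f x) = c * l f" if "integrable M f" for f c
    unfolding l_def mult.assoc by (intro L_scale adm_mult adm_fst Q that)
  have l_bound: "cmod (l f) \<le> (\<integral>x. cmod (f x) \<partial>M)" if "integrable M f" for f
    unfolding l_def using cmod_L_fst_mult_le[OF that Q, of 1] q by simp
  have ind: "integrable M (indicator A :: 'a \<Rightarrow> complex)" if "A \<in> sets M" for A
    using that by (intro integrable_const_bound[where B=1]) (auto simp: indicator_def)
  have l_ind: "l (indicator A) = of_real (\<nu> A)" "0 \<le> \<nu> A" if "A \<in> sets M" for A
  proof -
    have "l (indicator A) \<in> \<real>\<^sub>\<ge>\<^sub>0"
      unfolding l_def using q by (intro L_pos adm_mult adm_fst ind that Q) (auto simp: indicator_def)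
    then show "l (indicator A) = of_real (\<nu> A)" "0 \<le> \<nu> A"
      by (auto simp: \<nu>_def complex_nonneg_Reals_iff complex_eq_iff)
  qed
  have l_diff: "l (\<lambda>x. f x - g x) = l f - l g" if "integrable M f" "integrable M g" for f g
    using l_add[of f "\<lambda>x. -1 * g x"] l_scale[of g "-1"] that by simp
  have \<nu>_sums: "(\<lambda>i. \<nu> (A i)) sums \<nu> (\<Union>i. A i)"
    if A: "range A \<subseteq> sets M" and disj: "disjoint_family A" for A :: "nat \<Rightarrow> 'a set"
  proof -
    have Am: "A i \<in> sets M" "(\<Union>i. A i) \<in> sets M" for i using A by auto
    have eq: "(\<Sum>i<n. \<nu> (A i)) = Re (l (\<lambda>x. \<Sum>i<n. indicator (A i) x))" for n
    proof (induction n)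
      case 0
      have "l (\<lambda>x. 0 * 0) = 0 * l (\<lambda>x. 0)" by (rule l_scale) simp
      then show ?case by simp
    next
      case (Suc n)
      have "l (\<lambda>x. (\<Sum>i<n. indicator (A i) x) + indicator (A n) x) = l (\<lambda>x. \<Sum>i<n. indicator (A i) x) + l (indicator (A n))"
        by (intro l_add Bochner_Integration.integrable_sum ind Am)
      with Suc show ?case by (simp add: \<nu>_def)
    qed
    \<comment> \<open>The error after n sets is the weight of the tail of the union, at most its
      measure, which tends to 0.\<close>
    have bound: "norm (\<nu> (\<Union>i. A i) - (\<Sum>i<n. \<nu> (A i))) \<le> prob (\<Union>i. A i) - (\<Sum>i<n. prob (A i))" for n
    proof -
      let ?d = "\<lambda>x. indicator (\<Union>i. A i) x - (\<Sum>i<n. indicator (A i) x) :: complex"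
      let ?r = "\<lambda>x. indicator (\<Union>i. A i) x - (\<Sum>i<n. indicator (A i) x) :: real"
      have int: "integrable M (\<lambda>x. \<Sum>i<n. indicator (A i) x :: complex)"
        by (intro Bochner_Integration.integrable_sum ind Am)
      have "\<nu> (\<Union>i. A i) - (\<Sum>i<n. \<nu> (A i)) = Re (l ?d)"
        unfolding eq l_diff[OF ind[OF Am(2)] int] by (simp add: \<nu>_def)
      then have "norm (\<nu> (\<Union>i. A i) - (\<Sum>i<n. \<nu> (A i))) \<le> cmod (l ?d)"
        using abs_Re_le_cmod[of "l ?d"] by simp
      also have "\<dots> \<le> (\<integral>x. cmod (?d x) \<partial>M)"
        by (rule l_bound) (intro Bochner_Integration.integrable_diff ind Am int)
      also have "(\<lambda>x. cmod (?d x)) = ?r"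
      proof
        fix x
        have "disjoint_family_on A {..<n}" using disj by (auto simp: disjoint_family_on_def)
        then have *: "(\<Sum>i<n. indicator (A i) x) = (indicator (\<Union>i<n. A i) x :: real)"
          "(\<Sum>i<n. indicator (A i) x) = (indicator (\<Union>i<n. A i) x :: complex)"
          by (auto intro!: indicator_UN_disjoint[symmetric])
        show "cmod (?d x) = ?r x" unfolding * by (auto simp: indicator_def)
      qed
      also have "(\<integral>x. ?r x \<partial>M) = prob (\<Union>i. A i) - (\<Sum>i<n. prob (A i))"
        using Am by (subst Bochner_Integration.integral_diff)
          (auto intro!: Bochner_Integration.integrable_sum simp: Bochner_Integration.integral_sum emeasure_eq_measure)
      finally show ?thesis .
    qed
    have "(\<lambda>n. \<Sum>i<n. prob (A i)) \<longlonglongrightarrow> prob (\<Union>i. A i)"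
      using finite_measure_UNION[OF A disj] by (simp add: sums_def)
    then have "(\<lambda>n. prob (\<Union>i. A i) - (\<Sum>i<n. prob (A i))) \<longlonglongrightarrow> 0"
      using tendsto_diff[OF tendsto_const[of "prob (\<Union>i. A i)"]] by fastforce
    then have "(\<lambda>n. \<nu> (\<Union>i. A i) - (\<Sum>i<n. \<nu> (A i))) \<longlonglongrightarrow> 0"
      by (rule Lim_null_comparison[rotated]) (use bound in auto)
    from tendsto_minus[OF this]
    have "(\<lambda>n. (\<Sum>i<n. \<nu> (A i)) - \<nu> (\<Union>i. A i)) \<longlonglongrightarrow> 0" by simp
    then show ?thesis unfolding sums_def by (rule LIM_zero_cancel)
  qed
  define N where "N = measure_of (space M) (sets M) (\<lambda>A. ennreal (\<nu> A))"
  have sets_N: "sets N = sets M" by (simp add: N_def)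
  have em_N: "emeasure N A = ennreal (\<nu> A)" if "A \<in> sets M" for A
  proof (rule emeasure_measure_of[OF N_def])
    have "indicator {} = (\<lambda>x::'a. 0::complex)" by (simp add: fun_eq_iff)
    then have "l (indicator {}) = 0" using l_scale[of "\<lambda>x. 0" 0] by simp
    then show "positive (sets N) (\<lambda>A. ennreal (\<nu> A))"
      by (simp add: positive_def \<nu>_def)
    show "countably_additive (sets N) (\<lambda>A. ennreal (\<nu> A))"
      unfolding sets_N
    proof (rule countably_additiveI)
      fix A :: "nat \<Rightarrow> 'a set"
      assume A: "range A \<subseteq> sets M" "disjoint_family A" "(\<Union>i. A i) \<in> sets M"
      then have "(\<lambda>i. ennreal (\<nu> (A i))) sums ennreal (\<nu> (\<Union>i. A i))"
        using \<nu>_sums[OF A(1,2)] l_ind(2) by (subst sums_ennreal) auto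
      then show "(\<Sum>i. ennreal (\<nu> (A i))) = ennreal (\<nu> (\<Union>i. A i))" by (rule sums_unique[symmetric])
    qed
  qed (use that sets.space_closed sets_N in auto)
  have \<nu>_le: "\<nu> A \<le> prob A" if "A \<in> sets M" for A
  proof -
    have "\<bar>\<nu> A\<bar> \<le> (\<integral>x. cmod (indicator A x) \<partial>M)"
      using l_bound[OF ind[OF that]] abs_Re_le_cmod[of "l (indicator A)"] by (simp add: \<nu>_def)
    also have "(\<lambda>x. cmod (indicator A x)) = (indicator A :: 'a \<Rightarrow> real)" by (auto simp: indicator_def)
    finally show ?thesis using that by simp
  qed
  have "absolutely_continuous M N"
    unfolding absolutely_continuous_def
  proof
    fix A assume "A \<in> null_sets M"
    then have A: "A \<in> sets M" "prob A = 0" by (auto simp: measure_def)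
    then have "\<nu> A = 0" using \<nu>_le[OF A(1)] l_ind(2)[OF A(1)] by simp
    then show "A \<in> null_sets N" using A em_N sets_N by (auto simp: null_sets_def)
  qed
  from Radon_Nikodym[OF this sets_N] obtain h where h[measurable]: "h \<in> borel_measurable M" and hN: "density M h = N"
    by blast
  have h1: "AE x in M. h x \<le> 1"
  proof -
    let ?A = "{x \<in> space M. h x > 1}"
    have A[measurable]: "?A \<in> sets M" by measurable
    have "(\<integral>\<^sup>+x. h x * indicator ?A x \<partial>M) = ennreal (\<nu> ?A)"
      using emeasure_density[OF h A] em_N[OF A] hN by simp
    also have "\<dots> \<le> emeasure M ?A"
      using \<nu>_le[OF A] by (simp add: emeasure_eq_measure ennreal_leI)
    also have "\<dots> = (\<integral>\<^sup>+x. indicator ?A x \<partial>M)" by simp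
    finally have le: "(\<integral>\<^sup>+x. h x * indicator ?A x \<partial>M) \<le> (\<integral>\<^sup>+x. indicator ?A x \<partial>M)" .
    have "(\<integral>\<^sup>+x. h x * indicator ?A x - indicator ?A x \<partial>M)
        = (\<integral>\<^sup>+x. h x * indicator ?A x \<partial>M) - (\<integral>\<^sup>+x. indicator ?A x \<partial>M)"
    proof (rule nn_integral_diff)
      have "(\<integral>\<^sup>+x. indicator ?A x \<partial>M) = emeasure M ?A" by simp
      then show "(\<integral>\<^sup>+x. indicator ?A x \<partial>M) \<noteq> \<infinity>" by (simp only: emeasure_eq_measure) simp
    qed (auto simp: indicator_def)
    also have "\<dots> = 0"
    proof -
      have "(\<integral>\<^sup>+x. indicator ?A x \<partial>M) = emeasure M ?A" by simp
      also have "\<dots> < top" by (simp only: emeasure_eq_measure) simp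
      finally show ?thesis using le le_less_trans[OF le] unfolding diff_eq_0_iff_ennreal by blast
    qed
    finally have "AE x in M. h x * indicator ?A x - indicator ?A x = 0"
      by (subst (asm) nn_integral_0_iff_AE) auto
    then show ?thesis
    proof (rule AE_mp, intro AE_I2 impI)
      fix x assume "x \<in> space M" "h x * indicator ?A x - indicator ?A x = 0"
      then show "h x \<le> 1"
        by (cases "h x > 1") (auto simp: diff_eq_0_iff_ennreal not_less)
    qed
  qed
  \<comment> \<open>The derivative h is extended real valued and at most 1 only almost everywhere;
    the cut-off makes G a bounded real function at every point.\<close>
  define G where "G = (\<lambda>x. enn2real (min 1 (h x)))"
  have Gm[measurable]: "G \<in> borel_measurable M" unfolding G_def by measurable
  have G0: "0 \<le> G x" for x by (simp add: G_def)
  have minh: "min 1 (h x) < top" for x by (rule le_less_trans[of _ 1]) auto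
  have G1: "G x \<le> 1" for x
    using enn2real_mono[of "min 1 (h x)" 1] by (simp add: G_def)
  have hG: "AE x in M. h x = ennreal (G x)"
    using h1
  proof eventually_elim
    case (elim x)
    then have "min 1 (h x) = h x" by (simp add: min_absorb2)
    then show ?case using minh[of x] by (simp add: G_def)
  qed
  have G_int: "integrable M (\<lambda>x. g x * complex_of_real (G x))" if "integrable M g" for g
  proof (rule Bochner_Integration.integrable_bound[OF that])
    show "AE x in M. norm (g x * complex_of_real (G x)) \<le> norm (g x)"
      using G0 G1 by (auto simp: norm_mult intro!: mult_left_le)
  qed (use that in auto)
  have "l g = (\<integral>x. g x * of_real (G x) \<partial>M)" if "integrable M g" for g
    using that
  proof (induction rule: integrable_induct)
    case (base A c)
    have intG: "integrable M (\<lambda>x. G x * indicator A x)"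
      using base by (intro integrable_const_bound[where B=1]) (auto simp: indicator_def G0 G1)
    have "ennreal (\<nu> A) = (\<integral>\<^sup>+x. h x * indicator A x \<partial>M)"
      using emeasure_density[OF h base(1)] em_N[OF base(1)] hN by simp
    also have "\<dots> = (\<integral>\<^sup>+x. ennreal (G x * indicator A x) \<partial>M)"
      by (rule nn_integral_cong_AE, use hG in eventually_elim) (auto simp: indicator_def)
    also have "\<dots> = ennreal (\<integral>x. G x * indicator A x \<partial>M)"
      by (rule nn_integral_eq_integral[OF intG]) (auto simp: G0)
    finally have "\<nu> A = (\<integral>x. G x * indicator A x \<partial>M)"
      using l_ind(2)[OF base(1)] by (subst (asm) ennreal_inj) (auto simp: G0 intro!: integral_nonneg_AE)
    then have "l (indicator A) = (\<integral>x. complex_of_real (G x * indicator A x) \<partial>M)"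
      unfolding l_ind(1)[OF base(1)] by (simp only: integral_complex_of_real)
    moreover have "l (\<lambda>x. indicat_real A x *\<^sub>R c) = c * l (indicator A)"
      using l_scale[OF ind[OF base(1)], of c] by (simp add: scaleR_conv_of_real mult.commute of_real_indicator)
    moreover have "(\<integral>x. (indicat_real A x *\<^sub>R c) * of_real (G x) \<partial>M) = c * (\<integral>x. complex_of_real (G x * indicator A x) \<partial>M)"
      by (subst integral_mult_right_zero[symmetric]) (simp add: scaleR_conv_of_real mult_ac)
    ultimately show ?case by simp
  next
    case (add f g)
    then show ?case using l_add[OF add(1,2)] G_int by (simp add: distrib_right)
  next
    case (lim f s)
    have sf: "integrable M (\<lambda>x. s i x - f x)" for i using lim by auto
    have "(\<lambda>i. \<integral>x. cmod (s i x - f x) \<partial>M) \<longlonglongrightarrow> (\<integral>x. 0 \<partial>M)"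
    proof (rule integral_dominated_convergence[where w="\<lambda>x. 3 * cmod (f x)"])
      show "AE x in M. (\<lambda>i. cmod (s i x - f x)) \<longlonglongrightarrow> 0"
        using lim(2) by (intro AE_I2 tendsto_norm_zero LIM_zero)
      show "AE x in M. norm (cmod (s i x - f x)) \<le> 3 * cmod (f x)" for i
      proof (rule AE_I2)
        fix x assume "x \<in> space M"
        then have "cmod (s i x) \<le> 2 * cmod (f x)" using lim(3) by simp
        then show "norm (cmod (s i x - f x)) \<le> 3 * cmod (f x)"
          using norm_triangle_ineq4[of "s i x" "f x"] by simp
      qed
    qed (use lim in auto)
    then have z: "(\<lambda>i. \<integral>x. cmod (s i x - f x) \<partial>M) \<longlonglongrightarrow> 0" by simp
    have "(\<lambda>i. l (s i) - l f) \<longlonglongrightarrow> 0"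
      by (rule Lim_null_comparison[OF always_eventually z])
         (use l_bound[OF sf] l_diff lim in \<open>simp\<close>)
    moreover have "(\<lambda>i. l (s i) - (\<integral>x. f x * of_real (G x) \<partial>M)) \<longlonglongrightarrow> 0"
    proof (rule Lim_null_comparison[OF always_eventually z], rule allI)
      fix i
      have "l (s i) - (\<integral>x. f x * of_real (G x) \<partial>M) = (\<integral>x. (s i x - f x) * of_real (G x) \<partial>M)"
        using lim G_int by (simp add: left_diff_distrib)
      also have "cmod \<dots> \<le> (\<integral>x. cmod ((s i x - f x) * of_real (G x)) \<partial>M)"
        by (rule integral_norm_bound)
      also have "\<dots> \<le> (\<integral>x. cmod (s i x - f x) \<partial>M)"
        by (rule integral_mono[OF integrable_norm[OF G_int[OF sf]] integrable_norm[OF sf]])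
           (use G0 G1 in \<open>auto simp: norm_mult intro!: mult_left_le\<close>)
      finally show "cmod (l (s i) - (\<integral>x. f x * of_real (G x) \<partial>M)) \<le> (\<integral>x. cmod (s i x - f x) \<partial>M)" .
    qed
    ultimately have "(\<lambda>i. l (s i)) \<longlonglongrightarrow> l f" "(\<lambda>i. l (s i)) \<longlonglongrightarrow> (\<integral>x. f x * of_real (G x) \<partial>M)"
      by (simp_all add: LIM_zero_iff)
    then show ?case by (rule LIMSEQ_unique)
  qed
  then show thesis using that[OF Gm G0 G1] by (simp add: l_def)
qed

lemma L_um_density:
  assumes v: "v \<in> um M"
  obtains G :: "'a \<Rightarrow> complex" and C :: real where "G \<in> borel_measurable M" "\<And>x. cmod (G x) \<le> C"
    "\<And>g. integrable M g \<Longrightarrow> L (\<lambda>\<omega>. g (fst \<omega>) * v \<omega>) = (\<integral>x. g x * G x \<partial>M)"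
proof -
  let ?p = "\<lambda>\<omega>. (1 + Re (v \<omega>)) / 2" and ?q = "\<lambda>\<omega>. (1 + Im (v \<omega>)) / 2"
  note pq = um_parts(1,2)[OF v] and bounds = um_parts(3-6)[OF v]
  obtain A where A: "A \<in> borel_measurable M" "\<And>x. 0 \<le> A x" "\<And>x. A x \<le> 1"
    "\<And>g. integrable M g \<Longrightarrow> L (\<lambda>\<omega>. g (fst \<omega>) * of_real (?p \<omega>)) = (\<integral>x. g x * of_real (A x) \<partial>M)"
    using L_weight_density[OF pq(1) bounds(1,2)] by blast
  obtain B where B: "B \<in> borel_measurable M" "\<And>x. 0 \<le> B x" "\<And>x. B x \<le> 1"
    "\<And>g. integrable M g \<Longrightarrow> L (\<lambda>\<omega>. g (fst \<omega>) * of_real (?q \<omega>)) = (\<integral>x. g x * of_real (B x) \<partial>M)"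
    using L_weight_density[OF pq(2) bounds(3,4)] by blast
  \<comment> \<open>This undoes the rescaling of \<open>um_parts\<close>. The bound 6 that follows
    is generous; what matters is that G is bounded.\<close>
  define G where "G = (\<lambda>x. 2 * of_real (A x) + 2 * \<i> * of_real (B x) - (1 + \<i>))"
  have Gm: "G \<in> borel_measurable M" unfolding G_def using A(1) B(1) by measurable
  have "cmod (G x) \<le> 6" for x
  proof -
    have "cmod (G x) \<le> \<bar>Re (G x)\<bar> + \<bar>Im (G x)\<bar>" by (rule cmod_le)
    then show ?thesis using A(2,3)[of x] B(2,3)[of x] by (simp add: G_def)
  qed
  moreover have "L (\<lambda>\<omega>. g (fst \<omega>) * v \<omega>) = (\<integral>x. g x * G x \<partial>M)" if g: "integrable M g" for g
  proof -
    let ?P = "\<lambda>\<omega>. g (fst \<omega>) * of_real (?p \<omega>)" and ?R = "\<lambda>\<omega>. g (fst \<omega>) * of_real (?q \<omega>)"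
    have adm: "?P \<in> adm M" "?R \<in> adm M" "(\<lambda>\<omega>. g (fst \<omega>)) \<in> adm M" by (intro adm_intros g pq)+
    have adm2: "(\<lambda>\<omega>. 2 * ?P \<omega>) \<in> adm M" "(\<lambda>\<omega>. 2 * \<i> * ?R \<omega>) \<in> adm M" "(\<lambda>\<omega>. (1 + \<i>) * g (fst \<omega>)) \<in> adm M"
      by (intro adm_intros adm g)+
    have adm3: "(\<lambda>\<omega>. 2 * ?P \<omega> + 2 * \<i> * ?R \<omega>) \<in> adm M" by (rule adm_add[OF adm2(1,2)])
    have AB: "integrable M (\<lambda>x. g x * of_real (A x))" "integrable M (\<lambda>x. g x * of_real (B x))"
      by (rule Bochner_Integration.integrable_bound[OF g];
          use g A B in \<open>auto simp: norm_mult intro!: mult_left_le\<close>)+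
    have "(\<lambda>\<omega>. g (fst \<omega>) * v \<omega>) = (\<lambda>\<omega>. (2 * ?P \<omega> + 2 * \<i> * ?R \<omega>) - (1 + \<i>) * g (fst \<omega>))"
    proof
      fix \<omega>
      have "v \<omega> = 2 * of_real (?p \<omega>) + 2 * \<i> * of_real (?q \<omega>) - (1 + \<i>)"
        by (simp add: complex_eq_iff add_divide_distrib)
      moreover have "z * w = 2 * (z * a) + 2 * \<i> * (z * b) - (1 + \<i>) * z"
        if "w = 2 * a + 2 * \<i> * b - (1 + \<i>)" for z w a b :: complex
        unfolding that by (simp add: algebra_simps)
      ultimately show "g (fst \<omega>) * v \<omega> = (2 * ?P \<omega> + 2 * \<i> * ?R \<omega>) - (1 + \<i>) * g (fst \<omega>)"
        by blast
    qed
    then have "L (\<lambda>\<omega>. g (fst \<omega>) * v \<omega>) = 2 * L ?P + 2 * \<i> * L ?R - (1 + \<i>) * L (\<lambda>\<omega>. g (fst \<omega>))"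
      unfolding L_scale[OF adm(1), symmetric] L_scale[OF adm(2), symmetric] L_scale[OF adm(3), symmetric]
        L_add[OF adm2(1,2), symmetric] L_diff[OF adm3 adm2(3), symmetric] by simp
    also have "\<dots> = (\<integral>x. 2 * (g x * of_real (A x)) + 2 * \<i> * (g x * of_real (B x)) - (1 + \<i>) * g x \<partial>M)"
      unfolding A(4)[OF g] B(4)[OF g] L_marg[OF g] using AB g by simp
    also have "\<dots> = (\<integral>x. g x * G x \<partial>M)"
      by (rule Bochner_Integration.integral_cong) (simp_all add: G_def algebra_simps)
    finally show ?thesis .
  qed
  ultimately show thesis using that[OF Gm] by blast
qed

end

section \<open>Invariant states and their reweightings\<close>

locale state = prestate M L for M :: "'a measure" and L :: "('a \<times> 'b \<Rightarrow> complex) \<Rightarrow> complex" +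
  fixes T :: "'a \<Rightarrow> 'a" and R :: "'b \<Rightarrow> 'b"
  assumes mps: "mps M T"
    and L_inv: "F \<in> adm M \<Longrightarrow> L (\<lambda>\<omega>. F (map_prod T R \<omega>)) = L F"
begin

lemma aeq_shift:
  assumes "aeq L F G" "F \<in> adm M" "G \<in> adm M"
  shows "aeq L (\<lambda>\<omega>. F (map_prod T R \<omega>)) (\<lambda>\<omega>. G (map_prod T R \<omega>))"
  using L_inv[OF adm_cmod[OF adm_diff[OF assms(2,3)]]] assms(1) by (simp add: aeq_def nrm_def)

lemma L_funpow: "F \<in> adm M \<Longrightarrow> L (\<lambda>\<omega>. F ((map_prod T R ^^ n) \<omega>)) = L F"
proof (induction n)
  case (Suc n)
  have "(\<lambda>\<omega>. F ((map_prod T R ^^ n) \<omega>)) \<in> adm M"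
    unfolding map_prod_funpow by (rule adm_map_prod[OF mps_funpow[OF mps] Suc(2)])
  from L_inv[OF this] Suc show ?case by (simp add: funpow_swap1)
qed simp

lemma state_funpow: "state M L (T ^^ n) (R ^^ n)"
proof
  show "mps M (T ^^ n)" by (rule mps_funpow[OF mps])
  show "L (\<lambda>\<omega>. F (map_prod (T ^^ n) (R ^^ n) \<omega>)) = L F" if "F \<in> adm M" for F
    using L_funpow[OF that] by (simp add: map_prod_funpow)
qed

text \<open>For invariant Q the functional \<open>l\<close> takes the same value at g and at
  \<open>g \<circ> T\<close>, hence at the Birkhoff averages of g, which converge to the integral.
  So an invariant function is independent of the base, and reweighting by it does not disturb the
  marginal.\<close>

lemma L_base_mult_invariant:
  assumes erg: "ergodic M T" and g: "integrable M g" and Q: "Q \<in> bfun M"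
    and inv: "aeq L (\<lambda>\<omega>. Q (map_prod T R \<omega>)) Q"
  shows "L (\<lambda>\<omega>. g (fst \<omega>) * Q \<omega>) = L Q * (\<integral>x. g x \<partial>M)"
proof -
  from Q obtain C where C: "C \<ge> 0" "\<And>x b. x \<in> space M \<Longrightarrow> cmod (Q (x, b)) \<le> C" by (metis bfunE)
  have QT: "(\<lambda>\<omega>. Q (map_prod T R \<omega>)) \<in> bfun M" by (rule bfun_map_prod[OF mps Q])
  define l where "l = (\<lambda>g. L (\<lambda>\<omega>. g (fst \<omega>) * Q \<omega>))"
  have adm: "(\<lambda>\<omega>. g (fst \<omega>) * Q \<omega>) \<in> adm M" if "integrable M g" for g
    by (intro adm_mult adm_fst Q that)
  have l_add: "l (\<lambda>x. f x + g x) = l f + l g" if "integrable M f" "integrable M g" for f g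
    unfolding l_def distrib_right by (intro L_add adm that)
  have l_scale: "l (\<lambda>x. c * f x) = c * l f" if "integrable M f" for f c
    unfolding l_def mult.assoc by (intro L_scale adm that)
  have l_const: "l (\<lambda>x. c) = c * L Q" for c
    unfolding l_def by (intro L_scale bfun_adm Q)
  have l_bound: "cmod (l f) \<le> C * (\<integral>x. cmod (f x) \<partial>M)" if "integrable M f" for f
    unfolding l_def by (rule cmod_L_fst_mult_le[OF that Q C(2)])
  have l_T: "l (\<lambda>x. g (T x)) = l g" if g: "integrable M g" for g
  proof -
    have gT: "(\<lambda>\<omega>. g (T (fst \<omega>))) \<in> adm M" using adm_fst[OF mps_integrable[OF mps g]] .
    have "l g = L (\<lambda>\<omega>. Q (map_prod T R \<omega>) * g (T (fst \<omega>)))"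
      unfolding l_def using L_inv[OF adm[OF g]] by (simp add: mult.commute)
    also have "\<dots> = L (\<lambda>\<omega>. Q \<omega> * g (T (fst \<omega>)))" by (rule aeq_L_mult[OF inv QT Q gT])
    finally show ?thesis by (simp add: l_def mult.commute)
  qed
  have Tn: "integrable M (\<lambda>x. g ((T ^^ n) x))" if "integrable M g" for g :: "'a \<Rightarrow> complex" and n
    by (rule mps_integrable[OF mps_funpow[OF mps] that])
  have l_Tn: "l (\<lambda>x. g ((T ^^ n) x)) = l g" if g: "integrable M g" for g n
  proof (induction n)
    case (Suc n)
    then show ?case using l_T[OF Tn[OF g, of n]] by (simp add: funpow_swap1)
  qed simp
  have l_sum: "l (\<lambda>x. \<Sum>i<n. g ((T ^^ i) x)) = of_nat n * l g" if g: "integrable M g" for g n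
  proof (induction n)
    case 0
    then show ?case using l_const[of 0] by simp
  next
    case (Suc n)
    have "l (\<lambda>x. (\<Sum>i<n. g ((T ^^ i) x)) + g ((T ^^ n) x)) = of_nat n * l g + l g"
      using l_add[OF Bochner_Integration.integrable_sum[of "{..<n}", OF Tn[OF g]] Tn[OF g, of n]] Suc l_Tn[OF g, of n] by simp
    then show ?case by (simp add: algebra_simps)
  qed
  have "l g - L Q * (\<integral>x. g x \<partial>M) = 0"
  proof (rule L1_functional_eq_0[OF g, where L="\<lambda>g. l g - L Q * (\<integral>x. g x \<partial>M)" and C="C + cmod (L Q)"])
    fix f g :: "'a \<Rightarrow> complex" assume fg: "integrable M f" "integrable M g"
    show "l (\<lambda>x. f x + g x) - L Q * (\<integral>x. f x + g x \<partial>M) = l f - L Q * (\<integral>x. f x \<partial>M) + (l g - L Q * (\<integral>x. g x \<partial>M))"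
      using fg by (simp add: l_add algebra_simps)
  next
    fix f :: "'a \<Rightarrow> complex" assume f: "integrable M f"
    have "cmod (l f - L Q * (\<integral>x. f x \<partial>M)) \<le> cmod (l f) + cmod (L Q) * cmod (\<integral>x. f x \<partial>M)"
      using norm_triangle_ineq4[of "l f" "L Q * (\<integral>x. f x \<partial>M)"] by (simp add: norm_mult)
    also have "\<dots> \<le> C * (\<integral>x. cmod (f x) \<partial>M) + cmod (L Q) * (\<integral>x. cmod (f x) \<partial>M)"
      by (intro add_mono l_bound f mult_left_mono integral_norm_bound) auto
    finally show "cmod (l f - L Q * (\<integral>x. f x \<partial>M)) \<le> (C + cmod (L Q)) * (\<integral>x. cmod (f x) \<partial>M)"
      by (simp add: distrib_right)
  next
    fix g :: "'a \<Rightarrow> complex" and K :: real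
    assume g: "integrable M g" and K: "\<And>x. cmod (g x) \<le> K"
    define I where "I = (\<integral>x. g x \<partial>M)"
    define A where "A = (\<lambda>n x. (\<Sum>i<n. g ((T ^^ i) x)) / of_nat n)"
    have K0: "K \<ge> 0" using K norm_ge_zero order_trans by blast
    have Aint: "integrable M (A n)" for n
      unfolding A_def by (intro integrable_divide_zero Bochner_Integration.integrable_sum Tn g)
    have Ab: "cmod (A n x) \<le> K" for n x
    proof (cases "n = 0")
      case False
      have "cmod (\<Sum>i<n. g ((T ^^ i) x)) \<le> of_nat n * K"
        using sum_norm_bound[of "{..<n}" "\<lambda>i. g ((T ^^ i) x)" K] K by simp
      then show ?thesis using False by (simp add: A_def norm_divide divide_le_eq mult.commute)
    qed (simp add: A_def K0)
    have "(\<lambda>n. \<integral>x. cmod (A n x - I) \<partial>M) \<longlonglongrightarrow> (\<integral>x. 0 \<partial>M)"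
    proof (rule integral_dominated_convergence[where w="\<lambda>x. K + cmod I"])
      show "AE x in M. (\<lambda>n. cmod (A n x - I)) \<longlonglongrightarrow> 0"
        using ergodic_birkhoff[OF erg g]
        by eventually_elim (auto simp: A_def I_def intro!: tendsto_norm_zero LIM_zero)
      show "AE x in M. norm (cmod (A n x - I)) \<le> K + cmod I" for n
        using Ab by (auto intro!: order_trans[OF norm_triangle_ineq4] add_mono)
    qed (use Aint in auto)
    then have z: "(\<lambda>n. C * (\<integral>x. cmod (A n x - I) \<partial>M)) \<longlonglongrightarrow> 0"
      using tendsto_mult_left[of _ 0 _ C] by fastforce
    have "cmod (l g - L Q * I) \<le> C * (\<integral>x. cmod (A n x - I) \<partial>M)" if "n \<ge> 1" for n
    proof -
      have "l (A n) = l g"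
        using l_scale[OF Bochner_Integration.integrable_sum[of "{..<n}", OF Tn[OF g]], of "1 / of_nat n"]
          l_sum[OF g, of n] that by (simp add: A_def)
      moreover have "l (\<lambda>x. A n x + (- I)) = l (A n) + l (\<lambda>x. - I)" by (rule l_add[OF Aint]) simp
      ultimately have "l (\<lambda>x. A n x - I) = l g - L Q * I" using l_const[of "- I"] by (simp add: mult.commute)
      then show ?thesis using l_bound[of "\<lambda>x. A n x - I"] Aint[of n] by simp
    qed
    then have "cmod (l g - L Q * I) \<le> 0" by (intro LIMSEQ_le_const[OF z]) blast
    then show "l g - L Q * (\<integral>x. g x \<partial>M) = 0" by (simp add: I_def)
  qed
  then show ?thesis by (simp add: l_def)
qed

end

text \<open>This is L conditioned on the density q. The quotient restores total mass 1, and the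
  value 0 outside \<open>adm M\<close> is the one that every prestate takes there.\<close>

definition wt :: "'a measure \<Rightarrow> (('a \<times> 'b \<Rightarrow> complex) \<Rightarrow> complex) \<Rightarrow> ('a \<times> 'b \<Rightarrow> real) \<Rightarrow> ('a \<times> 'b \<Rightarrow> complex) \<Rightarrow> complex"
  where "wt M L q F = (if F \<in> adm M then L (\<lambda>\<omega>. F \<omega> * of_real (q \<omega>)) / L (\<lambda>\<omega>. of_real (q \<omega>)) else 0)"

text \<open>The marginal is again M because an invariant weight is independent of the base, by
  ergodicity. Invariance survives because under L the translate of q may be exchanged for q.\<close>

lemma (in state) state_wt:
  assumes erg: "ergodic M T" and Q: "(\<lambda>\<omega>. of_real (q \<omega>)) \<in> bfun M" and q: "\<And>\<omega>. 0 \<le> q \<omega>"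
    and inv: "aeq L (\<lambda>\<omega>. of_real (q (map_prod T R \<omega>))) (\<lambda>\<omega>. of_real (q \<omega>))"
    and nz: "L (\<lambda>\<omega>. of_real (q \<omega>)) \<noteq> 0"
  shows "state M (wt M L q) T R"
proof
  let ?Q = "\<lambda>\<omega>. complex_of_real (q \<omega>)"
  have pos: "L ?Q \<in> \<real>\<^sub>\<ge>\<^sub>0" by (rule L_pos[OF bfun_adm[OF Q]]) (simp add: q)
  show "mps M T" by (rule mps)
  show "wt M L q F = 0" if "F \<notin> adm M" for F using that by (simp add: wt_def)
  show "wt M L q (\<lambda>\<omega>. F \<omega> + G \<omega>) = wt M L q F + wt M L q G" if "F \<in> adm M" "G \<in> adm M" for F G
    using that L_add[OF adm_mult[OF that(1) Q] adm_mult[OF that(2) Q]] adm_add[OF that]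
    by (simp add: wt_def distrib_right add_divide_distrib)
  show "wt M L q (\<lambda>\<omega>. c * F \<omega>) = c * wt M L q F" if "F \<in> adm M" for F c
    using that L_scale[OF adm_mult[OF that Q]] adm_scale[OF that] by (simp add: wt_def mult.assoc)
  show "wt M L q F \<in> \<real>\<^sub>\<ge>\<^sub>0" if "F \<in> adm M" and p: "\<And>x b. x \<in> space M \<Longrightarrow> F (x, b) \<in> \<real>\<^sub>\<ge>\<^sub>0" for F
  proof -
    have "L (\<lambda>\<omega>. F \<omega> * ?Q \<omega>) \<in> \<real>\<^sub>\<ge>\<^sub>0"
      by (rule L_pos[OF adm_mult[OF that(1) Q]]) (use p q in \<open>auto intro!: nonneg_Reals_mult_I\<close>)
    then show ?thesis using that(1) pos by (simp add: wt_def nonneg_Reals_divide_I)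
  qed
  show "wt M L q (\<lambda>\<omega>. g (fst \<omega>)) = (\<integral>x. g x \<partial>M)" if g: "integrable M g" for g
  proof -
    have "(\<lambda>\<omega>::'a \<times> 'b. g (fst \<omega>)) \<in> adm M" by (rule adm_fst[OF g])
    then show ?thesis using L_base_mult_invariant[OF erg g Q inv] nz by (simp add: wt_def)
  qed
  show "wt M L q (\<lambda>\<omega>. F (map_prod T R \<omega>)) = wt M L q F" if F: "F \<in> adm M" for F
  proof -
    have FT: "(\<lambda>\<omega>. F (map_prod T R \<omega>)) \<in> adm M" by (rule adm_map_prod[OF mps F])
    have QT: "(\<lambda>\<omega>. of_real (q (map_prod T R \<omega>))) \<in> bfun M" by (rule bfun_map_prod[OF mps Q])
    have "L (\<lambda>\<omega>. ?Q (map_prod T R \<omega>) * F (map_prod T R \<omega>)) = L (\<lambda>\<omega>. ?Q \<omega> * F \<omega>)"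
      using L_inv[OF adm_mult_left[OF Q F]] by simp
    moreover have "L (\<lambda>\<omega>. ?Q (map_prod T R \<omega>) * F (map_prod T R \<omega>)) = L (\<lambda>\<omega>. ?Q \<omega> * F (map_prod T R \<omega>))"
      by (rule aeq_L_mult[OF inv QT Q FT])
    ultimately show ?thesis using F FT by (simp add: wt_def mult.commute)
  qed
qed

text \<open>
  The density \<open>G\<close> of \<open>v\<close> over the base satisfies \<open>G \<circ> T = \<xi> G\<close> almost everywhere: invariance of the
  state gives the cross term in the expansion of \<open>\<parallel>G \<circ> T - \<xi> G\<parallel>\<^sup>2\<close>, which therefore vanishes.
\<close>

lemma (in state) project_eigenfunction:
  assumes U: "mps M U" "T = U ^^ m" and erg: "ergodic M T"
    and v: "v \<in> um M" and \<xi>: "qeig M U d \<xi>"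
    and eq: "aeq L (\<lambda>\<omega>. v (map_prod T R \<omega>)) (\<lambda>\<omega>. \<xi> (fst \<omega>) * v \<omega>)"
    and g0: "integrable M g0" "L (\<lambda>\<omega>. g0 (fst \<omega>) * v \<omega>) \<noteq> 0"
  obtains \<theta> c where "qeig M U (Suc d) \<theta>" "AE x in M. \<theta> (T x) = \<xi> x * \<theta> x"
    "\<And>g. integrable M g \<Longrightarrow> L (\<lambda>\<omega>. g (fst \<omega>) * v \<omega>) = c * (\<integral>x. g x * \<theta> x \<partial>M)"
proof -
  obtain G C where G[measurable]: "G \<in> borel_measurable M" and C: "\<And>x. cmod (G x) \<le> C"
    and LG: "\<And>g. integrable M g \<Longrightarrow> L (\<lambda>\<omega>. g (fst \<omega>) * v \<omega>) = (\<integral>x. g x * G x \<partial>M)"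
    using L_um_density[OF v] by blast
  note [measurable] = qeig_measurable[OF \<xi>]
  have [measurable]: "(\<lambda>x. G (T x)) \<in> borel_measurable M"
    by (rule measurable_compose[OF mps_meas[OF mps] G])
  have vT: "(\<lambda>\<omega>. v (map_prod T R \<omega>)) \<in> bfun M" by (intro um_bfun um_map_prod mps v)
  have \<xi>v: "(\<lambda>\<omega>. \<xi> (fst \<omega>) * v \<omega>) \<in> bfun M" by (intro um_bfun um_mult um_qeig[OF \<xi>] v)
  have bint: "integrable M h" if "h \<in> borel_measurable M" "\<And>x. cmod (h x) \<le> K" for h :: "'a \<Rightarrow> complex" and K
    by (rule integrable_const_bound[where B=K]) (use that in auto)
  \<comment> \<open>The weak form of the equation for G, from invariance of L and the eigenvalue
    equation for v. It is tested below on the conjugate of G.\<close>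
  have coc: "(\<integral>x. g x * G x \<partial>M) = (\<integral>x. g (T x) * \<xi> x * G x \<partial>M)" if g: "integrable M g" for g
  proof -
    have gT: "integrable M (\<lambda>x. g (T x))" by (rule mps_integrable[OF mps g])
    have gT\<xi>: "integrable M (\<lambda>x. g (T x) * \<xi> x)"
      by (rule Bochner_Integration.integrable_bound[OF gT])
         (use gT qeig_cmod[OF \<xi>] in \<open>auto simp: norm_mult\<close>)
    have "(\<integral>x. g x * G x \<partial>M) = L (\<lambda>\<omega>. v (map_prod T R \<omega>) * g (T (fst \<omega>)))"
      using L_inv[OF adm_mult[OF adm_fst[OF g] um_bfun[OF v]]] LG[OF g] by (simp add: mult.commute)
    also have "\<dots> = L (\<lambda>\<omega>. \<xi> (fst \<omega>) * v \<omega> * g (T (fst \<omega>)))"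
      by (rule aeq_L_mult[OF eq vT \<xi>v adm_fst[OF gT]])
    also have "\<dots> = (\<integral>x. g (T x) * \<xi> x * G x \<partial>M)"
      using LG[OF gT\<xi>] by (simp add: mult_ac)
    finally show ?thesis .
  qed
  have Gint: "integrable M (\<lambda>x. cnj (G x))" by (rule bint[of _ C]) (use C in auto)
  have C0: "0 \<le> C" using C norm_ge_zero order_trans by blast
  let ?n = "\<lambda>x. G x * cnj (G x)"
  have ni: "integrable M ?n" "integrable M (\<lambda>x. G (T x) * cnj (G (T x)))"
    "integrable M (\<lambda>x. cnj (G (T x)) * \<xi> x * G x)"
    by (rule bint[of _ "C * C"]; use C C0 qeig_cmod[OF \<xi>] in \<open>auto simp: norm_mult intro!: mult_mono\<close>)+
  have cross: "(\<integral>x. cnj (G (T x)) * \<xi> x * G x \<partial>M) = (\<integral>x. ?n x \<partial>M)"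
    using coc[OF Gint] by (simp add: mult.commute)
  let ?D = "\<lambda>x. G (T x) - \<xi> x * G x"
  have pt: "complex_of_real ((cmod (?D x))\<^sup>2) = ?n (T x) + ?n x
      - (cnj (G (T x)) * \<xi> x * G x + cnj (cnj (G (T x)) * \<xi> x * G x))" for x
  proof -
    have "\<xi> x * cnj (\<xi> x) = 1" by (rule mult_cnj_unimodular[OF qeig_cmod[OF \<xi>]])
    then have "\<xi> x * G x * cnj (\<xi> x * G x) = ?n x"
      by (metis (no_types, lifting) complex_cnj_mult mult.assoc mult.commute mult.left_neutral)
    then show ?thesis unfolding complex_norm_square by (simp add: algebra_simps)
  qed
  have "(\<integral>x. complex_of_real ((cmod (?D x))\<^sup>2) \<partial>M) = (\<integral>x. ?n (T x) \<partial>M) + (\<integral>x. ?n x \<partial>M)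
      - ((\<integral>x. ?n x \<partial>M) + cnj (\<integral>x. ?n x \<partial>M))"
  proof -
    have c: "integrable M (\<lambda>x. cnj (cnj (G (T x)) * \<xi> x * G x))"
      "(\<integral>x. cnj (cnj (G (T x)) * \<xi> x * G x) \<partial>M) = cnj (\<integral>x. ?n x \<partial>M)"
      using integrable_cnj[OF ni(3)] arg_cong[OF cross, of cnj] Bochner_Integration.integral_cnj[of M "\<lambda>x. cnj (G (T x)) * \<xi> x * G x"]
      by (blast, metis)
    show ?thesis
      unfolding pt
        Bochner_Integration.integral_diff[OF Bochner_Integration.integrable_add[OF ni(2,1)]
          Bochner_Integration.integrable_add[OF ni(3) c(1)]]
        Bochner_Integration.integral_add[OF ni(2,1)] Bochner_Integration.integral_add[OF ni(3) c(1)]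
        cross c(2) ..
  qed
  also have "(\<integral>x. ?n (T x) \<partial>M) = (\<integral>x. ?n x \<partial>M)" by (rule mps_integral[OF mps]) measurable
  also have "cnj (\<integral>x. ?n x \<partial>M) = (\<integral>x. ?n x \<partial>M)"
    using Bochner_Integration.integral_cnj[of M ?n] by (simp add: mult.commute)
  finally have "(\<integral>x. complex_of_real ((cmod (?D x))\<^sup>2) \<partial>M) = 0" by simp
  then have zero: "(\<integral>x. (cmod (?D x))\<^sup>2 \<partial>M) = 0" by (simp only: integral_complex_of_real of_real_eq_0_iff)
  have Dint: "integrable M (\<lambda>x. (cmod (?D x))\<^sup>2)"
  proof (rule integrable_const_bound[where B="(2 * C)\<^sup>2"])
    show "AE x in M. norm ((cmod (?D x))\<^sup>2) \<le> (2 * C)\<^sup>2"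
    proof (rule AE_I2)
      fix x
      have "cmod (?D x) \<le> cmod (G (T x)) + cmod (\<xi> x * G x)" by (rule norm_triangle_ineq4)
      also have "\<dots> \<le> 2 * C" using C[of "T x"] C[of x] qeig_cmod[OF \<xi>] by (simp add: norm_mult)
      finally have "(cmod (?D x))\<^sup>2 \<le> (2 * C)\<^sup>2" by (rule power_mono) simp
      then show "norm ((cmod (?D x))\<^sup>2) \<le> (2 * C)\<^sup>2" by simp
    qed
  qed measurable
  have GT: "AE x in M. G (T x) = \<xi> x * G x"
    using zero by (subst (asm) integral_nonneg_eq_0_iff_AE[OF Dint]) auto
  have cint: "integrable M (\<lambda>x. complex_of_real (cmod (G x)))"
    by (rule bint[of _ C]) (use C in auto)
  \<comment> \<open>Since \<xi> is unimodular, |G| is invariant and by ergodicity a constant \<rho>.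
    The correlation with \<open>g0\<close> excludes \<rho> = 0, so that G can be normalised to
    modulus 1.\<close>
  define \<rho> where "\<rho> = (\<integral>x. cmod (G x) \<partial>M)"
  have "AE x in M. complex_of_real (cmod (G (T x))) = complex_of_real (cmod (G x))"
    using GT by eventually_elim (simp add: norm_mult qeig_cmod[OF \<xi>])
  then have "AE x in M. complex_of_real (cmod (G x)) = (\<integral>x. complex_of_real (cmod (G x)) \<partial>M)"
    by (rule ergodic_invariant_const[OF erg cint])
  then have \<rho>: "AE x in M. cmod (G x) = \<rho>"
    by (simp add: \<rho>_def)
  have "\<rho> \<noteq> 0"
  proof
    assume "\<rho> = 0"
    with \<rho> have "AE x in M. g0 x * G x = 0" by auto
    then have "(\<integral>x. g0 x * G x \<partial>M) = 0" by (rule integral_eq_zero_AE)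
    then show False using g0 LG by simp
  qed
  moreover have "\<rho> \<ge> 0" by (simp add: \<rho>_def)
  ultimately have \<rho>0: "\<rho> > 0" by simp
  define \<theta> where "\<theta> = (\<lambda>x. if cmod (G x) = \<rho> then G x / \<rho> else 1)"
  have \<theta>m: "\<theta> \<in> borel_measurable M" unfolding \<theta>_def by measurable
  have \<theta>1: "cmod (\<theta> x) = 1" for x using \<rho>0 by (simp add: \<theta>_def norm_divide)
  have \<theta>G: "AE x in M. G x = \<rho> * \<theta> x"
    using \<rho> by eventually_elim (use \<rho>0 in \<open>simp add: \<theta>_def\<close>)
  from GT \<theta>G mps_AE[OF mps \<theta>G] have \<theta>T: "AE x in M. \<theta> (T x) = \<xi> x * \<theta> x"
    by eventually_elim (use \<rho>0 in simp)
  \<comment> \<open>The equation for \<theta> involves the power T of U; \<open>qeig_root\<close>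
    descends from T to U.\<close>
  have "qeig M U (Suc d) \<theta>"
    using qeig_root[OF U(1) erg[unfolded U(2)] \<theta>m \<theta>1 \<xi>] \<theta>T unfolding U(2) by blast
  moreover note \<theta>T
  moreover have "L (\<lambda>\<omega>. g (fst \<omega>) * v \<omega>) = \<rho> * (\<integral>x. g x * \<theta> x \<partial>M)" if g: "integrable M g" for g
  proof -
    have "(\<integral>x. g x * G x \<partial>M) = (\<integral>x. \<rho> * (g x * \<theta> x) \<partial>M)"
      by (rule integral_cong_AE) (use g \<theta>m \<theta>G in \<open>auto\<close>)
    then show ?thesis using LG[OF g] by simp
  qed
  ultimately show thesis by (rule that)
qed

section \<open>Compactness and faces\<close>

text \<open>The Banach-Alaoglu argument: positivity and the marginal confine \<open>L F\<close> to a
  disc whose radius is the integral of a fixed dominating function of F. All functionals thus lie in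
  a product of discs, and every defining condition involves finitely many coordinates and is
  closed.\<close>

lemma compact_prestates:
  fixes M :: "'a measure"
  shows "compact {L :: ('a \<times> 'b \<Rightarrow> complex) \<Rightarrow> complex. prestate M L}"
proof (cases "prob_space M")
  case False
  then have "{L :: ('a \<times> 'b \<Rightarrow> complex) \<Rightarrow> complex. prestate M L} = {}" by (auto simp: prestate_def)
  then show ?thesis by (simp only: compact_empty)
next
  case True
  define dom where "dom = (\<lambda>F::'a \<times> 'b \<Rightarrow> complex. SOME D::'a \<Rightarrow> real.
    integrable M D \<and> (\<forall>x\<in>space M. \<forall>b. cmod (F (x, b)) \<le> D x))"
  have dom: "integrable M (dom F)" "\<And>x b. x \<in> space M \<Longrightarrow> cmod (F (x, b)) \<le> dom F x" if "F \<in> adm M" for F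
    using someI_ex[of "\<lambda>D. integrable M D \<and> (\<forall>x\<in>space M. \<forall>b. cmod (F (x, b)) \<le> D x)"] that
    by (auto simp: dom_def adm_def)
  define K where "K = Pi\<^sub>E UNIV (\<lambda>F. cball (0::complex) (if F \<in> adm M then \<integral>x. dom F x \<partial>M else 0))"
  have "compactin (product_topology (\<lambda>_. euclidean) UNIV) K"
    unfolding K_def compactin_PiE by simp
  then have K: "compact K" by (simp add: euclidean_product_topology)
  have sub: "{L :: ('a \<times> 'b \<Rightarrow> complex) \<Rightarrow> complex. prestate M L} \<subseteq> K"
  proof
    fix L assume "L \<in> {L :: ('a \<times> 'b \<Rightarrow> complex) \<Rightarrow> complex. prestate M L}"
    then interpret prestate M L by simp
    show "L \<in> K"
      unfolding K_def
    proof (rule PiE_I)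
      fix F
      have "cmod (L F) \<le> (\<integral>x. dom F x \<partial>M)" if "F \<in> adm M"
        by (rule order_trans[OF cmod_L_le[OF that] nrm_le_integral[OF that dom[OF that]]])
      then show "L F \<in> cball 0 (if F \<in> adm M then \<integral>x. dom F x \<partial>M else 0)"
        by (simp add: L_out)
    qed simp
  qed
  let ?C = "(\<Inter>F\<in>- adm M. {L. L F = 0}) \<inter>
    (\<Inter>F\<in>adm M. \<Inter>G\<in>adm M. {L. L (\<lambda>\<omega>. F \<omega> + G \<omega>) = L F + L G}) \<inter>
    (\<Inter>F\<in>adm M. \<Inter>c. {L. L (\<lambda>\<omega>. c * F \<omega>) = c * L F}) \<inter>
    (\<Inter>F\<in>{F \<in> adm M. \<forall>x\<in>space M. \<forall>b. F (x, b) \<in> \<real>\<^sub>\<ge>\<^sub>0}. {L. L F \<in> \<real>\<^sub>\<ge>\<^sub>0}) \<inter>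
    (\<Inter>g\<in>{g. integrable M g}. {L. L (\<lambda>\<omega>. g (fst \<omega>)) = (\<integral>x. g x \<partial>M)}) :: (('a \<times> 'b \<Rightarrow> complex) \<Rightarrow> complex) set"
  have "closed {L :: ('a \<times> 'b \<Rightarrow> complex) \<Rightarrow> complex. L F \<in> \<real>\<^sub>\<ge>\<^sub>0}" for F
    using closed_vimage[OF closed_nonneg_Reals_complex continuous_on_product_coordinates[of F]]
    by (simp add: vimage_def)
  then have "closed ?C"
    by (intro closed_Int closed_INT ballI closed_Collect_eq continuous_intros
        continuous_on_product_coordinates) auto
  moreover have "{L :: ('a \<times> 'b \<Rightarrow> complex) \<Rightarrow> complex. prestate M L} = ?C"
    using True unfolding prestate_def prestate_axioms_def by (intro set_eqI) auto
  ultimately have "closed {L :: ('a \<times> 'b \<Rightarrow> complex) \<Rightarrow> complex. prestate M L}" by simp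
  with K have "compact (K \<inter> {L :: ('a \<times> 'b \<Rightarrow> complex) \<Rightarrow> complex. prestate M L})" by (rule compact_Int_closed)
  with sub show ?thesis by (simp add: Int_absorb1)
qed

lemma compact_states:
  fixes M :: "'a measure" and R :: "'b \<Rightarrow> 'b"
  shows "compact {L :: ('a \<times> 'b \<Rightarrow> complex) \<Rightarrow> complex. state M L T R}"
proof (cases "mps M T")
  case False
  then have "{L :: ('a \<times> 'b \<Rightarrow> complex) \<Rightarrow> complex. state M L T R} = {}" by (auto simp: state_def state_axioms_def)
  then show ?thesis by (simp only: compact_empty)
next
  case True
  have "{L :: ('a \<times> 'b \<Rightarrow> complex) \<Rightarrow> complex. state M L T R} = {L :: ('a \<times> 'b \<Rightarrow> complex) \<Rightarrow> complex. prestate M L} \<inter> (\<Inter>F\<in>adm M. {L :: ('a \<times> 'b \<Rightarrow> complex) \<Rightarrow> complex. L (\<lambda>\<omega>. F (map_prod T R \<omega>)) = L F})"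
    using True by (auto simp: state_def state_axioms_def)
  moreover have "closed (\<Inter>F\<in>adm M. {L :: ('a \<times> 'b \<Rightarrow> complex) \<Rightarrow> complex. L (\<lambda>\<omega>. F (map_prod T R \<omega>)) = L F})"
    by (intro closed_INT ballI closed_Collect_eq continuous_on_product_coordinates)
  ultimately show ?thesis by (simp only: compact_Int_closed[OF compact_prestates])
qed

text \<open>
  Nonempty compact sets of states that are stable under reweighting by invariant functions.
  Maximising a real functional over such a set produces another one, and maximising an invariant
  function makes it constant: this replaces the ergodic decomposition.
\<close>

definition face :: "'a measure \<Rightarrow> ('a \<Rightarrow> 'a) \<Rightarrow> ('b \<Rightarrow> 'b) \<Rightarrow> (('a \<times> 'b \<Rightarrow> complex) \<Rightarrow> complex) set \<Rightarrow> bool"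
  where "face M T R K \<longleftrightarrow> compact K \<and> K \<noteq> {} \<and> (\<forall>L\<in>K. state M L T R) \<and>
    (\<forall>L\<in>K. \<forall>q. (\<lambda>\<omega>. of_real (q \<omega>)) \<in> bfun M \<longrightarrow> (\<forall>\<omega>. 0 \<le> q \<omega> \<and> q \<omega> \<le> 1) \<longrightarrow>
      aeq L (\<lambda>\<omega>. of_real (q (map_prod T R \<omega>))) (\<lambda>\<omega>. of_real (q \<omega>)) \<longrightarrow>
      L (\<lambda>\<omega>. of_real (q \<omega>)) \<noteq> 0 \<longrightarrow> wt M L q \<in> K)"

lemma face_state: "face M T R K \<Longrightarrow> L \<in> K \<Longrightarrow> state M L T R"
  by (simp add: face_def)

lemma face_wt:
  assumes "face M T R K" "L \<in> K" "(\<lambda>\<omega>. of_real (q \<omega>)) \<in> bfun M" "\<And>\<omega>. 0 \<le> q \<omega>" "\<And>\<omega>. q \<omega> \<le> 1"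
    "aeq L (\<lambda>\<omega>. of_real (q (map_prod T R \<omega>))) (\<lambda>\<omega>. of_real (q \<omega>))" "L (\<lambda>\<omega>. of_real (q \<omega>)) \<noteq> 0"
  shows "wt M L q \<in> K"
  using assms unfolding face_def by blast

text \<open>Reweighting preserves null relations, since |V - W| times a bounded weight is null when
  |V - W| is.\<close>

lemma face_aeq:
  assumes erg: "ergodic M T" and V: "V \<in> bfun M" and W: "W \<in> bfun M"
    and L0: "state M L0 T R" "aeq L0 V W"
  shows "face M T R {L. state M L T R \<and> aeq L V W}"
  unfolding face_def
proof (intro conjI ballI allI impI)
  have "closed {L. aeq L V W}"
    unfolding aeq_def nrm_def
    by (intro closed_Collect_eq continuous_intros continuous_on_product_coordinates)
  from compact_Int_closed[OF compact_states this]
  show "compact {L. state M L T R \<and> aeq L V W}" by (simp add: Collect_conj_eq)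
  show "{L. state M L T R \<and> aeq L V W} \<noteq> {}" using L0 by blast
  show "state M L T R" if "L \<in> {L. state M L T R \<and> aeq L V W}" for L using that by simp
  fix L q
  assume L: "L \<in> {L. state M L T R \<and> aeq L V W}" and Q: "(\<lambda>\<omega>. complex_of_real (q \<omega>)) \<in> bfun M"
    and q: "\<forall>\<omega>. 0 \<le> q \<omega> \<and> q \<omega> \<le> 1"
    and inv: "aeq L (\<lambda>\<omega>. of_real (q (map_prod T R \<omega>))) (\<lambda>\<omega>. of_real (q \<omega>))"
    and nz: "L (\<lambda>\<omega>. of_real (q \<omega>)) \<noteq> 0"
  interpret state M L T R using L by simp
  have d: "(\<lambda>\<omega>. V \<omega> - W \<omega>) \<in> bfun M" by (intro bfun_intros V W)
  have a: "(\<lambda>\<omega>. of_real (cmod (V \<omega> - W \<omega>))) \<in> bfun M" by (intro bfun_intros V W)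
  have "nrm L (\<lambda>\<omega>. of_real (cmod (V \<omega> - W \<omega>)) * of_real (q \<omega>)) = 0"
    by (rule nrm_bfun_mult_0[OF a _ bfun_adm[OF Q]]) (use L in \<open>simp add: aeq_def nrm_def\<close>)
  then have "L (\<lambda>\<omega>. of_real (cmod (V \<omega> - W \<omega>)) * of_real (q \<omega>)) = 0"
    using cmod_L_le[OF bfun_adm[OF bfun_mult[OF a Q]]] by simp
  then have "aeq (wt M L q) V W"
    using bfun_adm[OF a] by (simp add: aeq_def nrm_def wt_def)
  moreover have "state M (wt M L q) T R" by (rule state_wt[OF erg Q _ inv nz]) (use q in auto)
  ultimately show "wt M L q \<in> {L. state M L T R \<and> aeq L V W}" by simp
qed

definition maximizers :: "(('a \<times> 'b \<Rightarrow> complex) \<Rightarrow> complex) set \<Rightarrow> ('a \<times> 'b \<Rightarrow> complex) \<Rightarrow> (('a \<times> 'b \<Rightarrow> complex) \<Rightarrow> complex) set"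
  where "maximizers K F = {L \<in> K. \<forall>L'\<in>K. Re (L' F) \<le> Re (L F)}"

text \<open>With \<open>c = L q\<close> the state L is the convex combination, with coefficients c
  and 1 - c, of its reweightings by q and by 1 - q. If L attains the maximum, so does each part with
  a positive coefficient.\<close>

lemma face_maximizers:
  fixes M :: "'a measure" and R :: "'b \<Rightarrow> 'b"
  assumes erg: "ergodic M T" and K: "face M T R K" and F: "F \<in> adm M"
  shows "face M T R (maximizers K F)"
  unfolding face_def
proof (intro conjI ballI allI impI)
  have cK: "compact K" "K \<noteq> {}" using K by (auto simp: face_def)
  have cont: "continuous_on UNIV (\<lambda>L :: ('a \<times> 'b \<Rightarrow> complex) \<Rightarrow> complex. Re (L F))"
    by (intro continuous_intros continuous_on_product_coordinates)
  show "maximizers K F \<noteq> {}"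
    using continuous_attains_sup[OF cK continuous_on_subset[OF cont]] by (auto simp: maximizers_def)
  have "closed (\<Inter>L'\<in>K. {L. Re (L' F) \<le> Re (L F)})"
    by (intro closed_INT ballI closed_Collect_le cont continuous_on_const)
  from compact_Int_closed[OF cK(1) this]
  show "compact (maximizers K F)" by (simp add: maximizers_def Int_def)
  show "state M L T R" if "L \<in> maximizers K F" for L
    using that face_state[OF K] by (simp add: maximizers_def)
  fix L and q :: "'a \<times> 'b \<Rightarrow> real"
  let ?Q = "\<lambda>\<omega>. complex_of_real (q \<omega>)" and ?P = "\<lambda>\<omega>. complex_of_real (1 - q \<omega>)"
  assume L: "L \<in> maximizers K F" and Q: "?Q \<in> bfun M"
    and q: "\<forall>\<omega>. 0 \<le> q \<omega> \<and> q \<omega> \<le> 1"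
    and inv: "aeq L (\<lambda>\<omega>. of_real (q (map_prod T R \<omega>))) ?Q"
    and nz: "L ?Q \<noteq> 0"
  have LK: "L \<in> K" and max: "\<And>L'. L' \<in> K \<Longrightarrow> Re (L' F) \<le> Re (L F)"
    using L by (auto simp: maximizers_def)
  interpret state M L T R using face_state[OF K LK] .
  have "(\<lambda>\<omega>. 1 - ?Q \<omega>) \<in> bfun M" by (intro bfun_intros Q)
  then have P: "?P \<in> bfun M" by simp
  have invP: "aeq L (\<lambda>\<omega>. of_real (1 - q (map_prod T R \<omega>))) ?P"
    using inv by (simp add: aeq_def nrm_def norm_minus_commute)
  have wQ: "wt M L q \<in> K" by (rule face_wt[OF K LK Q _ _ inv nz]) (use q in auto)
  obtain c where c: "L ?Q = of_real c" using L_of_real[OF bfun_adm[OF Q]] by blast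
  have "L ?Q \<in> \<real>\<^sub>\<ge>\<^sub>0" by (rule L_pos[OF bfun_adm[OF Q]]) (use q in auto)
  then have c0: "c > 0" using nz c by (auto simp: complex_nonneg_Reals_iff less_le)
  have LP: "L ?P = of_real (1 - c)"
    using L_diff[OF bfun_adm[OF bfun_const[of 1]] bfun_adm[OF Q]] L_const[of 1] c by simp
  have "L ?P \<in> \<real>\<^sub>\<ge>\<^sub>0" by (rule L_pos[OF bfun_adm[OF P]]) (use q in \<open>auto simp del: of_real_diff\<close>)
  then have c1: "c \<le> 1" unfolding LP by (simp add: complex_nonneg_Reals_iff)
  have split: "L F = L (\<lambda>\<omega>. F \<omega> * ?Q \<omega>) + L (\<lambda>\<omega>. F \<omega> * ?P \<omega>)"
    using L_add[OF adm_mult[OF F Q] adm_mult[OF F P]] by (simp add: algebra_simps)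
  have FQ: "L (\<lambda>\<omega>. F \<omega> * ?Q \<omega>) = of_real c * wt M L q F"
    using F nz c by (simp add: wt_def)
  have "Re (L (\<lambda>\<omega>. F \<omega> * ?P \<omega>)) \<le> (1 - c) * Re (L F)"
  \<comment> \<open>For c = 1 the second part does not exist, but then 1 - q is null and contributes
    nothing.\<close>
  proof (cases "c = 1")
    case True
    have "\<bar>1 - q \<omega>\<bar> = 1 - q \<omega>" for \<omega> using q by (simp only: abs_of_nonneg diff_ge_0_iff_ge)
    then have "nrm L ?P = Re (L ?P)" unfolding nrm_def norm_of_real by (simp only:)
    then have "nrm L ?P = 0" unfolding LP using True by simp
    then have "nrm L (\<lambda>\<omega>. ?P \<omega> * F \<omega>) = 0" by (rule nrm_bfun_mult_0[OF P _ F])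
    then have "L (\<lambda>\<omega>. F \<omega> * ?P \<omega>) = 0"
      using cmod_L_le[OF adm_mult_left[OF P F]] by (simp add: mult.commute)
    then show ?thesis using True by simp
  next
    case False
    then have nz': "L ?P \<noteq> 0" using LP by simp
    have "wt M L (\<lambda>\<omega>. 1 - q \<omega>) \<in> K"
      by (rule face_wt[OF K LK P _ _ invP nz']) (use q in auto)
    from max[OF this] have "(1 - c) * Re (wt M L (\<lambda>\<omega>. 1 - q \<omega>) F) \<le> (1 - c) * Re (L F)"
      using c1 by (intro mult_left_mono) auto
    moreover have "L (\<lambda>\<omega>. F \<omega> * ?P \<omega>) = of_real (1 - c) * wt M L (\<lambda>\<omega>. 1 - q \<omega>) F"
      using F nz' LP by (simp add: wt_def)
    ultimately show ?thesis by (simp del: of_real_diff)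
  qed
  then have "c * Re (L F) \<le> c * Re (wt M L q F)"
    using arg_cong[OF split, of Re] FQ by (simp add: algebra_simps)
  then have ge: "Re (L F) \<le> Re (wt M L q F)" using c0 by simp
  show "wt M L q \<in> maximizers K F"
    unfolding maximizers_def using wQ ge max by (auto intro: order_trans)
qed

text \<open>Reweighting L by q itself gives q the mean \<open>L (q\<^sup>2) / L q\<close>. By
  maximality this does not exceed \<open>L q\<close>, so q has variance 0 under L.\<close>

lemma maximizers_const:
  fixes M :: "'a measure" and R :: "'b \<Rightarrow> 'b" and q :: "'a \<times> 'b \<Rightarrow> real"
  assumes erg: "ergodic M T" and K: "face M T R K" and L: "L \<in> maximizers K (\<lambda>\<omega>. of_real (q \<omega>))"
    and Q: "(\<lambda>\<omega>. of_real (q \<omega>)) \<in> bfun M" and q: "\<And>\<omega>. 0 \<le> q \<omega>" "\<And>\<omega>. q \<omega> \<le> 1"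
    and inv: "aeq L (\<lambda>\<omega>. of_real (q (map_prod T R \<omega>))) (\<lambda>\<omega>. of_real (q \<omega>))"
  obtains c where "aeq L (\<lambda>\<omega>. of_real (q \<omega>)) (\<lambda>\<omega>. of_real c)"
proof -
  let ?Q = "\<lambda>\<omega>. complex_of_real (q \<omega>)"
  have LK: "L \<in> K" and max: "\<And>L'. L' \<in> K \<Longrightarrow> Re (L' ?Q) \<le> Re (L ?Q)"
    using L by (auto simp: maximizers_def)
  interpret state M L T R using face_state[OF K LK] .
  have Qa: "?Q \<in> adm M" by (rule bfun_adm[OF Q])
  obtain c where c: "L ?Q = of_real c" using L_of_real[OF Qa] by blast
  have c0: "c \<ge> 0"
    using L_pos[OF Qa] q c by (simp add: complex_nonneg_Reals_iff)
  show thesis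
  proof (cases "c = 0")
    case True
    have "nrm L ?Q = 0" using c True q by (simp add: nrm_def)
    then show thesis using that[of 0] by (simp add: aeq_def)
  next
    case False
    then have nz: "L ?Q \<noteq> 0" using c by simp
    have QQ: "(\<lambda>\<omega>. ?Q \<omega> * ?Q \<omega>) \<in> adm M" by (rule adm_mult[OF Qa Q])
    have "wt M L q \<in> K" by (rule face_wt[OF K LK Q q inv nz])
    from max[OF this] have "Re (L (\<lambda>\<omega>. ?Q \<omega> * ?Q \<omega>)) / c \<le> c"
      using Qa c by (simp add: wt_def)
    then have le: "Re (L (\<lambda>\<omega>. ?Q \<omega> * ?Q \<omega>)) \<le> c * c"
      using c0 False by (simp add: divide_le_eq)
    have adm: "(\<lambda>\<omega>. of_real (2 * c) * ?Q \<omega>) \<in> adm M" "(\<lambda>\<omega>. of_real (c * c)) \<in> adm M"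
      by (intro adm_intros Qa bfun_adm bfun_intros)+
    have "(\<lambda>\<omega>. complex_of_real ((cmod (?Q \<omega> - of_real c))\<^sup>2))
        = (\<lambda>\<omega>. (?Q \<omega> * ?Q \<omega> - of_real (2 * c) * ?Q \<omega>) + of_real (c * c))"
    proof
      fix \<omega>
      have "cmod (?Q \<omega> - of_real c) = \<bar>q \<omega> - c\<bar>" by (metis norm_of_real of_real_diff)
      then show "complex_of_real ((cmod (?Q \<omega> - of_real c))\<^sup>2)
          = (?Q \<omega> * ?Q \<omega> - of_real (2 * c) * ?Q \<omega>) + of_real (c * c)"
        by (simp add: power2_eq_square algebra_simps)
    qed
    then have "L (\<lambda>\<omega>. complex_of_real ((cmod (?Q \<omega> - of_real c))\<^sup>2))
        = L (\<lambda>\<omega>. ?Q \<omega> * ?Q \<omega>) - of_real (2 * c) * L ?Q + of_real (c * c)"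
      by (simp only: L_add[OF adm_diff[OF QQ adm(1)] adm(2)] L_diff[OF QQ adm(1)] L_scale[OF Qa] L_const)
    then have "Re (L (\<lambda>\<omega>. complex_of_real ((cmod (?Q \<omega> - of_real c))\<^sup>2))) \<le> 0"
      using le c by simp
    then have "nrm L (\<lambda>\<omega>. ?Q \<omega> - of_real c) = 0"
      by (intro nrm_eq_0I bfun_intros Q)
    then show thesis using that[of c] by (simp add: aeq_def)
  qed
qed

section \<open>Equality up to quasi-eigenfunctions of the base\<close>

text \<open>Factors from class d of the base count as trivial. A function whose derivative lies in
  that class is equivalent to its translate and can be handled like an invariant function.\<close>

definition sim :: "'a measure \<Rightarrow> ('a \<Rightarrow> 'a) \<Rightarrow> nat \<Rightarrow> (('a \<times> 'b \<Rightarrow> complex) \<Rightarrow> complex) \<Rightarrow>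
    ('a \<times> 'b \<Rightarrow> complex) \<Rightarrow> ('a \<times> 'b \<Rightarrow> complex) \<Rightarrow> bool"
  where "sim M U d L F G \<longleftrightarrow> (\<exists>\<xi>. qeig M U d \<xi> \<and> aeq L F (\<lambda>\<omega>. G \<omega> * \<xi> (fst \<omega>)))"

lemma (in prestate) um_adm: "F \<in> um M \<Longrightarrow> F \<in> adm M"
  by (intro bfun_adm um_bfun)

lemma (in prestate) aeq_sim: "aeq L F G \<Longrightarrow> sim M U d L F G"
  unfolding sim_def by (rule exI[of _ "\<lambda>_. 1"]) (simp add: qeig_one)

lemma (in prestate) sim_refl: "sim M U d L F F"
  by (intro aeq_sim aeq_refl)

lemma (in prestate) sim_mult:
  assumes "sim M U d L F G" "sim M U d L F' G'" "F \<in> um M" "G \<in> um M" "F' \<in> um M" "G' \<in> um M"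
  shows "sim M U d L (\<lambda>\<omega>. F \<omega> * F' \<omega>) (\<lambda>\<omega>. G \<omega> * G' \<omega>)"
proof -
  obtain \<xi> \<xi>' where \<xi>: "qeig M U d \<xi>" "aeq L F (\<lambda>\<omega>. G \<omega> * \<xi> (fst \<omega>))"
    and \<xi>': "qeig M U d \<xi>'" "aeq L F' (\<lambda>\<omega>. G' \<omega> * \<xi>' (fst \<omega>))"
    using assms(1,2) by (auto simp: sim_def)
  have "aeq L (\<lambda>\<omega>. F \<omega> * F' \<omega>) (\<lambda>\<omega>. (G \<omega> * \<xi> (fst \<omega>)) * (G' \<omega> * \<xi>' (fst \<omega>)))"
    by (intro aeq_um_mult \<xi> \<xi>' um_mult um_qeig[OF \<xi>(1)] um_qeig[OF \<xi>'(1)] assms)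
  then show ?thesis unfolding sim_def
    by (intro exI[of _ "\<lambda>x. \<xi> x * \<xi>' x"]) (simp add: qeig_mult \<xi> \<xi>' mult_ac)
qed

lemma (in prestate) sim_trans:
  assumes "sim M U d L F G" "sim M U d L G H" "F \<in> um M" "G \<in> um M" "H \<in> um M"
  shows "sim M U d L F H"
proof -
  obtain \<xi> \<xi>' where \<xi>: "qeig M U d \<xi>" "aeq L F (\<lambda>\<omega>. G \<omega> * \<xi> (fst \<omega>))"
    and \<xi>': "qeig M U d \<xi>'" "aeq L G (\<lambda>\<omega>. H \<omega> * \<xi>' (fst \<omega>))"
    using assms(1,2) by (auto simp: sim_def)
  note um = um_mult um_qeig[OF \<xi>(1)] um_qeig[OF \<xi>'(1)] assms
  have "aeq L (\<lambda>\<omega>. G \<omega> * \<xi> (fst \<omega>)) (\<lambda>\<omega>. (H \<omega> * \<xi>' (fst \<omega>)) * \<xi> (fst \<omega>))"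
    by (intro aeq_um_mult \<xi>' aeq_refl um)
  then have "aeq L F (\<lambda>\<omega>. (H \<omega> * \<xi>' (fst \<omega>)) * \<xi> (fst \<omega>))"
    by (rule aeq_trans[OF \<xi>(2)]) (intro um_adm um)+
  then show ?thesis unfolding sim_def
    by (intro exI[of _ "\<lambda>x. \<xi> x * \<xi>' x"]) (simp add: qeig_mult \<xi> \<xi>' mult_ac)
qed

lemma (in prestate) sim_sym:
  assumes "sim M U d L F G" "F \<in> um M" "G \<in> um M"
  shows "sim M U d L G F"
proof -
  obtain \<xi> where \<xi>: "qeig M U d \<xi>" "aeq L F (\<lambda>\<omega>. G \<omega> * \<xi> (fst \<omega>))"
    using assms(1) by (auto simp: sim_def)
  note um = um_mult um_qeig[OF \<xi>(1)] um_qeig[OF qeig_cnj[OF \<xi>(1)]] assms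
  have "aeq L (\<lambda>\<omega>. F \<omega> * cnj (\<xi> (fst \<omega>))) (\<lambda>\<omega>. G \<omega> * \<xi> (fst \<omega>) * cnj (\<xi> (fst \<omega>)))"
    by (intro aeq_um_mult \<xi> aeq_refl um)
  also have "(\<lambda>\<omega>. G \<omega> * \<xi> (fst \<omega>) * cnj (\<xi> (fst \<omega>))) = G"
    using mult_cnj_unimodular[OF qeig_cmod[OF \<xi>(1)]] by (simp add: mult.assoc)
  finally show ?thesis unfolding sim_def
    by (intro exI[of _ "\<lambda>x. cnj (\<xi> x)"]) (simp add: qeig_cnj \<xi> aeq_sym)
qed

lemma (in prestate) sim_prod:
  assumes "finite I" "\<And>i. i \<in> I \<Longrightarrow> sim M U d L (F i) (G i)" "\<And>i. i \<in> I \<Longrightarrow> F i \<in> um M" "\<And>i. i \<in> I \<Longrightarrow> G i \<in> um M"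
  shows "sim M U d L (\<lambda>\<omega>. \<Prod>i\<in>I. F i \<omega>) (\<lambda>\<omega>. \<Prod>i\<in>I. G i \<omega>)"
  using assms
proof (induction I rule: finite_induct)
  case (insert i I)
  then show ?case
    using sim_mult[of U d "F i" "G i" "\<lambda>\<omega>. \<Prod>i\<in>I. F i \<omega>" "\<lambda>\<omega>. \<Prod>i\<in>I. G i \<omega>"] um_prod[of I F M] um_prod[of I G M]
    by simp
qed (simp add: sim_refl)

lemma (in prestate) sim_power:
  assumes "sim M U d L F G" "F \<in> um M" "G \<in> um M"
  shows "sim M U d L (\<lambda>\<omega>. F \<omega> ^ n) (\<lambda>\<omega>. G \<omega> ^ n)"
  using sim_prod[of "{..<n}" U d "\<lambda>_. F" "\<lambda>_. G"] assms by simp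

section \<open>Iterated derivatives and powers of the map\<close>

lemma um_map_prod_funpow:
  fixes T :: "'a \<Rightarrow> 'a" and R :: "'b \<Rightarrow> 'b"
  shows "mps M T \<Longrightarrow> F \<in> um M \<Longrightarrow> (\<lambda>\<omega>. F ((map_prod T R ^^ l) \<omega>)) \<in> um M"
  unfolding map_prod_funpow by (rule um_map_prod[OF mps_funpow])

lemma um_mder_funpow:
  fixes T :: "'a \<Rightarrow> 'a" and R :: "'b \<Rightarrow> 'b"
  shows "mps M T \<Longrightarrow> F \<in> um M \<Longrightarrow> mder (map_prod T R ^^ l) F \<in> um M"
  unfolding map_prod_funpow by (rule um_mder[OF mps_funpow])

lemma um_mder_iter:
  fixes T :: "'a \<Rightarrow> 'a" and R :: "'b \<Rightarrow> 'b"
  shows "mps M T \<Longrightarrow> F \<in> um M \<Longrightarrow> (mder (map_prod T R) ^^ i) F \<in> um M"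
  by (induction i) (auto intro: um_mder)

lemma um_mder_funpow_iter:
  fixes T :: "'a \<Rightarrow> 'a" and R :: "'b \<Rightarrow> 'b"
  shows "mps M T \<Longrightarrow> F \<in> um M \<Longrightarrow> (mder (map_prod T R ^^ l) ^^ i) F \<in> um M"
  by (induction i) (auto intro: um_mder_funpow)

lemma mder_iter_mult:
  "(mder \<tau> ^^ a) (\<lambda>\<omega>. F \<omega> * G \<omega>) = (\<lambda>\<omega>. (mder \<tau> ^^ a) F \<omega> * (mder \<tau> ^^ a) G \<omega>)"
  by (induction a) (simp_all add: mder_mult)

lemma mder_iter_one: "(mder \<tau> ^^ a) (\<lambda>\<omega>. 1) = (\<lambda>\<omega>. 1)"
  by (induction a) (simp_all add: mder_def)

lemma mder_iter_prod:
  "(mder \<tau> ^^ a) (\<lambda>\<omega>. \<Prod>l<r. F l \<omega>) = (\<lambda>\<omega>. \<Prod>l<(r::nat). (mder \<tau> ^^ a) (F l) \<omega>)"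
  by (induction r) (simp_all add: mder_iter_mult mder_iter_one)

lemma mder_iter_comp:
  assumes "\<And>\<omega>. \<tau> (\<sigma> \<omega>) = \<sigma> (\<tau> \<omega>)"
  shows "(mder \<tau> ^^ a) (\<lambda>\<omega>. F (\<sigma> \<omega>)) = (\<lambda>\<omega>. (mder \<tau> ^^ a) F (\<sigma> \<omega>))"
  by (induction a) (simp_all add: mder_comp[where \<tau>=\<tau> and \<sigma>=\<sigma>, OF assms])

text \<open>The class belongs to U while the state is invariant under a power T of U; the factor
  from the base stays in the class because quasi-eigenfunctions of U are stable under U.\<close>

lemma (in state) sim_shift:
  assumes "sim M U d L F G" "F \<in> um M" "G \<in> um M" "mps M U" "T = U ^^ m"
  shows "sim M U d L (\<lambda>\<omega>. F (map_prod T R \<omega>)) (\<lambda>\<omega>. G (map_prod T R \<omega>))"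
proof -
  obtain \<xi> where \<xi>: "qeig M U d \<xi>" "aeq L F (\<lambda>\<omega>. G \<omega> * \<xi> (fst \<omega>))"
    using assms(1) by (auto simp: sim_def)
  have "aeq L (\<lambda>\<omega>. F (map_prod T R \<omega>)) (\<lambda>\<omega>. G (map_prod T R \<omega>) * \<xi> (fst (map_prod T R \<omega>)))"
    by (intro aeq_shift[OF \<xi>(2)] um_adm um_mult um_qeig[OF \<xi>(1)] assms)
  moreover have "qeig M U d (\<lambda>x. \<xi> (T x))"
    unfolding assms(5) by (rule qeig_shift_funpow[OF assms(4) \<xi>(1)])
  ultimately show ?thesis unfolding sim_def by (intro exI[of _ "\<lambda>x. \<xi> (T x)"]) simp
qed

lemma (in state) sim_shift_funpow:
  assumes "sim M U d L F G" "F \<in> um M" "G \<in> um M" "mps M U" "T = U ^^ m"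
  shows "sim M U d L (\<lambda>\<omega>. F ((map_prod T R ^^ l) \<omega>)) (\<lambda>\<omega>. G ((map_prod T R ^^ l) \<omega>))"
proof (induction l)
  case (Suc l)
  from sim_shift[OF this um_map_prod_funpow[OF mps assms(2)] um_map_prod_funpow[OF mps assms(3)] assms(4,5)]
  show ?case by (simp add: funpow_swap1)
qed (use assms in simp)

lemma (in state) sim_invariant_funpow:
  assumes "sim M U d L (\<lambda>\<omega>. v (map_prod T R \<omega>)) v" "v \<in> um M" "mps M U" "T = U ^^ m"
  shows "sim M U d L (\<lambda>\<omega>. v ((map_prod T R ^^ l) \<omega>)) v"
proof (induction l)
  case (Suc l)
  have "sim M U d L (\<lambda>\<omega>. v ((map_prod T R ^^ l) (map_prod T R \<omega>))) (\<lambda>\<omega>. v (map_prod T R \<omega>))"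
    by (rule sim_shift[OF Suc um_map_prod_funpow[OF mps assms(2)] assms(2-4)])
  from sim_trans[OF this assms(1) um_map_prod[OF mps um_map_prod_funpow[OF mps assms(2)]] um_map_prod[OF mps assms(2)] assms(2)]
  show ?case by (simp add: funpow_swap1)
qed (simp add: sim_refl)

text \<open>A derivative along \<open>map_prod T R ^^ r\<close> is a product of r translates of a
  derivative along the map itself. As v is invariant up to the class, each of the a derivatives
  multiplies the exponent by r. The b derivatives are those not yet exchanged; the induction lets
  their number grow.\<close>

lemma (in state) sim_mder_funpow:
  assumes U: "mps M U" "T = U ^^ m" and u: "u \<in> um M"
    and v: "v = (mder (map_prod T R) ^^ (a + b)) u"
    and inv: "sim M U d L (\<lambda>\<omega>. v (map_prod T R \<omega>)) v"
  shows "sim M U d L ((mder (map_prod T R ^^ r) ^^ a) ((mder (map_prod T R) ^^ b) u)) (\<lambda>\<omega>. v \<omega> ^ (r ^ a))"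
  using v
proof (induction a arbitrary: b)
  case 0
  then show ?case by (simp add: sim_refl)
next
  case (Suc a)
  let ?\<tau> = "map_prod T R"
  let ?w = "(mder ?\<tau> ^^ b) u"
  let ?z = "(mder (?\<tau> ^^ r) ^^ a) ((mder ?\<tau> ^^ Suc b) u)"
  have vu: "v \<in> um M" unfolding Suc(2) by (rule um_mder_iter[OF mps u])
  have zu: "?z \<in> um M" by (intro um_mder_funpow_iter um_mder_iter mps u)
  have IH: "sim M U d L ?z (\<lambda>\<omega>. v \<omega> ^ (r ^ a))" by (rule Suc(1)) (simp add: Suc(2))
  have comm: "(?\<tau> ^^ r) ((?\<tau> ^^ l) \<omega>) = (?\<tau> ^^ l) ((?\<tau> ^^ r) \<omega>)" for l \<omega>
    by (metis comp_apply funpow_add add.commute)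
  have "mder (?\<tau> ^^ r) ?w = (\<lambda>\<omega>. \<Prod>l<r. mder ?\<tau> ?w ((?\<tau> ^^ l) \<omega>))"
    by (rule mder_funpow) (rule um_cmod[OF um_mder_iter[OF mps u]])
  then have eq: "(mder (?\<tau> ^^ r) ^^ Suc a) ?w = (\<lambda>\<omega>. \<Prod>l<r. ?z ((?\<tau> ^^ l) \<omega>))"
    by (simp only: funpow_Suc_right comp_apply mder_iter_prod mder_iter_comp[where \<tau>="map_prod T R ^^ r" and \<sigma>="map_prod T R ^^ _", OF comm]) (simp add: funpow_swap1)
  have "sim M U d L (\<lambda>\<omega>. \<Prod>l<r. ?z ((?\<tau> ^^ l) \<omega>)) (\<lambda>\<omega>. \<Prod>l<r. v \<omega> ^ (r ^ a))"
  proof (rule sim_prod)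
    fix l
    have "sim M U d L (\<lambda>\<omega>. v ((?\<tau> ^^ l) \<omega>) ^ (r ^ a)) (\<lambda>\<omega>. v \<omega> ^ (r ^ a))"
      by (intro sim_power sim_invariant_funpow[OF inv vu U] um_map_prod_funpow mps vu)
    with sim_shift_funpow[OF IH zu um_power[OF vu] U, of l]
    show "sim M U d L (\<lambda>\<omega>. ?z ((?\<tau> ^^ l) \<omega>)) (\<lambda>\<omega>. v \<omega> ^ (r ^ a))"
      by (rule sim_trans) (intro um_map_prod_funpow um_power mps vu zu)+
  qed (rule finite_lessThan, intro um_map_prod_funpow mps zu, intro um_power vu)
  then show ?case unfolding eq by (simp add: power_mult[symmetric] mult.commute)
qed

section \<open>Van der Corput's method for states\<close>

lemma (in prestate) L_cnj:
  assumes "F \<in> adm M"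
  shows "L (\<lambda>\<omega>. cnj (F \<omega>)) = cnj (L F)"
proof -
  let ?R = "\<lambda>\<omega>. of_real (Re (F \<omega>)) :: complex" and ?I = "\<lambda>\<omega>. of_real (Im (F \<omega>)) :: complex"
  have adm: "?R \<in> adm M" "?I \<in> adm M" "(\<lambda>\<omega>. \<i> * ?I \<omega>) \<in> adm M" by (intro adm_intros assms)+
  have "(\<lambda>\<omega>. cnj (F \<omega>)) = (\<lambda>\<omega>. ?R \<omega> - \<i> * ?I \<omega>)" "F = (\<lambda>\<omega>. ?R \<omega> + \<i> * ?I \<omega>)"
    by (auto simp: complex_eq_iff fun_eq_iff)
  then have "L (\<lambda>\<omega>. cnj (F \<omega>)) = L ?R - \<i> * L ?I" "L F = L ?R + \<i> * L ?I"
    using L_diff[OF adm(1,3)] L_add[OF adm(1,3)] L_scale[OF adm(2)] by metis+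
  then show ?thesis
    using L_of_real[OF adm(1)] L_of_real[OF adm(2)] by (simp add: complex_eq_iff)
qed

text \<open>The translates of w are pairwise orthogonal with equal norm, so the square of the sum of
  H of them has mean H times a constant. By Cauchy-Schwarz this mean is at least
  \<open>H\<^sup>2 * (cmod (L w))\<^sup>2\<close>, which is impossible for large H unless
  \<open>L w\<close> vanishes.\<close>

lemma (in state) L_eq_0_if_orthogonal_shifts:
  assumes w: "w \<in> bfun M"
    and orth: "\<And>h. h \<ge> 1 \<Longrightarrow> L (\<lambda>\<omega>. w ((map_prod T R ^^ h) \<omega>) * cnj (w \<omega>)) = 0"
  shows "L w = 0"
proof -
  let ?\<tau> = "map_prod T R"
  let ?w = "\<lambda>h \<omega>. w ((?\<tau> ^^ h) \<omega>)"
  let ?B = "L (\<lambda>\<omega>. w \<omega> * cnj (w \<omega>))"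
  have wh: "?w h \<in> bfun M" for h
    unfolding map_prod_funpow by (rule bfun_map_prod[OF mps_funpow[OF mps] w])
  have cc: "(\<lambda>\<omega>. ?w h \<omega> * cnj (?w h' \<omega>)) \<in> adm M" for h h'
    by (intro bfun_adm bfun_intros wh)
  have shift: "L (\<lambda>\<omega>. ?w (h + j) \<omega> * cnj (?w (h' + j) \<omega>)) = L (\<lambda>\<omega>. ?w h \<omega> * cnj (?w h' \<omega>))" for h h' j
    using L_funpow[OF cc[of h h'], of j] by (simp add: funpow_add)
  have lt: "L (\<lambda>\<omega>. ?w h \<omega> * cnj (?w h' \<omega>)) = 0" if "h > h'" for h h'
    using shift[of "h - h'" h' 0] orth[of "h - h'"] that by simp
  have ip: "L (\<lambda>\<omega>. ?w h \<omega> * cnj (?w h' \<omega>)) = (if h = h' then ?B else 0)" for h h'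
  proof (cases h h' rule: linorder_cases)
    case less
    from L_cnj[OF cc[of h' h]] lt[OF less] less show ?thesis by (simp add: mult.commute)
  next
    case equal
    then show ?thesis using shift[of 0 h 0] by simp
  next
    case greater
    then show ?thesis using lt by simp
  qed
  have bound: "real H * (cmod (L w))\<^sup>2 \<le> Re ?B" if "H \<ge> 1" for H :: nat
  proof -
    let ?W = "\<lambda>\<omega>. \<Sum>h<H. ?w h \<omega>"
    have W: "?W \<in> bfun M" by (intro bfun_sum wh)
    have "L ?W = of_nat H * L w"
      using L_sum[of "{..<H}" ?w] bfun_adm[OF wh] L_funpow[OF bfun_adm[OF w]] by simp
    then have "(of_nat H * cmod (L w))\<^sup>2 \<le> Re (L (\<lambda>\<omega>. ?W \<omega> * cnj (?W \<omega>)))"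
      using norm_L_power2_le[OF W] by (simp add: norm_mult)
    also have "L (\<lambda>\<omega>. ?W \<omega> * cnj (?W \<omega>)) = (\<Sum>h<H. \<Sum>h'<H. L (\<lambda>\<omega>. ?w h \<omega> * cnj (?w h' \<omega>)))"
      unfolding cnj_sum sum_product by (simp add: L_sum adm_sum cc)
    also have "\<dots> = of_nat H * ?B" unfolding ip by simp
    finally have "real H * (real H * (cmod (L w))\<^sup>2) \<le> real H * Re ?B"
      by (simp add: power_mult_distrib power2_eq_square mult_ac)
    then show ?thesis using that by simp
  qed
  show "L w = 0"
  proof (rule ccontr)
    assume "L w \<noteq> 0"
    then have "(cmod (L w))\<^sup>2 > 0" by simp
    then obtain H where H: "Re ?B < real H * (cmod (L w))\<^sup>2" using reals_Archimedean3 by blast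
    also have "\<dots> \<le> real (Suc H) * (cmod (L w))\<^sup>2" by (intro mult_right_mono) auto
    also have "\<dots> \<le> Re ?B" by (rule bound) simp
    finally show False by simp
  qed
qed

text \<open>Differencing u with step h lowers the order i by one and turns the top derivative into
  its h-th power, up to a factor from the base. This is why \<open>zero\<close> speaks of all powers
  r and all integrable g: the factor is absorbed into g, the exponent into r.\<close>

lemma (in state) van_der_corput_iterate:
  assumes U: "mps M U" "T = U ^^ m" and u: "u \<in> um M"
    and inv: "sim M U d L (\<lambda>\<omega>. (mder (map_prod T R) ^^ i) u (map_prod T R \<omega>)) ((mder (map_prod T R) ^^ i) u)"
    and zero: "\<And>g r. integrable M g \<Longrightarrow> r \<ge> 1 \<Longrightarrow> L (\<lambda>\<omega>. g (fst \<omega>) * (mder (map_prod T R) ^^ i) u \<omega> ^ r) = 0"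
    and g: "integrable M g"
  shows "L (\<lambda>\<omega>. g (fst \<omega>) * u \<omega>) = 0"
  using u inv zero g
proof (induction i arbitrary: u g)
  case 0
  then show ?case using 0(3)[of g 1] by simp
next
  case (Suc i)
  let ?\<tau> = "map_prod T R"
  let ?v = "(mder ?\<tau> ^^ Suc i) u"
  have v: "?v \<in> um M" by (intro um_mder_iter mps Suc)
  have main: "L (\<lambda>\<omega>. g (fst \<omega>) * mder (?\<tau> ^^ h) u \<omega>) = 0" if h: "h \<ge> 1" and g: "integrable M g" for h g
  proof (rule Suc(1)[OF _ _ _ g])
    let ?u = "mder (?\<tau> ^^ h) u"
    let ?vh = "(mder ?\<tau> ^^ i) ?u"
    show u: "?u \<in> um M" by (intro um_mder_funpow mps Suc)
    have vh: "?vh \<in> um M" by (intro um_mder_iter mps u)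
    have comm: "?\<tau> ((?\<tau> ^^ l) \<omega>) = (?\<tau> ^^ l) (?\<tau> \<omega>)" for l \<omega> by (simp add: funpow_swap1)
    have "?u = (\<lambda>\<omega>. \<Prod>l<h. mder ?\<tau> u ((?\<tau> ^^ l) \<omega>))"
      by (rule mder_funpow) (rule um_cmod[OF Suc(2)])
    then have vh_eq: "?vh = (\<lambda>\<omega>. \<Prod>l<h. ?v ((?\<tau> ^^ l) \<omega>))"
      by (simp only: mder_iter_prod mder_iter_comp[where \<tau>="map_prod T R" and \<sigma>="map_prod T R ^^ _", OF comm]) (simp add: funpow_swap1)
    have "sim M U d L ?vh (\<lambda>\<omega>. \<Prod>l<h. ?v \<omega>)"
      unfolding vh_eq by (intro sim_prod sim_invariant_funpow[OF Suc(3) v U] um_map_prod_funpow mps v) simp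
    then have sim: "sim M U d L ?vh (\<lambda>\<omega>. ?v \<omega> ^ h)" by simp
    have vp: "(\<lambda>\<omega>. ?v \<omega> ^ h) \<in> um M" "(\<lambda>\<omega>. ?v (?\<tau> \<omega>) ^ h) \<in> um M"
      "(\<lambda>\<omega>. ?v (?\<tau> \<omega>)) \<in> um M" "(\<lambda>\<omega>. ?vh (?\<tau> \<omega>)) \<in> um M"
      by (intro um_power um_map_prod mps v vh)+
    have "sim M U d L (\<lambda>\<omega>. ?vh (?\<tau> \<omega>)) (\<lambda>\<omega>. ?v (?\<tau> \<omega>) ^ h)"
      by (rule sim_shift[OF sim vh vp(1) U])
    from sim_trans[OF this sim_power[OF Suc(3) vp(3) v] vp(4,2,1)]
    show "sim M U d L (\<lambda>\<omega>. ?vh (?\<tau> \<omega>)) ?vh"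
      by (rule sim_trans[OF _ sim_sym[OF sim vh vp(1)] vp(4,1) vh])
    fix g :: "'a \<Rightarrow> complex" and r :: nat assume g: "integrable M g" and r: "r \<ge> 1"
    from sim obtain \<xi> where \<xi>: "qeig M U d \<xi>" "aeq L ?vh (\<lambda>\<omega>. ?v \<omega> ^ h * \<xi> (fst \<omega>))"
      by (auto simp: sim_def)
    have um: "(\<lambda>\<omega>. ?v \<omega> ^ h * \<xi> (fst \<omega>)) \<in> um M" by (intro um_mult vp um_qeig[OF \<xi>(1)])
    have g\<xi>: "integrable M (\<lambda>x. g x * \<xi> x ^ r)"
      by (rule Bochner_Integration.integrable_bound[OF g])
         (use g qeig_measurable[OF \<xi>(1)] qeig_cmod[OF \<xi>(1)] in \<open>auto simp: norm_mult norm_power\<close>)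
    have "L (\<lambda>\<omega>. ?vh \<omega> ^ r * g (fst \<omega>)) = L (\<lambda>\<omega>. (?v \<omega> ^ h * \<xi> (fst \<omega>)) ^ r * g (fst \<omega>))"
      by (intro aeq_L_mult aeq_um_power \<xi> vh um um_bfun um_power adm_fst g)
    also have "\<dots> = L (\<lambda>\<omega>. (g (fst \<omega>) * \<xi> (fst \<omega>) ^ r) * ?v \<omega> ^ (h * r))"
      by (simp add: power_mult_distrib power_mult mult_ac)
    also have "\<dots> = 0" using Suc(4)[OF g\<xi>, of "h * r"] h r by simp
    finally show "L (\<lambda>\<omega>. g (fst \<omega>) * ?vh \<omega> ^ r) = 0" by (simp add: mult.commute)
  qed
  show ?case
  \<comment> \<open>A bounded g is wanted because it is multiplied below with the conjugate of its
    own translate.\<close>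
  proof (rule L_fst_mult_eq_0[OF Suc(5) um_bfun[OF Suc(2)]])
    fix g :: "'a \<Rightarrow> complex" and K :: real
    assume g: "integrable M g" and K: "\<And>x. cmod (g x) \<le> K"
    show "L (\<lambda>\<omega>. g (fst \<omega>) * u \<omega>) = 0"
    proof (rule L_eq_0_if_orthogonal_shifts)
      show "(\<lambda>\<omega>. g (fst \<omega>) * u \<omega>) \<in> bfun M"
        by (rule bfun_mult[OF bfun_fst[OF _ K] um_bfun[OF Suc(2)]]) (use g in auto)
      fix h :: nat assume h: "h \<ge> 1"
      have gh: "integrable M (\<lambda>x. g ((T ^^ h) x) * cnj (g x))"
      proof (rule Bochner_Integration.integrable_bound[of _ "\<lambda>x. K * cmod (g ((T ^^ h) x))"])
        show "integrable M (\<lambda>x. K * cmod (g ((T ^^ h) x)))"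
          using mps_integrable[OF mps_funpow[OF mps] g, of h] by auto
        show "(\<lambda>x. g ((T ^^ h) x) * cnj (g x)) \<in> borel_measurable M"
          using mps_integrable[OF mps_funpow[OF mps] g, of h] g by auto
        show "AE x in M. norm (g ((T ^^ h) x) * cnj (g x)) \<le> norm (K * cmod (g ((T ^^ h) x)))"
        proof (rule AE_I2)
          fix x
          have "cmod (g x) \<le> \<bar>K\<bar>" using K[of x] by linarith
          then show "norm (g ((T ^^ h) x) * cnj (g x)) \<le> norm (K * cmod (g ((T ^^ h) x)))"
            by (simp add: norm_mult abs_mult mult.commute mult_right_mono)
        qed
      qed
      show "L (\<lambda>\<omega>. g (fst ((?\<tau> ^^ h) \<omega>)) * u ((?\<tau> ^^ h) \<omega>) * cnj (g (fst \<omega>) * u \<omega>)) = 0"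
        using main[OF h gh] by (simp add: mder_def map_prod_funpow mult_ac)
    qed
  qed
qed

text \<open>
  The heart of the proof: a state under which the \<open>j\<close>-th derivative of \<open>u\<close> is a quasi-eigenfunction
  of the base cannot correlate \<open>u\<close> with \<open>f\<close>. Let \<open>v\<close> be the previous derivative. Either all powers
  of \<open>v\<close> are orthogonal to the base and van der Corput applies, or some \<open>v\<^sup>r\<close> agrees with a
  quasi-eigenfunction up to an invariant function \<open>J\<close>. On an extremal state \<open>J\<close> is constant, so with
  respect to the \<open>r\<close>-th power of the transformation already the derivative of order \<open>j - 1\<close>
  comes from the base.
\<close>

lemma state_annihilates:
  fixes M :: "'a measure" and U :: "'a \<Rightarrow> 'a" and V :: "'b \<Rightarrow> 'b"
  assumes te: "totally_ergodic M U" and u: "u \<in> um M" and f: "integrable M f"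
    and perp: "\<And>g. qeig M U (Suc k) g \<Longrightarrow> (\<integral>x. f x * g x \<partial>M) = 0"
    and "j \<le> k" "m \<ge> 1" "state M L (U ^^ m) (V ^^ m)" "qeig M U (k - j) \<xi>"
    and "aeq L ((mder (map_prod (U ^^ m) (V ^^ m)) ^^ Suc j) u) (\<lambda>\<omega>. \<xi> (fst \<omega>))"
  shows "L (\<lambda>\<omega>. f (fst \<omega>) * u \<omega>) = 0"
  using assms(5-)
proof (induction j arbitrary: m L \<xi>)
  case 0
  let ?T = "U ^^ m" and ?R = "V ^^ m"
  let ?\<tau> = "map_prod ?T ?R"
  have U: "mps M U" and erg: "ergodic M ?T"
    using te 0(2) by (auto simp: totally_ergodic_def)
  interpret state M L ?T ?R by (rule 0)
  note um = um_mult um_cnj um_map_prod[OF mps u] u um_qeig[OF 0(4)]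
  \<comment> \<open>Here u itself satisfies an eigenvalue equation whose multiplier \<xi> has class
    k, so its projection to the base has class k + 1, to which f is orthogonal.\<close>
  have "aeq L (\<lambda>\<omega>. mder ?\<tau> u \<omega> * u \<omega>) (\<lambda>\<omega>. \<xi> (fst \<omega>) * u \<omega>)"
    by (rule aeq_um_mult[OF _ aeq_refl])
       (use 0(5) in simp, unfold mder_def, (intro um)+)
  also have "(\<lambda>\<omega>. mder ?\<tau> u \<omega> * u \<omega>) = (\<lambda>\<omega>. u (?\<tau> \<omega>))"
  proof
    fix \<omega>
    show "mder ?\<tau> u \<omega> * u \<omega> = u (?\<tau> \<omega>)"
      using mult_cnj_unimodular[OF um_cmod[OF u, of \<omega>]] by (simp add: mder_def mult.assoc mult.commute)
  qed
  finally have eq: "aeq L (\<lambda>\<omega>. u (?\<tau> \<omega>)) (\<lambda>\<omega>. \<xi> (fst \<omega>) * u \<omega>)" .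
  show ?case
  proof (rule ccontr)
    assume nz: "L (\<lambda>\<omega>. f (fst \<omega>) * u \<omega>) \<noteq> 0"
    obtain \<theta> c where "qeig M U (Suc (k - 0)) \<theta>"
      and L: "\<And>g. integrable M g \<Longrightarrow> L (\<lambda>\<omega>. g (fst \<omega>) * u \<omega>) = c * (\<integral>x. g x * \<theta> x \<partial>M)"
      using project_eigenfunction[OF U refl erg u 0(4) eq f nz] by metis
    then have "(\<integral>x. f x * \<theta> x \<partial>M) = 0" using perp by simp
    then show False using nz L[OF f] by simp
  qed
next
  case (Suc j)
  let ?T = "U ^^ m" and ?R = "V ^^ m"
  let ?\<tau> = "map_prod ?T ?R"
  define d where "d = k - Suc j"
  have d: "Suc d = k - j" using Suc(2) by (simp add: d_def)
  have U: "mps M U" and erg: "ergodic M ?T"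
    using te Suc(3) by (auto simp: totally_ergodic_def)
  have mpsT: "mps M ?T" by (rule mps_funpow[OF U])
  have \<xi>: "qeig M U d \<xi>" using Suc(5) by (simp add: d_def)
  define v where "v = (mder ?\<tau> ^^ Suc j) u"
  have v: "v \<in> um M" unfolding v_def by (rule um_mder_iter[OF mpsT u])
  have Dv: "mder ?\<tau> v \<in> um M" by (rule um_mder[OF mpsT v])
  have vT: "(\<lambda>\<omega>. v (?\<tau> \<omega>)) \<in> um M" by (rule um_map_prod[OF mpsT v])
  have \<xi>u: "(\<lambda>\<omega>. \<xi> (fst \<omega>)) \<in> um M" by (rule um_qeig[OF \<xi>])
  define F where "F = (\<lambda>\<omega>::'a \<times> 'b. f (fst \<omega>) * u \<omega>)"
  have F: "F \<in> adm M" unfolding F_def by (intro adm_mult adm_fst f um_bfun u)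
  show ?case
  proof (rule ccontr)
    assume nz: "L (\<lambda>\<omega>. f (fst \<omega>) * u \<omega>) \<noteq> 0"
    \<comment> \<open>The factor \<open>cnj (L F)\<close> makes the value at L real and positive;
      the value at a maximizer is at least as large, so u still correlates with f there.\<close>
    define F' where "F' = (\<lambda>\<omega>. cnj (L F) * F \<omega>)"
    have F': "F' \<in> adm M" unfolding F'_def by (rule adm_scale[OF F])
    define K0 where "K0 = {L. state M L ?T ?R \<and> aeq L (mder ?\<tau> v) (\<lambda>\<omega>. \<xi> (fst \<omega>))}"
    have LK0: "L \<in> K0" using Suc by (simp add: K0_def v_def)
    have face0: "face M ?T ?R K0"
      unfolding K0_def by (rule face_aeq[OF erg um_bfun[OF Dv] um_bfun[OF \<xi>u]]) (use LK0 in \<open>auto simp: K0_def\<close>)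
    define K1 where "K1 = maximizers K0 F'"
    have face1: "face M ?T ?R K1" unfolding K1_def by (rule face_maximizers[OF erg face0 F'])
    have K1_nz: "L' F \<noteq> 0" if "L' \<in> K1" for L'
    proof -
      have "L' \<in> K0" and le: "Re (L F') \<le> Re (L' F')" using that LK0 by (auto simp: K1_def maximizers_def)
      interpret L: state M L ?T ?R using face_state[OF face0 LK0] .
      interpret L': state M L' ?T ?R using face_state[OF face0 \<open>L' \<in> K0\<close>] .
      have "L F' = of_real ((cmod (L F))\<^sup>2)"
        unfolding F'_def L.L_scale[OF F] complex_norm_square by (rule mult.commute)
      moreover have "L F \<noteq> 0" using nz by (simp add: F_def)
      ultimately have "Re (L F') > 0" by simp
      then have "L' F' \<noteq> 0" using le by auto
      then show ?thesis unfolding F'_def L'.L_scale[OF F] by simp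
    qed
    have K1_K0: "K1 \<subseteq> K0" by (auto simp: K1_def maximizers_def)
    have shift: "aeq L' (\<lambda>\<omega>. v (?\<tau> \<omega>)) (\<lambda>\<omega>. \<xi> (fst \<omega>) * v \<omega>)" if "L' \<in> K0" for L'
    proof -
      interpret L': state M L' ?T ?R using face_state[OF face0 that] .
      have "aeq L' (\<lambda>\<omega>. mder ?\<tau> v \<omega> * v \<omega>) (\<lambda>\<omega>. \<xi> (fst \<omega>) * v \<omega>)"
        by (rule L'.aeq_um_mult[OF _ L'.aeq_refl Dv \<xi>u v v]) (use that in \<open>simp add: K0_def\<close>)
      moreover have "mder ?\<tau> v \<omega> * v \<omega> = v (?\<tau> \<omega>)" for \<omega>
        using mult_cnj_unimodular[OF um_cmod[OF v, of \<omega>]] by (simp add: mder_def mult.assoc mult.commute)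
      ultimately show ?thesis by simp
    qed
    have sim: "sim M U d L' (\<lambda>\<omega>. v (?\<tau> \<omega>)) v" if "L' \<in> K0" for L'
      unfolding sim_def using shift[OF that] \<xi> by (intro exI[of _ \<xi>]) (simp add: mult.commute)
    obtain L1 where L1: "L1 \<in> K1" using face1 by (auto simp: face_def)
    interpret L1: state M L1 ?T ?R using face_state[OF face1 L1] .
    \<comment> \<open>Otherwise every power of v is orthogonal to the base, and van der Corput makes
      \<open>L1 F\<close> vanish, against the choice of \<open>K1\<close>.\<close>
    have "\<exists>g r. integrable M g \<and> r \<ge> 1 \<and> L1 (\<lambda>\<omega>. g (fst \<omega>) * v \<omega> ^ r) \<noteq> 0"
    proof (rule ccontr)
      assume "\<not> ?thesis"
      then have "L1 F = 0"
        unfolding F_def using K1_K0 L1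
        by (intro L1.van_der_corput_iterate[OF U refl u _ _ f, where i="Suc j" and d=d])
           (use sim in \<open>auto simp: v_def[symmetric] simp del: funpow.simps\<close>)
      then show False using K1_nz[OF L1] by simp
    qed
    then obtain g0 r where g0: "integrable M g0" and r: "r \<ge> 1" and nz0: "L1 (\<lambda>\<omega>. g0 (fst \<omega>) * v \<omega> ^ r) \<noteq> 0"
      by blast
    have vr: "(\<lambda>\<omega>. v \<omega> ^ r) \<in> um M" by (rule um_power[OF v])
    have \<xi>r: "qeig M U d (\<lambda>x. \<xi> x ^ r)" by (rule qeig_power[OF \<xi>])
    have shift_r: "aeq L' (\<lambda>\<omega>. v (?\<tau> \<omega>) ^ r) (\<lambda>\<omega>. \<xi> (fst \<omega>) ^ r * v \<omega> ^ r)" if "L' \<in> K0" for L'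
    proof -
      interpret L': state M L' ?T ?R using face_state[OF face0 that] .
      have "aeq L' (\<lambda>\<omega>. v (?\<tau> \<omega>) ^ r) (\<lambda>\<omega>. (\<xi> (fst \<omega>) * v \<omega>) ^ r)"
        by (intro L'.aeq_um_power shift that vT um_mult \<xi>u v)
      then show ?thesis by (simp add: power_mult_distrib)
    qed
    obtain \<theta> where \<theta>: "qeig M U (Suc d) \<theta>" and \<theta>T: "AE x in M. \<theta> (?T x) = \<xi> x ^ r * \<theta> x"
      using L1.project_eigenfunction[OF U refl erg vr \<xi>r shift_r g0 nz0] L1 K1_K0 by blast
    \<comment> \<open>Both \<open>v ^ r\<close> and \<theta> pick up the factor
      \<open>\<xi> ^ r\<close> under the map, so J is invariant. This holds under every state of
      \<open>K0\<close>, not merely under \<open>L1\<close>, which allows J to be maximised over a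
      face.\<close>
    define J where "J = (\<lambda>\<omega>. v \<omega> ^ r * cnj (\<theta> (fst \<omega>)))"
    have \<theta>u: "(\<lambda>\<omega>. \<theta> (fst \<omega>)) \<in> um M" "(\<lambda>\<omega>. cnj (\<theta> (fst \<omega>))) \<in> um M"
      by (rule um_qeig[OF \<theta>], rule um_qeig[OF qeig_cnj[OF \<theta>]])
    have J: "J \<in> um M" unfolding J_def by (intro um_mult vr \<theta>u)
    have JT: "(\<lambda>\<omega>. J (?\<tau> \<omega>)) \<in> um M" by (rule um_map_prod[OF mpsT J])
    have J_inv: "aeq L' (\<lambda>\<omega>. J (?\<tau> \<omega>)) J" if "L' \<in> K0" for L'
    proof -
      interpret L': state M L' ?T ?R using face_state[OF face0 that] .
      have \<theta>T': "qeig M U (Suc d) (\<lambda>x. cnj (\<theta> (?T x)))"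
        by (rule qeig_cnj[OF qeig_shift_funpow[OF U \<theta>]])
      have \<xi>\<theta>: "qeig M U (Suc d) (\<lambda>x. cnj (\<xi> x ^ r * \<theta> x))"
        by (rule qeig_cnj[OF qeig_mult[OF qeig_Suc[OF U \<xi>r] \<theta>]])
      have "aeq L' (\<lambda>\<omega>. cnj (\<theta> (?T (fst \<omega>)))) (\<lambda>\<omega>. cnj (\<xi> (fst \<omega>) ^ r * \<theta> (fst \<omega>)))"
        by (rule L'.aeq_fst[of "\<lambda>x. cnj (\<theta> (?T x))" "\<lambda>x. cnj (\<xi> x ^ r * \<theta> x)"])
           (use \<theta>T qeig_measurable[OF \<theta>T'] qeig_measurable[OF \<xi>\<theta>] qeig_cmod[OF \<theta>T'] qeig_cmod[OF \<xi>\<theta>] in auto)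
      then have "aeq L' (\<lambda>\<omega>. v (?\<tau> \<omega>) ^ r * cnj (\<theta> (?T (fst \<omega>))))
          (\<lambda>\<omega>. \<xi> (fst \<omega>) ^ r * v \<omega> ^ r * cnj (\<xi> (fst \<omega>) ^ r * \<theta> (fst \<omega>)))"
        by (intro L'.aeq_um_mult shift_r that um_power vT um_mult vr um_qeig[OF \<xi>r] um_qeig[OF \<xi>\<theta>] um_qeig[OF \<theta>T'])
      moreover have "\<xi> x ^ r * w * cnj (\<xi> x ^ r * \<theta> x) = w * cnj (\<theta> x)" for x w
      proof -
        have "\<xi> x ^ r * w * cnj (\<xi> x ^ r * \<theta> x) = (\<xi> x ^ r * cnj (\<xi> x ^ r)) * (w * cnj (\<theta> x))"
          by (simp only: complex_cnj_mult mult_ac)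
        then show ?thesis using mult_cnj_unimodular[OF qeig_cmod[OF \<xi>r, of x]] by (simp only: mult_1)
      qed
      ultimately show ?thesis by (simp only: J_def fst_map_prod)
    qed
    let ?p = "\<lambda>\<omega>. (1 + Re (J \<omega>)) / 2" and ?q = "\<lambda>\<omega>. (1 + Im (J \<omega>)) / 2"
    note pq = um_parts(1,2)[OF J] and bounds = um_parts(3-6)[OF J]
    have pq_inv: "aeq L' (\<lambda>\<omega>. of_real (?p (?\<tau> \<omega>))) (\<lambda>\<omega>. of_real (?p \<omega>))"
      "aeq L' (\<lambda>\<omega>. of_real (?q (?\<tau> \<omega>))) (\<lambda>\<omega>. of_real (?q \<omega>))" if "L' \<in> K0" for L'
    proof -
      interpret L': state M L' ?T ?R using face_state[OF face0 that] .
      have d: "(\<lambda>\<omega>. J (?\<tau> \<omega>) - J \<omega>) \<in> bfun M" by (intro bfun_diff um_bfun J JT)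
      have pd: "(\<lambda>\<omega>. complex_of_real (?p (?\<tau> \<omega>)) - of_real (?p \<omega>)) \<in> bfun M"
        "(\<lambda>\<omega>. complex_of_real (?q (?\<tau> \<omega>)) - of_real (?q \<omega>)) \<in> bfun M"
        using bfun_diff[OF bfun_map_prod[OF mpsT pq(1)] pq(1)] bfun_diff[OF bfun_map_prod[OF mpsT pq(2)] pq(2)] by simp_all
      have le: "cmod (complex_of_real (?p (?\<tau> \<omega>)) - of_real (?p \<omega>)) \<le> cmod (J (?\<tau> \<omega>) - J \<omega>)"
        "cmod (complex_of_real (?q (?\<tau> \<omega>)) - of_real (?q \<omega>)) \<le> cmod (J (?\<tau> \<omega>) - J \<omega>)" for \<omega>
      proof -
        have "?p (?\<tau> \<omega>) - ?p \<omega> = Re (J (?\<tau> \<omega>) - J \<omega>) / 2" "?q (?\<tau> \<omega>) - ?q \<omega> = Im (J (?\<tau> \<omega>) - J \<omega>) / 2"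
          by (simp_all add: field_simps)
        then show "cmod (complex_of_real (?p (?\<tau> \<omega>)) - of_real (?p \<omega>)) \<le> cmod (J (?\<tau> \<omega>) - J \<omega>)"
          "cmod (complex_of_real (?q (?\<tau> \<omega>)) - of_real (?q \<omega>)) \<le> cmod (J (?\<tau> \<omega>) - J \<omega>)"
          using abs_Re_le_cmod[of "J (?\<tau> \<omega>) - J \<omega>"] abs_Im_le_cmod[of "J (?\<tau> \<omega>) - J \<omega>"]
          unfolding of_real_diff[symmetric] norm_of_real by linarith+
      qed
      have z: "nrm L' (\<lambda>\<omega>. J (?\<tau> \<omega>) - J \<omega>) = 0" using J_inv[OF that] by (simp add: aeq_def)
      have "nrm L' (\<lambda>\<omega>. complex_of_real (?p (?\<tau> \<omega>)) - of_real (?p \<omega>)) \<le> 0"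
        "nrm L' (\<lambda>\<omega>. complex_of_real (?q (?\<tau> \<omega>)) - of_real (?q \<omega>)) \<le> 0"
        unfolding z[symmetric] by (intro L'.nrm_mono L1.bfun_adm d pd le)+
      then show "aeq L' (\<lambda>\<omega>. of_real (?p (?\<tau> \<omega>))) (\<lambda>\<omega>. of_real (?p \<omega>))"
        "aeq L' (\<lambda>\<omega>. of_real (?q (?\<tau> \<omega>))) (\<lambda>\<omega>. of_real (?q \<omega>))"
        using L'.nrm_nonneg[OF L1.bfun_adm[OF pd(1)]] L'.nrm_nonneg[OF L1.bfun_adm[OF pd(2)]]
        unfolding aeq_def by linarith+
    qed
    have adm_pq: "(\<lambda>\<omega>. complex_of_real (?p \<omega>)) \<in> adm M" "(\<lambda>\<omega>. complex_of_real (?q \<omega>)) \<in> adm M"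
      by (intro L1.bfun_adm pq)+
    \<comment> \<open>Real and imaginary part are made constant one after the other; a maximizer
      chosen for the second still maximises the first.\<close>
    define K2 where "K2 = maximizers K1 (\<lambda>\<omega>. complex_of_real (?p \<omega>))"
    have face2: "face M ?T ?R K2" unfolding K2_def by (rule face_maximizers[OF erg face1 adm_pq(1)])
    have face3: "face M ?T ?R (maximizers K2 (\<lambda>\<omega>. complex_of_real (?q \<omega>)))"
      by (rule face_maximizers[OF erg face2 adm_pq(2)])
    then obtain L3 where L3: "L3 \<in> maximizers K2 (\<lambda>\<omega>. complex_of_real (?q \<omega>))" by (auto simp: face_def)
    then have L3K2: "L3 \<in> K2" by (simp add: maximizers_def)
    then have L3K1: "L3 \<in> K1" by (simp add: K2_def maximizers_def)
    with K1_K0 have L3K0: "L3 \<in> K0" by blast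
    interpret L3: state M L3 ?T ?R using face_state[OF face0 L3K0] .
    obtain a where a: "aeq L3 (\<lambda>\<omega>. of_real (?p \<omega>)) (\<lambda>\<omega>. of_real a)"
      using maximizers_const[OF erg face1 L3K2[unfolded K2_def] pq(1) bounds(1,2) pq_inv(1)[OF L3K0]] by blast
    obtain c where c: "aeq L3 (\<lambda>\<omega>. of_real (?q \<omega>)) (\<lambda>\<omega>. of_real c)"
      using maximizers_const[OF erg face2 L3 pq(2) bounds(3,4) pq_inv(2)[OF L3K0]] by blast
    define t where "t = Complex (2 * a - 1) (2 * c - 1)"
    have cst: "(\<lambda>\<omega>. z) \<in> adm M" for z :: complex by (intro L1.bfun_adm bfun_const)
    have aeq_Jt: "aeq L3 J (\<lambda>\<omega>. t)"
    proof -
      have "nrm L3 (\<lambda>\<omega>. 2 * (of_real (?p \<omega>) - of_real a)) = 0" "nrm L3 (\<lambda>\<omega>. 2 * (of_real (?q \<omega>) - of_real c)) = 0"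
        using a c L3.nrm_bfun_mult_0[OF bfun_diff[OF pq(1) bfun_const] _ cst[of 2]]
          L3.nrm_bfun_mult_0[OF bfun_diff[OF pq(2) bfun_const] _ cst[of 2]]
        by (simp_all only: aeq_def mult.commute)
      moreover have "nrm L3 (\<lambda>\<omega>. J \<omega> - t) \<le>
          nrm L3 (\<lambda>\<omega>. 2 * (of_real (?p \<omega>) - of_real a)) + nrm L3 (\<lambda>\<omega>. 2 * (of_real (?q \<omega>) - of_real c))"
      proof (rule L3.nrm_triangle)
        fix x b
        have "2 * (of_real (?p (x, b)) - of_real a) = complex_of_real (Re (J (x, b) - t))"
          "2 * (of_real (?q (x, b)) - of_real c) = complex_of_real (Im (J (x, b) - t))"
          by (simp_all add: t_def)
        then show "cmod (J (x, b) - t) \<le> cmod (2 * (of_real (?p (x, b)) - of_real a)) + cmod (2 * (of_real (?q (x, b)) - of_real c))"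
          using cmod_le[of "J (x, b) - t"] by (simp only: norm_of_real)
      qed (intro adm_diff adm_scale adm_pq cst L3.um_adm J)+
      ultimately show ?thesis
        using L3.nrm_nonneg[OF adm_diff[OF L3.um_adm[OF J] cst[of t]]] by (simp add: aeq_def)
    qed
    \<comment> \<open>The distance from a point of the unit circle to t is at least the distance of
      \<open>cmod t\<close> from 1, and its mean under \<open>L3\<close> is 0.\<close>
    have t1: "cmod t = 1"
    proof -
      have "nrm L3 (\<lambda>\<omega>. of_real (cmod t - 1)) \<le> nrm L3 (\<lambda>\<omega>. J \<omega> - t)"
      proof (rule L3.nrm_mono[OF cst adm_diff[OF L3.um_adm[OF J] cst]])
        fix x b
        show "cmod (of_real (cmod t - 1)) \<le> cmod (J (x, b) - t)"
          using norm_triangle_ineq3[of "J (x, b)" t] um_cmod[OF J, of "(x, b)"] unfolding norm_of_real by linarith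
      qed
      moreover have "nrm L3 (\<lambda>\<omega>. of_real (cmod t - 1)) = \<bar>cmod t - 1\<bar>"
        unfolding nrm_def L3.L_const norm_of_real by simp
      ultimately show ?thesis using aeq_Jt by (simp add: aeq_def)
    qed
    have tu: "(\<lambda>\<omega>. t) \<in> um M" using t1 by (simp add: um_def)
    have vr_eq: "aeq L3 (\<lambda>\<omega>. v \<omega> ^ r) (\<lambda>\<omega>. t * \<theta> (fst \<omega>))"
    proof -
      have "aeq L3 (\<lambda>\<omega>. J \<omega> * \<theta> (fst \<omega>)) (\<lambda>\<omega>. t * \<theta> (fst \<omega>))"
        by (intro L3.aeq_um_mult aeq_Jt L3.aeq_refl J tu \<theta>u)
      moreover have "J \<omega> * \<theta> (fst \<omega>) = v \<omega> ^ r" for \<omega>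
        using mult_cnj_unimodular[OF qeig_cmod[OF \<theta>, of "fst \<omega>"]] by (simp add: J_def mult.assoc mult.commute)
      ultimately show ?thesis by simp
    qed
    have "L3 (\<lambda>\<omega>. f (fst \<omega>) * u \<omega>) = 0"
    proof -
      let ?w = "(mder (?\<tau> ^^ r) ^^ Suc j) u"
      have wu: "?w \<in> um M" by (rule um_mder_funpow_iter[OF mpsT u])
      \<comment> \<open>Up to class d the derivative of order j + 1 along the r-th power is
        \<open>(v ^ r) ^ (r ^ j)\<close>, and \<open>v ^ r\<close> has just been identified with
        \<open>t * \<theta>\<close>. So it comes from class d + 1 of the base, and the induction
        hypothesis applies with the power \<open>m * r\<close>.\<close>
      have "sim M U d L3 ((mder (?\<tau> ^^ r) ^^ Suc j) ((mder ?\<tau> ^^ 0) u)) (\<lambda>\<omega>. v \<omega> ^ (r ^ Suc j))"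
        by (rule L3.sim_mder_funpow[OF U refl u _ sim[OF L3K0]]) (simp add: v_def)
      then obtain \<eta> where \<eta>: "qeig M U d \<eta>" and w1: "aeq L3 ?w (\<lambda>\<omega>. v \<omega> ^ (r ^ Suc j) * \<eta> (fst \<omega>))"
        by (auto simp: sim_def simp del: funpow.simps(2))
      define \<zeta> where "\<zeta> = (\<lambda>x. (t * \<theta> x) ^ (r ^ j) * \<eta> x)"
      have \<zeta>: "qeig M U (Suc d) \<zeta>"
        unfolding \<zeta>_def by (intro qeig_mult qeig_power qeig_const[OF U t1] \<theta> qeig_Suc[OF U] \<eta>)
      have "aeq L3 (\<lambda>\<omega>. (v \<omega> ^ r) ^ (r ^ j) * \<eta> (fst \<omega>)) (\<lambda>\<omega>. (t * \<theta> (fst \<omega>)) ^ (r ^ j) * \<eta> (fst \<omega>))"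
        by (intro L3.aeq_um_mult L3.aeq_um_power vr_eq L3.aeq_refl um_power um_mult v tu \<theta>u um_qeig[OF \<eta>])
      then have w2: "aeq L3 (\<lambda>\<omega>. v \<omega> ^ (r ^ Suc j) * \<eta> (fst \<omega>)) (\<lambda>\<omega>. \<zeta> (fst \<omega>))"
        by (simp add: \<zeta>_def power_mult)
      have "aeq L3 ?w (\<lambda>\<omega>. \<zeta> (fst \<omega>))"
        by (rule L3.aeq_trans[OF w1 w2])
           (intro L3.um_adm wu um_mult um_power v um_qeig[OF \<eta>] um_qeig[OF \<zeta>])+
      moreover have "?\<tau> ^^ r = map_prod (U ^^ (m * r)) (V ^^ (m * r))"
        by (simp only: map_prod_funpow funpow_mult)
      moreover have "state M L3 (U ^^ (m * r)) (V ^^ (m * r))"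
        using L3.state_funpow[of r] by (simp only: funpow_mult)
      moreover have "m * r \<ge> 1" using Suc(3) r by simp
      ultimately show ?thesis
        using Suc(2) \<zeta> unfolding d by (intro Suc(1)[of "m * r" L3 \<zeta>]) auto
    qed
    then show False using K1_nz[OF L3K1] by (simp add: F_def)
  qed
qed

section \<open>Polynomial phases\<close>

definition ee :: "real \<Rightarrow> complex" where
  "ee t = cis (2 * pi * t)"

lemma norm_ee [simp]: "cmod (ee t) = 1"
  by (simp add: ee_def)

lemma ee_add: "ee (s + t) = ee s * ee t"
  by (simp add: ee_def cis_mult distrib_left)

lemma ee_cnj: "cnj (ee t) = ee (- t)"
  by (simp add: ee_def cis_cnj)

lemma ee_0 [simp]: "ee 0 = 1"
  by (simp add: ee_def)

lemma ee_of_int [simp]: "ee (of_int n) = 1"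
  by (simp add: ee_def)

lemma continuous_on_ee [continuous_intros]: "continuous_on A f \<Longrightarrow> continuous_on A (\<lambda>x. ee (f x))"
  unfolding ee_def by (intro continuous_intros)

lemma ee_surj:
  assumes "cmod z = 1"
  obtains t where "ee t = z"
proof -
  have "z \<noteq> 0" using assms by auto
  then have "z = cis (Arg z)" using assms cis_Arg[of z] by (simp add: sgn_div_norm)
  then have "ee (Arg z / (2 * pi)) = z" by (simp add: ee_def)
  then show thesis by (rule that)
qed

lemma ee_eq_iff: "ee s = ee t \<longleftrightarrow> s - t \<in> \<int>"
proof
  assume "ee s = ee t"
  then have "sin (2 * pi * s) = sin (2 * pi * t) \<and> cos (2 * pi * s) = cos (2 * pi * t)"
    by (simp add: ee_def complex_eq_iff)
  then obtain n :: int where "2 * pi * s = 2 * pi * t + 2 * pi * n" unfolding sin_cos_eq_iff by blast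
  then have "2 * pi * s = 2 * pi * (t + n)" by (simp add: distrib_left)
  then have "s = t + n" by simp
  then show "s - t \<in> \<int>" by simp
next
  assume "s - t \<in> \<int>"
  then obtain n where "s - t = of_int n" by (rule Ints_cases)
  then have "s = of_int n + t" by simp
  then show "ee s = ee t" by (simp add: ee_add)
qed

lemma torus_cont_ee: "torus_cont ee"
  by (auto simp: torus_cont_def ee_eq_iff intro!: continuous_intros)

text \<open>After n translations the value at 0 is the value of P at n. In the skew product the
  single function e(P(0)) thus displays all weights e(P(n)) along an orbit.\<close>

definition pshift :: "real poly \<Rightarrow> real poly" where
  "pshift P = pcompose P [:1, 1:]"

definition pdiff :: "real poly \<Rightarrow> real poly" where
  "pdiff P = pshift P - P"

lemma poly_pshift: "poly (pshift P) t = poly P (t + 1)"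
  by (simp add: pshift_def poly_pcompose add.commute)

lemma poly_pdiff: "poly (pdiff P) t = poly (pshift P) t - poly P t"
  by (simp add: pdiff_def)

lemma poly_pshift_funpow: "poly ((pshift ^^ n) P) t = poly P (t + real n)"
  by (induction n arbitrary: t) (simp_all add: poly_pshift algebra_simps)

lemma pdiff_pshift: "(pdiff ^^ i) (pshift P) = pshift ((pdiff ^^ i) P)"
proof (induction i)
  case (Suc i)
  then show ?case by (simp add: pdiff_def pshift_def pcompose_diff)
qed simp

lemma degree_pshift_le: "degree (pshift p) \<le> degree p"
  using degree_pcompose_le[of p "[:1, 1:]"] by (simp add: pshift_def)

text \<open>The second conjunct covers constants, whose difference is 0: with truncated subtraction
  the degree bound alone would not express this.\<close>

lemma degree_pdiff:
  "degree P \<le> n \<Longrightarrow> degree (pdiff P) \<le> n - 1 \<and> (n = 0 \<longrightarrow> pdiff P = 0)"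
proof (induction P arbitrary: n)
  case 0
  then show ?case by (simp add: pdiff_def pshift_def)
next
  case (pCons a p)
  have eq: "pdiff (pCons a p) = pCons 0 (pdiff p) + pshift p"
    by (simp add: pdiff_def pshift_def pcompose_pCons)
  show ?case
  proof (cases "p = 0")
    case True
    then show ?thesis by (simp add: pdiff_def pshift_def)
  next
    case False
    then have n: "Suc (degree p) \<le> n" using pCons by simp
    have IH: "degree (pdiff p) \<le> degree p - 1 \<and> (degree p = 0 \<longrightarrow> pdiff p = 0)"
      using pCons(2)[of "degree p"] by simp
    have "degree (pCons 0 (pdiff p)) \<le> degree p"
      using IH by (cases "degree p") (auto simp: degree_pCons_eq_if)
    moreover note degree_pshift_le[of p]
    ultimately have "degree (pdiff (pCons a p)) \<le> degree p"
      unfolding eq by (rule degree_add_le)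
    then show ?thesis using n by auto
  qed
qed

lemma pdiff_funpow_degree: "degree P \<le> k \<Longrightarrow> (pdiff ^^ Suc k) P = 0"
proof (induction k arbitrary: P)
  case 0
  then show ?case using degree_pdiff[of P 0] by simp
next
  case (Suc k)
  have "degree (pdiff P) \<le> k" using degree_pdiff[OF Suc(2)] by simp
  then have "(pdiff ^^ Suc k) (pdiff P) = 0" by (rule Suc(1))
  then show ?case by (simp only: funpow_Suc_right comp_apply)
qed

text \<open>Derivatives of the phase are phases of finite differences, so on polynomials of degree
  at most k the one of order k + 1 is 1.\<close>

lemma mder_iter_phase:
  "(mder (map_prod T pshift) ^^ i) (\<lambda>\<omega>. ee (poly (snd \<omega>) 0)) = (\<lambda>\<omega>. ee (poly ((pdiff ^^ i) (snd \<omega>)) 0))"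
proof (induction i)
  case (Suc i)
  show ?case
    by (simp only: funpow.simps comp_apply Suc)
       (simp add: mder_def pdiff_pshift ee_cnj poly_pdiff flip: ee_add)
qed simp

text \<open>A polynomial is viewed as its sequence of values at the naturals, a point of a separable
  metric space; the averages depend on these values alone. The countable family makes the supremum
  measurable and permits a measurable choice of polynomials.\<close>

lemma dense_polys:
  obtains p :: "nat \<Rightarrow> real poly" where "\<And>i. degree (p i) \<le> k"
    "\<And>P. degree P \<le> k \<Longrightarrow> \<exists>s. \<forall>n. (\<lambda>j. poly (p (s j)) (real n)) \<longlonglongrightarrow> poly P (real n)"
proof -
  let ?S = "(\<lambda>P n. poly P (real n)) ` {P. degree P \<le> k}"
  obtain A where A: "countable A" "A \<subseteq> ?S" "?S \<subseteq> closure A" by (rule separable)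
  have "0 \<in> {P::real poly. degree P \<le> k}" by simp
  then have "?S \<noteq> {}" by blast
  then have "A \<noteq> {}" using A(3) by auto
  have "\<exists>P. degree P \<le> k \<and> (\<lambda>n. poly P (real n)) = from_nat_into A i" for i
  proof -
    have "from_nat_into A i \<in> ?S" using from_nat_into[OF \<open>A \<noteq> {}\<close>, of i] A(2) by (rule subsetD[rotated])
    then show ?thesis by (elim imageE) (metis mem_Collect_eq)
  qed
  then obtain p where p: "\<And>i. degree (p i) \<le> k" "\<And>i. (\<lambda>n. poly (p i) (real n)) = from_nat_into A i"
    by metis
  show thesis
  proof (rule that[of p])
    fix P :: "real poly" assume "degree P \<le> k"
    then have "(\<lambda>n. poly P (real n)) \<in> closure A" using A(3) by auto
    then obtain a where a: "\<And>j. a j \<in> A" "a \<longlonglongrightarrow> (\<lambda>n. poly P (real n))"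
      unfolding closure_sequential by blast
    have "\<exists>i. from_nat_into A i = a j" for j
      using from_nat_into_surj[OF A(1) a(1)] by blast
    then obtain s where s: "\<And>j. from_nat_into A (s j) = a j" by metis
    have "(\<lambda>j. a j n) \<longlonglongrightarrow> poly P (real n)" for n
      by (rule continuous_on_tendsto_compose[OF continuous_on_product_coordinates a(2)]) auto
    then show "\<exists>s. \<forall>n. (\<lambda>j. poly (p (s j)) (real n)) \<longlonglongrightarrow> poly P (real n)"
      by (intro exI[of _ s]) (metis (no_types, lifting) p(2) s ext)
  qed (rule p(1))
qed

section \<open>Suprema of averages over polynomial phases\<close>

definition wsup :: "('a \<Rightarrow> 'a) \<Rightarrow> ('a \<Rightarrow> complex) \<Rightarrow> nat \<Rightarrow> nat \<Rightarrow> 'a \<Rightarrow> real" where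
  "wsup T f k N x = (SUP P\<in>{P. degree P \<le> k}. cmod (wavg T f ee P x N))"

lemma cmod_wavg_le:
  assumes "\<And>t. cmod (\<phi> t) \<le> B"
  shows "cmod (wavg T f \<phi> P x N) \<le> B * ((\<Sum>n=1..N. cmod (f ((T ^^ n) x))) / real N)"
proof -
  have "cmod (\<Sum>n=1..N. \<phi> (poly P (real n)) * f ((T ^^ n) x)) \<le> (\<Sum>n=1..N. B * cmod (f ((T ^^ n) x)))"
    by (rule sum_norm_le) (use assms in \<open>auto simp: norm_mult intro!: mult_right_mono\<close>)
  then show ?thesis
    by (simp add: wavg_def norm_divide divide_right_mono flip: sum_distrib_left)
qed

lemma cmod_wavg_ee_le: "cmod (wavg T f ee P x N) \<le> (\<Sum>n=1..N. cmod (f ((T ^^ n) x))) / real N"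
  using cmod_wavg_le[of ee 1] by simp

lemma bdd_above_wavg: "bdd_above ((\<lambda>P. cmod (wavg T f ee P x N)) ` A)"
  by (rule bdd_aboveI2[OF cmod_wavg_ee_le])

lemma wavg_le_wsup: "degree P \<le> k \<Longrightarrow> cmod (wavg T f ee P x N) \<le> wsup T f k N x"
  unfolding wsup_def by (rule cSUP_upper[OF _ bdd_above_wavg]) simp

lemma wsup_le_I:
  assumes "\<And>P. degree P \<le> k \<Longrightarrow> cmod (wavg T f ee P x N) \<le> B"
  shows "wsup T f k N x \<le> B"
  unfolding wsup_def
proof (rule cSUP_least)
  have "0 \<in> {P::real poly. degree P \<le> k}" by simp
  then show "{P::real poly. degree P \<le> k} \<noteq> {}" by blast
qed (use assms in auto)

lemma wsup_nonneg: "0 \<le> wsup T f k N x"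
  by (rule order_trans[OF norm_ge_zero wavg_le_wsup[of 0]]) simp

lemma wsup_le: "wsup T f k N x \<le> (\<Sum>n=1..N. cmod (f ((T ^^ n) x))) / real N"
  by (rule wsup_le_I) (rule cmod_wavg_ee_le)

lemma wavg_tendsto:
  assumes "\<And>n. (\<lambda>j. poly (q j) (real n)) \<longlonglongrightarrow> poly P (real n)"
  shows "(\<lambda>j. wavg T f ee (q j) x N) \<longlonglongrightarrow> wavg T f ee P x N"
proof -
  have "(\<lambda>j. ee (poly (q j) (real n))) \<longlonglongrightarrow> ee (poly P (real n))" for n
    unfolding ee_def by (intro tendsto_intros assms)
  then show ?thesis unfolding wavg_def divide_inverse by (intro tendsto_intros)
qed

lemma wavg_add_const: "wavg T f ee (P + [:a:]) x N = ee a * wavg T f ee P x N"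
  by (simp add: wavg_def ee_add sum_distrib_left mult_ac)

text \<open>The constant term of P is free and can rotate the average onto the positive real axis.
  Real parts are wanted because the averages are integrated over x later; the factor 1/2 leaves room
  for the passage to the countable family.\<close>

lemma half_wsup_attained:
  assumes p: "\<And>i. degree (p i) \<le> k"
    and dense: "\<And>P. degree P \<le> k \<Longrightarrow> \<exists>s. \<forall>n. (\<lambda>j. poly (p (s j)) (real n)) \<longlonglongrightarrow> poly P (real n)"
  shows "\<exists>i::nat. wsup T f k N x / 2 \<le> Re (wavg T f ee (p i) x N)"
proof (cases "wsup T f k N x = 0")
  case True
  then have "wavg T f ee (p 0) x N = 0" using wavg_le_wsup[OF p[of 0], of T f x N] by simp
  then show ?thesis using True by (intro exI[of _ 0]) simp
next
  case False
  then have pos: "wsup T f k N x > 0" using wsup_nonneg[of T f k N x] by simp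
  have "\<exists>P. degree P \<le> k \<and> wsup T f k N x / 2 < cmod (wavg T f ee P x N)"
  proof (rule ccontr)
    assume "\<not> ?thesis"
    then have "wsup T f k N x \<le> wsup T f k N x / 2" by (intro wsup_le_I) (auto simp: not_less)
    then show False using pos by simp
  qed
  then obtain P where P: "degree P \<le> k" "wsup T f k N x / 2 < cmod (wavg T f ee P x N)" by blast
  let ?w = "wavg T f ee P x N"
  have w0: "?w \<noteq> 0" using P(2) pos by auto
  then have "cmod (cnj (sgn ?w)) = 1" by (simp add: norm_sgn)
  then obtain a where a: "ee a = cnj (sgn ?w)" by (rule ee_surj)
  have "ee a * ?w = of_real (cmod ?w)"
  proof -
    have "?w * cnj ?w = of_real (cmod ?w) * of_real (cmod ?w)"
      using complex_norm_square[of ?w] by (simp add: power2_eq_square)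
    then show ?thesis using w0 unfolding a by (simp add: sgn_eq mult.commute)
  qed
  then have "Re (wavg T f ee (P + [:a:]) x N) = cmod ?w" unfolding wavg_add_const by simp
  moreover have "degree (P + [:a:]) \<le> k" using P(1) by (intro degree_add_le) auto
  then obtain s where "\<And>n. (\<lambda>j. poly (p (s j)) (real n)) \<longlonglongrightarrow> poly (P + [:a:]) (real n)"
    using dense by blast
  then have "(\<lambda>j. Re (wavg T f ee (p (s j)) x N)) \<longlonglongrightarrow> Re (wavg T f ee (P + [:a:]) x N)"
    by (intro tendsto_Re wavg_tendsto)
  ultimately have "\<forall>\<^sub>F j in sequentially. wsup T f k N x / 2 < Re (wavg T f ee (p (s j)) x N)"
    using P(2) by (intro order_tendstoD(1)) auto
  then obtain j where "wsup T f k N x / 2 < Re (wavg T f ee (p (s j)) x N)"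
    using eventually_happens'[OF sequentially_bot] by blast
  then show ?thesis by (intro exI[of _ "s j"]) simp
qed

lemma wsup_eq_countable:
  assumes p: "\<And>i. degree (p i) \<le> k"
    and dense: "\<And>P. degree P \<le> k \<Longrightarrow> \<exists>s. \<forall>n. (\<lambda>j. poly (p (s j)) (real n)) \<longlonglongrightarrow> poly P (real n)"
  shows "wsup T f k N x = (SUP i::nat. cmod (wavg T f ee (p i) x N))"
proof (rule antisym)
  show "wsup T f k N x \<le> (SUP i. cmod (wavg T f ee (p i) x N))"
  proof (rule wsup_le_I)
    fix P :: "real poly" assume "degree P \<le> k"
    then obtain s where "\<And>n. (\<lambda>j. poly (p (s j)) (real n)) \<longlonglongrightarrow> poly P (real n)" using dense by blast
    then have "(\<lambda>j. cmod (wavg T f ee (p (s j)) x N)) \<longlonglongrightarrow> cmod (wavg T f ee P x N)"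
      by (intro tendsto_norm wavg_tendsto)
    moreover have "cmod (wavg T f ee (p (s j)) x N) \<le> (SUP i. cmod (wavg T f ee (p i) x N))" for j
      using bdd_aboveI2[of UNIV "\<lambda>i. cmod (wavg T f ee (p i) x N)", OF cmod_wavg_ee_le] by (rule cSUP_upper[OF UNIV_I])
    ultimately show "cmod (wavg T f ee P x N) \<le> (SUP i. cmod (wavg T f ee (p i) x N))"
      by (intro LIMSEQ_le_const2) auto
  qed
  show "(SUP i. cmod (wavg T f ee (p i) x N)) \<le> wsup T f k N x"
    by (rule cSUP_least) (auto intro: wavg_le_wsup p)
qed

lemma wavg_measurable:
  assumes "mps M T" "f \<in> borel_measurable M"
  shows "(\<lambda>x. wavg T f \<phi> P x N) \<in> borel_measurable M"
  unfolding wavg_def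
  using measurable_compose[OF mps_meas[OF mps_funpow[OF assms(1)]] assms(2)] by measurable

lemma integrable_birkhoff_avg:
  fixes h :: "'a \<Rightarrow> real"
  assumes "mps M T" "integrable M h"
  shows "integrable M (\<lambda>x. (\<Sum>n=1..N. h ((T ^^ n) x)) / real N)"
  using mps_integrable[OF mps_funpow[OF assms(1)] assms(2)]
  by (intro integrable_divide_zero Bochner_Integration.integrable_sum) auto

lemma integrable_wsup:
  assumes T: "mps M T" and f: "integrable M f"
  shows "integrable M (wsup T f k N)"
proof (rule Bochner_Integration.integrable_bound)
  obtain p :: "nat \<Rightarrow> real poly" where p: "\<And>i. degree (p i) \<le> k"
    "\<And>P. degree P \<le> k \<Longrightarrow> \<exists>s. \<forall>n. (\<lambda>j. poly (p (s j)) (real n)) \<longlonglongrightarrow> poly P (real n)"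
    using dense_polys[of k] by metis
  have [measurable]: "(\<lambda>x. wavg T f ee (p i) x N) \<in> borel_measurable M" for i
    using f by (intro wavg_measurable T) auto
  have "(\<lambda>x. SUP i. cmod (wavg T f ee (p i) x N)) \<in> borel_measurable M"
    by (rule borel_measurable_cSUP) (auto intro!: bdd_aboveI2 cmod_wavg_ee_le)
  then show "wsup T f k N \<in> borel_measurable M"
    using wsup_eq_countable[OF p, of T f N] by (simp add: fun_eq_iff[symmetric] cong: measurable_cong)
  show "integrable M (\<lambda>x. (\<Sum>n=1..N. cmod (f ((T ^^ n) x))) / real N)"
    by (rule integrable_birkhoff_avg[OF T integrable_norm[OF f]])
  show "AE x in M. norm (wsup T f k N x) \<le> norm ((\<Sum>n=1..N. cmod (f ((T ^^ n) x))) / real N)"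
    by (intro AE_I2)
       (metis wsup_le[of T f k N] wsup_nonneg[of T f k N] real_norm_def abs_of_nonneg abs_ge_self order_trans)
qed

section \<open>Convergence in mean\<close>

text \<open>Empirical states along orbits carrying an almost optimal choice of polynomials.\<close>

definition estate :: "'a measure \<Rightarrow> ('a \<Rightarrow> 'a) \<Rightarrow> ('a \<Rightarrow> real poly) \<Rightarrow> nat \<Rightarrow> ('a \<times> real poly \<Rightarrow> complex) \<Rightarrow> complex"
  where "estate M T \<pi> N F = (if F \<in> adm M
    then \<integral>x. (\<Sum>n=1..N. F ((T ^^ n) x, (pshift ^^ n) (\<pi> x))) / of_nat N \<partial>M else 0)"

context
  fixes M :: "'a measure" and T :: "'a \<Rightarrow> 'a" and p :: "nat \<Rightarrow> real poly" and \<iota> :: "'a \<Rightarrow> nat" and N :: nat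
  assumes T: "mps M T" and \<iota>: "\<iota> \<in> measurable M (count_space UNIV)" and N: "N \<ge> 1"
begin

text \<open>An admissible F is measurable for each fixed polynomial only. As the polynomial is
  chosen through the countably valued index \<iota>, measurability is glued together from the level
  sets of \<iota>.\<close>

lemma estate_term:
  assumes F: "F \<in> adm M"
  shows "integrable M (\<lambda>x. F ((T ^^ n) x, (pshift ^^ n) (p (\<iota> x))))"
proof -
  obtain D where D: "integrable M D" "\<And>x b. x \<in> space M \<Longrightarrow> cmod (F (x, b)) \<le> D x" using admE[OF F] by metis
  have Tn: "mps M (T ^^ n)" by (rule mps_funpow[OF T])
  show ?thesis
  proof (rule Bochner_Integration.integrable_bound)
    show "integrable M (\<lambda>x. D ((T ^^ n) x))" by (rule mps_integrable[OF Tn D(1)])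
    show "(\<lambda>x. F ((T ^^ n) x, (pshift ^^ n) (p (\<iota> x)))) \<in> borel_measurable M"
    proof (rule measurable_compose_countable[OF _ \<iota>])
      fix i
      show "(\<lambda>x. F ((T ^^ n) x, (pshift ^^ n) (p i))) \<in> borel_measurable M"
        by (rule measurable_compose[OF mps_meas[OF Tn] adm_measurable[OF F]])
    qed
    show "AE x in M. norm (F ((T ^^ n) x, (pshift ^^ n) (p (\<iota> x)))) \<le> norm (D ((T ^^ n) x))"
      using D(2) mps_space[OF Tn] by (intro AE_I2) (auto intro: order_trans[OF _ abs_ge_self])
  qed
qed

lemma estate_eq:
  assumes F: "F \<in> adm M"
  shows "estate M T (\<lambda>x. p (\<iota> x)) N F = (\<Sum>n=1..N. \<integral>x. F ((T ^^ n) x, (pshift ^^ n) (p (\<iota> x))) \<partial>M) / of_nat N"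
  using F estate_term[OF F] by (simp add: estate_def)

lemma prestate_estate: "prestate M (estate M T (\<lambda>x. p (\<iota> x)) N)"
proof -
  interpret prob_space M by (rule mps_prob[OF T])
  let ?L = "estate M T (\<lambda>x. p (\<iota> x)) N"
  show ?thesis
  proof
    show "?L F = 0" if "F \<notin> adm M" for F using that by (simp add: estate_def)
    show "?L (\<lambda>\<omega>. F \<omega> + G \<omega>) = ?L F + ?L G" if "F \<in> adm M" "G \<in> adm M" for F G
      using that estate_term by (simp add: estate_eq adm_add sum.distrib add_divide_distrib)
    show "?L (\<lambda>\<omega>. c * F \<omega>) = c * ?L F" if "F \<in> adm M" for F c
      using that by (simp add: estate_eq adm_scale flip: sum_distrib_left)
    show "?L F \<in> \<real>\<^sub>\<ge>\<^sub>0" if F: "F \<in> adm M" and pos: "\<And>x b. x \<in> space M \<Longrightarrow> F (x, b) \<in> \<real>\<^sub>\<ge>\<^sub>0" for F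
    proof -
      have "(\<integral>x. F ((T ^^ n) x, (pshift ^^ n) (p (\<iota> x))) \<partial>M) \<in> \<real>\<^sub>\<ge>\<^sub>0" for n
      proof -
        let ?h = "\<lambda>x. F ((T ^^ n) x, (pshift ^^ n) (p (\<iota> x)))"
        have h: "?h x \<in> \<real>\<^sub>\<ge>\<^sub>0" if "x \<in> space M" for x
          by (rule pos[OF mps_space[OF mps_funpow[OF T] that]])
        then have "(\<integral>x. ?h x \<partial>M) = (\<integral>x. complex_of_real (Re (?h x)) \<partial>M)"
          by (intro Bochner_Integration.integral_cong) (auto simp: complex_nonneg_Reals_iff complex_eq_iff)
        also have "\<dots> = of_real (\<integral>x. Re (?h x) \<partial>M)" by (rule integral_complex_of_real)
        finally show ?thesis
          using h by (auto simp: complex_nonneg_Reals_iff intro!: Bochner_Integration.integral_nonneg)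
      qed
      then have "(\<Sum>n=1..N. \<integral>x. F ((T ^^ n) x, (pshift ^^ n) (p (\<iota> x))) \<partial>M) \<in> \<real>\<^sub>\<ge>\<^sub>0"
        by (auto simp: complex_nonneg_Reals_iff intro!: sum_nonneg)
      then show ?thesis unfolding estate_eq[OF F] by (rule nonneg_Reals_divide_I) simp
    qed
    show "?L (\<lambda>\<omega>. g (fst \<omega>)) = (\<integral>x. g x \<partial>M)" if g: "integrable M g" for g
    proof -
      have "(\<integral>x. g ((T ^^ n) x) \<partial>M) = (\<integral>x. g x \<partial>M)" for n
        by (rule mps_integral[OF mps_funpow[OF T]]) (use g in auto)
      then show ?thesis using N by (simp add: estate_eq[OF adm_fst[OF g]])
    qed
  qed
qed

text \<open>One step of the map replaces the first term of the sum by the term after the last; the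
  others cancel.\<close>

lemma estate_almost_invariant:
  assumes F: "F \<in> adm M" and D: "integrable M D" "\<And>x b. x \<in> space M \<Longrightarrow> cmod (F (x, b)) \<le> D x"
  shows "cmod (estate M T (\<lambda>x. p (\<iota> x)) N (\<lambda>\<omega>. F (map_prod T pshift \<omega>)) - estate M T (\<lambda>x. p (\<iota> x)) N F)
      \<le> 2 * (\<integral>x. D x \<partial>M) / N"
proof -
  define I where "I = (\<lambda>n. \<integral>x. F ((T ^^ n) x, (pshift ^^ n) (p (\<iota> x))) \<partial>M)"
  have I: "cmod (I n) \<le> (\<integral>x. D x \<partial>M)" for n
  proof -
    have "cmod (I n) \<le> (\<integral>x. cmod (F ((T ^^ n) x, (pshift ^^ n) (p (\<iota> x)))) \<partial>M)"
      unfolding I_def by (rule integral_norm_bound)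
    also have "\<dots> \<le> (\<integral>x. D ((T ^^ n) x) \<partial>M)"
      by (intro integral_mono integrable_norm estate_term F mps_integrable[OF mps_funpow[OF T]] D
          mps_space[OF mps_funpow[OF T]])
    also have "\<dots> = (\<integral>x. D x \<partial>M)"
      by (rule mps_integral[OF mps_funpow[OF T]]) (use D in auto)
    finally show ?thesis .
  qed
  have "estate M T (\<lambda>x. p (\<iota> x)) N (\<lambda>\<omega>. F (map_prod T pshift \<omega>)) = (\<Sum>n=1..N. I (Suc n)) / of_nat N"
    unfolding estate_eq[OF adm_map_prod[OF T F]] I_def by simp
  moreover have "estate M T (\<lambda>x. p (\<iota> x)) N F = (\<Sum>n=1..N. I n) / of_nat N"
    unfolding estate_eq[OF F] I_def by simp
  moreover have "(\<Sum>n=1..N. I (Suc n)) - (\<Sum>n=1..N. I n) = I (Suc N) - I 1"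
    using sum_Suc_diff[of 1 N I] N by (simp add: sum_subtractf)
  ultimately have "estate M T (\<lambda>x. p (\<iota> x)) N (\<lambda>\<omega>. F (map_prod T pshift \<omega>)) - estate M T (\<lambda>x. p (\<iota> x)) N F
      = (I (Suc N) - I 1) / of_nat N"
    by (metis diff_divide_distrib)
  moreover have "cmod (I (Suc N) - I 1) \<le> 2 * (\<integral>x. D x \<partial>M)"
    using norm_triangle_ineq4[of "I (Suc N)" "I 1"] I[of "Suc N"] I[of 1] by linarith
  ultimately show ?thesis by (simp add: norm_divide divide_right_mono)
qed

end

lemma phase_um: "(\<lambda>\<omega>. ee (poly (snd \<omega>) 0)) \<in> um M"
  by (simp add: um_def)

lemma tendsto_integral_wsup:
  assumes te: "totally_ergodic M T" and f: "integrable M f"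
    and perp: "\<And>g. qeig M T (Suc k) g \<Longrightarrow> (\<integral>x. f x * g x \<partial>M) = 0"
  shows "(\<lambda>N. \<integral>x. wsup T f k N x \<partial>M) \<longlonglongrightarrow> 0"
proof (rule ccontr)
  assume not: "\<not> ?thesis"
  have T: "mps M T" using te by (simp add: totally_ergodic_def)
  interpret prob_space M by (rule mps_prob[OF T])
  let ?I = "\<lambda>N. \<integral>x. wsup T f k N x \<partial>M"
  have I0: "0 \<le> ?I N" for N by (intro Bochner_Integration.integral_nonneg wsup_nonneg)
  obtain \<delta> where \<delta>: "\<delta> > 0" and freq: "\<forall>n. \<exists>N\<ge>n. \<delta> \<le> ?I N"
    using not I0 unfolding LIMSEQ_iff by (auto simp: not_less)
  obtain p :: "nat \<Rightarrow> real poly" where p: "\<And>i. degree (p i) \<le> k"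
    "\<And>P. degree P \<le> k \<Longrightarrow> \<exists>s. \<forall>n. (\<lambda>j. poly (p (s j)) (real n)) \<longlonglongrightarrow> poly P (real n)"
    using dense_polys[of k] by metis
  have [measurable]: "(\<lambda>x. wavg T f ee (p i) x N) \<in> borel_measurable M" for i N
    using f by (intro wavg_measurable T) auto
  have [measurable]: "wsup T f k N \<in> borel_measurable M" for N
    using integrable_wsup[OF T f] by auto
  \<comment> \<open>The least suitable index is a measurable function of x.\<close>
  define \<iota> where "\<iota> = (\<lambda>N x. LEAST i. wsup T f k N x / 2 \<le> Re (wavg T f ee (p i) x N))"
  have \<iota>m: "\<iota> N \<in> measurable M (count_space UNIV)" for N
    unfolding \<iota>_def by measurable
  have \<iota>: "wsup T f k N x / 2 \<le> Re (wavg T f ee (p (\<iota> N x)) x N)" for N x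
    unfolding \<iota>_def by (rule LeastI_ex[OF half_wsup_attained[OF p]])
  define \<Lambda> where "\<Lambda> = (\<lambda>N. estate M T (\<lambda>x. p (\<iota> N x)) N)"
  let ?u = "\<lambda>\<omega>::'a \<times> real poly. ee (poly (snd \<omega>) 0)"
  let ?F = "\<lambda>\<omega>. f (fst \<omega>) * ?u \<omega>"
  have F: "?F \<in> adm M" by (intro adm_mult adm_fst f um_bfun phase_um)
  have lower: "?I N / 2 \<le> Re (\<Lambda> N ?F)" if "N \<ge> 1" for N
  proof -
    have int: "integrable M (\<lambda>x. wavg T f ee (p (\<iota> N x)) x N)"
    proof (rule Bochner_Integration.integrable_bound)
      show "integrable M (\<lambda>x. (\<Sum>n=1..N. cmod (f ((T ^^ n) x))) / real N)"
        by (rule integrable_birkhoff_avg[OF T integrable_norm[OF f]])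
      show "(\<lambda>x. wavg T f ee (p (\<iota> N x)) x N) \<in> borel_measurable M"
        by (rule measurable_compose_countable[OF _ \<iota>m]) measurable
      show "AE x in M. norm (wavg T f ee (p (\<iota> N x)) x N) \<le> norm ((\<Sum>n=1..N. cmod (f ((T ^^ n) x))) / real N)"
        by (intro AE_I2 order_trans[OF cmod_wavg_ee_le]) (simp only: real_norm_def abs_ge_self)
    qed
    have "\<Lambda> N ?F = (\<integral>x. wavg T f ee (p (\<iota> N x)) x N \<partial>M)"
      using F by (simp add: \<Lambda>_def estate_def wavg_def poly_pshift_funpow mult.commute)
    then have "Re (\<Lambda> N ?F) = (\<integral>x. Re (wavg T f ee (p (\<iota> N x)) x N) \<partial>M)"
      using integral_Re[OF int] by simp
    also have "\<dots> \<ge> (\<integral>x. wsup T f k N x / 2 \<partial>M)"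
      by (rule integral_mono) (use integrable_wsup[OF T f] int \<iota> in auto)
    finally show ?thesis by simp
  qed
  \<comment> \<open>The lower bound \<open>Suc n\<close> keeps the lengths positive and makes them
    tend to infinity.\<close>
  have "\<forall>n. \<exists>N. Suc n \<le> N \<and> \<delta> \<le> ?I N" using freq by blast
  from choice[OF this] obtain \<sigma> where \<sigma>: "\<And>n. \<sigma> n \<ge> Suc n" "\<And>n. \<delta> \<le> ?I (\<sigma> n)" by blast
  have \<sigma>1: "\<sigma> n \<ge> 1" for n using \<sigma>(1)[of n] by linarith
  have pre: "prestate M (\<Lambda> (\<sigma> n))" for n
    unfolding \<Lambda>_def by (rule prestate_estate[OF T \<iota>m \<sigma>1])
  \<comment> \<open>A product of this size need not be sequentially compact, so L is a cluster point
    of the filter and not the limit of a subsequence. Closed conditions that hold eventually are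
    handed on to it by \<open>closed_L\<close>.\<close>
  have "filtermap (\<lambda>n. \<Lambda> (\<sigma> n)) sequentially \<noteq> bot" by (simp add: filtermap_bot_iff)
  moreover have "eventually (\<lambda>L. L \<in> {L. prestate M L}) (filtermap (\<lambda>n. \<Lambda> (\<sigma> n)) sequentially)"
    using pre by (simp add: eventually_filtermap)
  ultimately obtain L where L: "prestate M L"
    and cl: "inf (nhds L) (filtermap (\<lambda>n. \<Lambda> (\<sigma> n)) sequentially) \<noteq> bot"
    using compact_prestates[of M, unfolded compact_filter] by blast
  have closed_L: "L \<in> C" if C: "closed C" and ev: "\<forall>\<^sub>F n in sequentially. \<Lambda> (\<sigma> n) \<in> C" for C
  proof (rule ccontr)
    assume "L \<notin> C"
    then have "eventually (\<lambda>L. L \<in> - C) (nhds L)"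
      using C by (intro eventually_nhds_in_open) auto
    moreover have "eventually (\<lambda>L. L \<in> C) (filtermap (\<lambda>n. \<Lambda> (\<sigma> n)) sequentially)"
      using ev by (simp add: eventually_filtermap)
    ultimately have "eventually (\<lambda>L. False) (inf (nhds L) (filtermap (\<lambda>n. \<Lambda> (\<sigma> n)) sequentially))"
      unfolding eventually_inf by fastforce
    then show False using cl by (simp add: eventually_False)
  qed
  interpret prestate M L by (rule L)
  have inv: "L (\<lambda>\<omega>. F (map_prod T pshift \<omega>)) = L F" if F: "F \<in> adm M" for F
  proof -
    obtain D where D: "integrable M D" "\<And>x b. x \<in> space M \<Longrightarrow> cmod (F (x, b)) \<le> D x" using admE[OF F] by metis
    have "cmod (L (\<lambda>\<omega>. F (map_prod T pshift \<omega>)) - L F) \<le> \<epsilon>" if "\<epsilon> > 0" for \<epsilon>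
    proof -
      let ?C = "{L. cmod (L (\<lambda>\<omega>. F (map_prod T pshift \<omega>)) - L F) \<le> \<epsilon>}"
      have "closed ?C"
        by (intro closed_Collect_le continuous_intros continuous_on_product_coordinates)
      moreover have "(\<lambda>n. 2 * (\<integral>x. D x \<partial>M) / real n) \<longlonglongrightarrow> 0" by (rule lim_const_over_n)
      then have "\<forall>\<^sub>F n in sequentially. 2 * (\<integral>x. D x \<partial>M) / real n < \<epsilon>" using that by (rule order_tendstoD(2))
      then obtain n0 where n0: "\<And>n. n \<ge> n0 \<Longrightarrow> 2 * (\<integral>x. D x \<partial>M) / real n < \<epsilon>"
        unfolding eventually_sequentially by blast
      have "\<forall>\<^sub>F n in sequentially. \<Lambda> (\<sigma> n) \<in> ?C"
        using eventually_ge_at_top[of n0]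
      proof eventually_elim
        case (elim n)
        have "\<sigma> n \<ge> n0" using \<sigma>(1)[of n] elim by linarith
        then show ?case
          using estate_almost_invariant[OF T \<iota>m \<sigma>1 F D, of p "\<sigma> n" n] n0[of "\<sigma> n"] by (simp add: \<Lambda>_def)
      qed
      ultimately have "L \<in> ?C" by (rule closed_L)
      then show ?thesis by simp
    qed
    then have "cmod (L (\<lambda>\<omega>. F (map_prod T pshift \<omega>)) - L F) \<le> 0" by (rule field_le_epsilon[of _ 0, simplified])
    then show ?thesis by simp
  qed
  have "state M L T pshift" by unfold_locales (use T inv in auto)
  moreover have "L ?F = 0"
  proof (rule state_annihilates[OF te phase_um f perp order_refl, where m=1 and V=pshift and L=L and \<xi>="\<lambda>_. 1"])
    show "state M L (T ^^ 1) (pshift ^^ 1)" using \<open>state M L T pshift\<close> by simp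
    let ?w = "(mder (map_prod (T ^^ 1) (pshift ^^ 1)) ^^ Suc k) ?u"
    have "T ^^ 1 = T" "pshift ^^ 1 = pshift" by simp_all
    then have w: "?w = (\<lambda>\<omega>. ee (poly ((pdiff ^^ Suc k) (snd \<omega>)) 0))" by (simp only: mder_iter_phase)
    have wd: "(\<lambda>\<omega>. complex_of_real (cmod (?w \<omega> - 1))) \<in> adm M"
      by (intro adm_cmod adm_diff bfun_adm bfun_const um_bfun) (unfold w, simp add: um_def)
    have "closed {L. nrm L (\<lambda>\<omega>. ?w \<omega> - 1) = 0}"
      unfolding nrm_def by (intro closed_Collect_eq continuous_intros continuous_on_product_coordinates)
    \<comment> \<open>The function \<open>?w\<close> is 1 at polynomials of degree at most k, the
      ones visited by the empirical states, so the equation survives in L up to a null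
      function.\<close>
    moreover have "nrm (\<Lambda> (\<sigma> n)) (\<lambda>\<omega>. ?w \<omega> - 1) = 0" for n
    proof -
      have deg: "degree ((pshift ^^ i) (p j)) \<le> k" for i j
        using p(1)[of j]
      proof (induction i)
        case (Suc i)
        then show ?case
          using degree_pshift_le[of "(pshift ^^ i) (p j)"] by simp
      qed simp
      have "?w (x, (pshift ^^ i) (p j)) = 1" for x i j
        unfolding w snd_conv pdiff_funpow_degree[OF deg] by simp
      then have "\<Lambda> (\<sigma> n) (\<lambda>\<omega>. complex_of_real (cmod (?w \<omega> - 1))) = 0"
        unfolding \<Lambda>_def estate_def using wd by (simp del: funpow.simps)
      then show ?thesis by (simp add: nrm_def del: funpow.simps)
    qed
    ultimately have "nrm L (\<lambda>\<omega>. ?w \<omega> - 1) = 0"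
      using closed_L[of "{L. nrm L (\<lambda>\<omega>. ?w \<omega> - 1) = 0}"] by simp
    then show "aeq L ?w (\<lambda>\<omega>. 1)" by (simp only: aeq_def)
  qed (simp_all add: qeig_one)
  moreover have "\<delta> / 2 \<le> Re (L ?F)"
  proof -
    have "closed {L :: ('a \<times> real poly \<Rightarrow> complex) \<Rightarrow> complex. \<delta> / 2 \<le> Re (L ?F)}"
      by (intro closed_Collect_le continuous_intros continuous_on_product_coordinates)
    moreover have "\<forall>\<^sub>F n in sequentially. \<Lambda> (\<sigma> n) \<in> {L. \<delta> / 2 \<le> Re (L ?F)}"
    proof (intro always_eventually allI)
      fix n show "\<Lambda> (\<sigma> n) \<in> {L. \<delta> / 2 \<le> Re (L ?F)}"
        using lower[OF \<sigma>1[of n]] \<sigma>(2)[of n] by simp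
    qed
    ultimately show ?thesis using closed_L by blast
  qed
  ultimately show False using \<delta> by simp
qed

section \<open>Pointwise convergence\<close>

lemma sum_atLeast1_add:
  fixes g :: "nat \<Rightarrow> 'c::comm_monoid_add"
  shows "(\<Sum>n=1..a + b. g n) = (\<Sum>n=1..a. g n) + (\<Sum>n=1..b. g (a + n))"
  by (induction b) (simp_all add: add.assoc)

lemma degree_pshift_funpow_le: "degree ((pshift ^^ i) P) \<le> degree P"
proof (induction i)
  case (Suc i)
  then show ?case using degree_pshift_le[of "(pshift ^^ i) P"] by simp
qed simp

text \<open>The sum is cut into blocks of length N. On each block P becomes a translate of P, again
  of degree at most k, so \<open>wsup\<close> at a point of the orbit of \<open>T ^^ N\<close>
  bounds it; the incomplete last block is bounded by the sum of |f| over a full one.\<close>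

lemma wsup_subadditive:
  assumes N: "N \<ge> 1"
  shows "real M * wsup T f k M x \<le> real N * (\<Sum>i<M div N. wsup T f k N (((T ^^ N) ^^ i) x))
      + (\<Sum>n=1..N. cmod (f ((T ^^ n) (((T ^^ N) ^^ (M div N)) x))))"
proof (cases "M = 0")
  case True
  then show ?thesis by (auto intro!: sum_nonneg)
next
  case False
  let ?S = "T ^^ N"
  let ?R = "\<lambda>y. \<Sum>n=1..N. cmod (f ((T ^^ n) y))"
  define a where "a = (\<lambda>P n. ee (poly P (real n)) * f ((T ^^ n) x))"
  have shift: "a P (N * q + n) = ee (poly ((pshift ^^ (N * q)) P) (real n)) * f ((T ^^ n) ((?S ^^ q) x))" for P q n
  proof -
    have "(T ^^ (N * q + n)) x = (T ^^ n) ((?S ^^ q) x)"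
      by (simp only: funpow_mult add.commute[of "N * q" n] funpow_add comp_apply)
    then show ?thesis by (simp add: a_def poly_pshift_funpow add.commute)
  qed
  have block: "cmod (\<Sum>n=1..N * q. a P n) \<le> real N * (\<Sum>i<q. wsup T f k N ((?S ^^ i) x))"
    if P: "degree P \<le> k" for P q
  proof (induction q)
    case (Suc q)
    let ?P = "(pshift ^^ (N * q)) P"
    have "(\<Sum>n=1..N. a P (N * q + n)) = of_nat N * wavg T f ee ?P ((?S ^^ q) x) N"
      using N by (simp add: shift wavg_def)
    moreover have "cmod (wavg T f ee ?P ((?S ^^ q) x) N) \<le> wsup T f k N ((?S ^^ q) x)"
      by (rule wavg_le_wsup[OF order_trans[OF degree_pshift_funpow_le P]])
    ultimately have "cmod (\<Sum>n=1..N. a P (N * q + n)) \<le> real N * wsup T f k N ((?S ^^ q) x)"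
      by (simp add: norm_mult mult_left_mono)
    moreover have "(\<Sum>n=1..N * Suc q. a P n) = (\<Sum>n=1..N * q. a P n) + (\<Sum>n=1..N. a P (N * q + n))"
      using sum_atLeast1_add[of "a P" "N * q" N] by (simp add: add.commute)
    ultimately show ?case
      using Suc norm_triangle_ineq[of "\<Sum>n=1..N * q. a P n" "\<Sum>n=1..N. a P (N * q + n)"]
      by (simp add: distrib_left)
  qed simp
  have "cmod (wavg T f ee P x M) \<le> (real N * (\<Sum>i<M div N. wsup T f k N ((?S ^^ i) x)) + ?R ((?S ^^ (M div N)) x)) / real M"
    if P: "degree P \<le> k" for P
  proof -
    let ?q = "M div N" and ?r = "M mod N"
    have "cmod (\<Sum>n=1..?r. a P (N * ?q + n)) \<le> (\<Sum>n=1..?r. cmod (f ((T ^^ n) ((?S ^^ ?q) x))))"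
      by (rule sum_norm_le) (simp add: shift norm_mult)
    also have "\<dots> \<le> ?R ((?S ^^ ?q) x)"
      using N by (intro sum_mono2) (auto intro: order_trans less_imp_le mod_less_divisor)
    finally have "cmod (\<Sum>n=1..?r. a P (N * ?q + n)) \<le> ?R ((?S ^^ ?q) x)" .
    moreover have "(\<Sum>n=1..M. a P n) = (\<Sum>n=1..N * ?q. a P n) + (\<Sum>n=1..?r. a P (N * ?q + n))"
      using sum_atLeast1_add[of "a P" "N * ?q" ?r] by simp
    then have "cmod (\<Sum>n=1..M. a P n) \<le> cmod (\<Sum>n=1..N * ?q. a P n) + cmod (\<Sum>n=1..?r. a P (N * ?q + n))"
      by (simp only: norm_triangle_ineq)
    ultimately have "cmod (\<Sum>n=1..M. a P n) \<le> real N * (\<Sum>i<?q. wsup T f k N ((?S ^^ i) x)) + ?R ((?S ^^ ?q) x)"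
      using block[OF P, of ?q] by linarith
    then show ?thesis by (simp add: wavg_def a_def norm_divide divide_right_mono)
  qed
  from wsup_le_I[of k T f x M, OF this] show ?thesis
    using False by (simp add: le_divide_eq mult.commute)
qed

text \<open>Birkhoff's theorem for \<open>T ^^ N\<close>, ergodic by total ergodicity, averages the
  block bounds. A single fixed N already controls all large m.\<close>

lemma AE_wsup_eventually:
  assumes te: "totally_ergodic M T" and f: "integrable M f" and N: "N \<ge> 1"
  shows "AE x in M. \<forall>\<epsilon>>0. \<forall>\<^sub>F m in sequentially. wsup T f k m x < (\<integral>x. wsup T f k N x \<partial>M) + \<epsilon>"
proof -
  have T: "mps M T" and S: "ergodic M (T ^^ N)" using te N by (auto simp: totally_ergodic_def)
  let ?S = "T ^^ N"
  let ?R = "\<lambda>y. \<Sum>n=1..N. cmod (f ((T ^^ n) y))"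
  have "integrable M ?R"
    using mps_integrable[OF mps_funpow[OF T] integrable_norm[OF f]]
    by (intro Bochner_Integration.integrable_sum) auto
  from ergodic_birkhoff_real[OF S this] ergodic_birkhoff_real[OF S integrable_wsup[OF T f, of k N]]
  show ?thesis
  proof eventually_elim
    case (elim x)
    let ?a = "\<lambda>q. (\<Sum>i<q. wsup T f k N ((?S ^^ i) x)) / real q"
    let ?s = "\<lambda>q. \<Sum>i<q. ?R ((?S ^^ i) x)"
    let ?I = "\<integral>y. ?R y \<partial>M"
    \<comment> \<open>An orbit term divided by q is a difference of consecutive Birkhoff averages,
      up to a factor that tends to 1, and hence tends to 0.\<close>
    have "(\<lambda>q. ?s (Suc q) / real (Suc q) * (real (Suc q) / real q) - ?s q / real q) \<longlonglongrightarrow> ?I * 1 - ?I"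
      by (intro tendsto_intros elim(1) LIMSEQ_Suc[OF elim(1)] LIMSEQ_Suc_n_over_n)
    moreover have cancel: "u / b * (b / c) = u / c" if "b \<noteq> 0" for u b c :: real using that by simp
    have "?s (Suc q) / real (Suc q) * (real (Suc q) / real q) - ?s q / real q
        = ?R ((?S ^^ q) x) / real q" for q
    proof -
      have "?s (Suc q) / real (Suc q) * (real (Suc q) / real q) = ?s (Suc q) / real q"
        by (rule cancel) simp
      then show ?thesis by (simp add: add_divide_distrib)
    qed
    ultimately have R0: "(\<lambda>q. ?R ((?S ^^ q) x) / real q) \<longlonglongrightarrow> 0" by simp
    have lim: "(\<lambda>q. ?a q + ?R ((?S ^^ q) x) / real q) \<longlonglongrightarrow> (\<integral>x. wsup T f k N x \<partial>M)"
      using tendsto_add[OF elim(2) R0] by simp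
    have div: "filterlim (\<lambda>m. m div N) at_top sequentially"
      using N by (intro filterlim_at_top_div_const_nat) auto
    show ?case
    proof (intro allI impI)
      fix \<epsilon> :: real assume "\<epsilon> > 0"
      then have "\<forall>\<^sub>F q in sequentially. ?a q + ?R ((?S ^^ q) x) / real q < (\<integral>x. wsup T f k N x \<partial>M) + \<epsilon>"
        by (intro order_tendstoD(2)[OF lim]) simp
      from filterlim_iff[THEN iffD1, OF div, rule_format, OF this]
        filterlim_iff[THEN iffD1, OF div, rule_format, OF eventually_gt_at_top[of 0]]
      show "\<forall>\<^sub>F m in sequentially. wsup T f k m x < (\<integral>x. wsup T f k N x \<partial>M) + \<epsilon>"
      proof eventually_elim
        case (elim m)
        let ?q = "m div N"
        have q: "real ?q > 0" using elim(2) by simp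
        have nn: "0 \<le> ?R ((?S ^^ ?q) x)" by (intro sum_nonneg) simp
        have "real N * real ?q * wsup T f k m x \<le> real m * wsup T f k m x"
          by (intro mult_right_mono wsup_nonneg) (metis of_nat_le_iff of_nat_mult times_div_less_eq_dividend)
        also have "\<dots> \<le> real N * (\<Sum>i<?q. wsup T f k N ((?S ^^ i) x)) + ?R ((?S ^^ ?q) x)"
          by (rule wsup_subadditive[OF N])
        also have "\<dots> \<le> real N * (\<Sum>i<?q. wsup T f k N ((?S ^^ i) x)) + real N * ?R ((?S ^^ ?q) x)"
          using N nn mult_right_mono[of 1 "real N" "?R ((?S ^^ ?q) x)"] by simp
        also have "\<dots> = real N * real ?q * (?a ?q + ?R ((?S ^^ ?q) x) / real ?q)"
          using q by (simp add: field_simps)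
        finally have "wsup T f k m x \<le> ?a ?q + ?R ((?S ^^ ?q) x) / real ?q"
          using q N by (simp add: mult_le_cancel_left_pos)
        then show ?case using elim(1) by linarith
      qed
    qed
  qed
qed

lemma AE_wsup_tendsto:
  assumes te: "totally_ergodic M T" and f: "integrable M f"
    and perp: "\<And>g. qeig M T (Suc k) g \<Longrightarrow> (\<integral>x. f x * g x \<partial>M) = 0"
  shows "AE x in M. (\<lambda>N. wsup T f k N x) \<longlonglongrightarrow> 0"
proof -
  let ?I = "\<lambda>N. \<integral>x. wsup T f k N x \<partial>M"
  have I: "?I \<longlonglongrightarrow> 0" by (rule tendsto_integral_wsup[OF te f perp])
  have "AE x in M. \<forall>N. \<forall>\<epsilon>>0. \<forall>\<^sub>F m in sequentially. wsup T f k m x < ?I (Suc N) + \<epsilon>"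
    using AE_wsup_eventually[OF te f] by (subst AE_all_countable) auto
  then show ?thesis
  proof (rule AE_mp, intro AE_I2 impI)
    fix x
    assume ev: "\<forall>N. \<forall>\<epsilon>>0. \<forall>\<^sub>F m in sequentially. wsup T f k m x < ?I (Suc N) + \<epsilon>"
    show "(\<lambda>N. wsup T f k N x) \<longlonglongrightarrow> 0"
    proof (rule order_tendstoI)
      fix a :: real assume "a < 0"
      then show "\<forall>\<^sub>F N in sequentially. a < wsup T f k N x"
        using wsup_nonneg[of T f k _ x] by (intro always_eventually allI) (rule less_le_trans)
    next
      fix a :: real assume "0 < a"
      then have "\<forall>\<^sub>F N in sequentially. ?I (Suc N) < a / 2"
        by (intro order_tendstoD(2)[OF LIMSEQ_Suc[OF I]]) simp
      then obtain N where N: "?I (Suc N) < a / 2"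
        using eventually_happens'[OF sequentially_bot] by blast
      have "\<forall>\<^sub>F m in sequentially. wsup T f k m x < ?I (Suc N) + a / 2" using ev \<open>0 < a\<close> by simp
      then show "\<forall>\<^sub>F m in sequentially. wsup T f k m x < a"
        by eventually_elim (use N in linarith)
    qed
  qed
qed

section \<open>Continuous functions on the torus\<close>

inductive trig_poly :: "(real \<Rightarrow> complex) \<Rightarrow> bool" where
  monomial: "trig_poly (\<lambda>t. c * ee (of_int j * t))"
| add: "trig_poly \<phi> \<Longrightarrow> trig_poly \<psi> \<Longrightarrow> trig_poly (\<lambda>t. \<phi> t + \<psi> t)"

lemma trig_poly_const: "trig_poly (\<lambda>t. c)"
  using trig_poly.monomial[of c 0] by simp

lemma trig_poly_mult:
  assumes "trig_poly \<phi>" "trig_poly \<psi>"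
  shows "trig_poly (\<lambda>t. \<phi> t * \<psi> t)"
  using assms
proof (induction arbitrary: \<psi>)
  case (monomial c j)
  show ?case using monomial
  proof induction
    case (monomial c' j')
    have "ee (of_int (j + j') * t) = ee (of_int j * t) * ee (of_int j' * t)" for t
      by (simp add: distrib_right ee_add)
    then have "(\<lambda>t. c * ee (of_int j * t) * (c' * ee (of_int j' * t))) = (\<lambda>t. (c * c') * ee (of_int (j + j') * t))"
      by (simp add: fun_eq_iff)
    then show ?case by (simp only: trig_poly.monomial)
  next
    case (add \<phi> \<psi>)
    then show ?case using trig_poly.add by (simp add: distrib_left)
  qed
next
  case (add \<phi>1 \<phi>2)
  then show ?case using trig_poly.add by (simp add: distrib_right)
qed

text \<open>A real linear functional of \<open>ee t\<close> is a combination of its real and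
  imaginary part, hence of \<open>ee t\<close> and \<open>ee (- t)\<close>; sums and products stay
  in the class.\<close>

lemma trig_poly_real_polynomial:
  assumes "real_polynomial_function p"
  shows "trig_poly (\<lambda>t. complex_of_real (p (ee t)))"
  using assms
proof (induction rule: real_polynomial_function.induct)
  case (linear h)
  have "complex_of_real (h (ee t))
      = (of_real (h 1) / 2 + of_real (h \<i>) / (2 * \<i>)) * ee (of_int 1 * t)
        + (of_real (h 1) / 2 - of_real (h \<i>) / (2 * \<i>)) * ee (of_int (- 1) * t)" for t
  proof -
    note lin = bounded_linear.linear[OF linear]
    have "ee t = Re (ee t) *\<^sub>R 1 + Im (ee t) *\<^sub>R \<i>" by (simp add: complex_eq_iff)
    then have "h (ee t) = h (Re (ee t) *\<^sub>R 1 + Im (ee t) *\<^sub>R \<i>)" by (rule arg_cong)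
    also have "\<dots> = Re (ee t) * h 1 + Im (ee t) * h \<i>"
      by (simp only: linear_add[OF lin] linear_scale[OF lin] real_scaleR_def)
    finally have "h (ee t) = Re (ee t) * h 1 + Im (ee t) * h \<i>" .
    moreover have "ee (of_int (- 1) * t) = cnj (ee t)" by (simp add: ee_cnj)
    ultimately show ?thesis by (simp add: complex_eq_iff field_simps)
  qed
  then show ?case by (simp only:) (rule trig_poly.add[OF trig_poly.monomial trig_poly.monomial])
next
  case (const c)
  show ?case by (rule trig_poly_const)
next
  case (add f g)
  then show ?case using trig_poly.add by simp
next
  case (mult f g)
  then show ?case using trig_poly_mult by simp
qed

lemma torus_cont_periodic:
  assumes "torus_cont \<phi>" "s - t \<in> \<int>"
  shows "\<phi> s = \<phi> t"
proof -
  have per: "\<phi> (r + 1) = \<phi> r" for r using assms(1) by (simp add: torus_cont_def)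
  have nat: "\<phi> (r + real n) = \<phi> r" for r n
  proof (induction n)
    case (Suc n)
    then show ?case using per[of "r + real n"] by (simp add: add_ac)
  qed simp
  obtain n where "s - t = of_int n" using assms(2) by (rule Ints_cases)
  then show ?thesis
    using nat[of t "nat n"] nat[of s "nat (- n)"] by (cases "n \<ge> 0") (auto simp: algebra_simps)
qed

text \<open>Continuity is read off from closed sets: the preimage of B is the image under
  \<open>ee\<close> of the part of the unit interval that \<phi> maps into B, and this is
  compact.\<close>

lemma torus_cont_factors_through_circle:
  assumes "torus_cont \<phi>"
  obtains \<Phi> where "continuous_on (sphere 0 1) \<Phi>" "\<And>t. \<Phi> (ee t) = \<phi> t"
proof -
  define \<Phi> where "\<Phi> = (\<lambda>z. \<phi> (SOME t. ee t = z))"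
  have \<Phi>: "\<Phi> (ee t) = \<phi> t" for t
  proof -
    have "ee (SOME s. ee s = ee t) = ee t" by (rule someI[of "\<lambda>s. ee s = ee t"]) simp
    then show ?thesis unfolding \<Phi>_def ee_eq_iff by (rule torus_cont_periodic[OF assms])
  qed
  have cont: "continuous_on UNIV \<phi>" using assms by (simp add: torus_cont_def)
  have "closed (\<Phi> -` B \<inter> sphere 0 1)" if B: "closed B" for B
  proof -
    have "\<Phi> -` B \<inter> sphere 0 1 = ee ` ({0..1} \<inter> \<phi> -` B)"
    proof (intro set_eqI iffI)
      fix z assume z: "z \<in> \<Phi> -` B \<inter> sphere 0 1"
      then obtain t where t: "ee t = z" using ee_surj[of z] by auto
      have "ee (frac t) = z" using t by (metis ee_eq_iff frac_def Ints_of_int add_diff_cancel_left' diff_minus_eq_add minus_diff_eq Ints_minus)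
      moreover from this have "\<phi> (frac t) \<in> B" using z \<Phi>[of "frac t"] by auto
      moreover have "frac t \<in> {0..1}" using frac_ge_0[of t] frac_lt_1[of t] by simp
      ultimately show "z \<in> ee ` ({0..1} \<inter> \<phi> -` B)" by blast
    qed (auto simp: \<Phi>)
    moreover have "compact ({0..1} \<inter> \<phi> -` B)"
      using closed_vimage[OF B cont] by (intro compact_Int_closed) auto
    ultimately show ?thesis
      by (simp add: compact_imp_closed compact_continuous_image continuous_on_ee[OF continuous_on_id])
  qed
  then have "continuous_on (sphere 0 1) \<Phi>" by (subst continuous_on_closed_vimage) auto
  then show thesis using \<Phi> by (rule that)
qed

lemma torus_cont_approx:
  assumes "torus_cont \<phi>" "\<epsilon> > 0"
  obtains \<psi> where "trig_poly \<psi>" "\<And>t. cmod (\<phi> t - \<psi> t) \<le> \<epsilon>"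
proof -
  obtain \<Phi> where \<Phi>: "continuous_on (sphere 0 1) \<Phi>" "\<And>t. \<Phi> (ee t) = \<phi> t"
    using torus_cont_factors_through_circle[OF assms(1)] by blast
  obtain g where g: "polynomial_function g" "\<And>z. z \<in> sphere 0 1 \<Longrightarrow> norm (\<Phi> z - g z) < \<epsilon>"
    using Stone_Weierstrass_polynomial_function[OF compact_sphere \<Phi>(1) assms(2)] by blast
  have "real_polynomial_function (Re \<circ> g)" "real_polynomial_function (Im \<circ> g)"
    using g(1) bounded_linear_Re bounded_linear_Im by (auto simp: polynomial_function_def)
  then have "trig_poly (\<lambda>t. complex_of_real (Re (g (ee t))) + \<i> * complex_of_real (Im (g (ee t))))"
    using trig_poly.add[OF trig_poly_real_polynomial trig_poly_mult[OF trig_poly_const[of \<i>] trig_poly_real_polynomial]]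
    by (simp add: comp_def)
  then have "trig_poly (\<lambda>t. g (ee t))" by (simp flip: complex_eq)
  moreover have "cmod (\<phi> t - g (ee t)) \<le> \<epsilon>" for t
    using g(2)[of "ee t"] \<Phi>(2)[of t] by simp
  ultimately show thesis by (rule that)
qed

lemma torus_cont_bounded:
  assumes "torus_cont \<phi>"
  obtains B where "\<And>t. cmod (\<phi> t) \<le> B"
proof -
  obtain \<Phi> where \<Phi>: "continuous_on (sphere 0 1) \<Phi>" "\<And>t. \<Phi> (ee t) = \<phi> t"
    using torus_cont_factors_through_circle[OF assms] by blast
  have "bounded (\<Phi> ` sphere 0 1)"
    by (intro compact_imp_bounded compact_continuous_image \<Phi> compact_sphere)
  then obtain B where B: "\<forall>z\<in>sphere 0 1. cmod (\<Phi> z) \<le> B" unfolding bounded_iff by blast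
  have "cmod (\<phi> t) \<le> B" for t using B[rule_format, of "ee t"] \<Phi>(2)[of t] by simp
  then show thesis by (rule that)
qed

text \<open>The frequency is absorbed by the polynomial: \<open>smult (of_int j) P\<close> has
  degree at most k as well, so control of a single character controls them all.\<close>

lemma trig_poly_wavg_small:
  assumes "trig_poly \<psi>" and lim: "(\<lambda>N. wsup T f k N x) \<longlonglongrightarrow> 0"
  shows "\<exists>b. b \<longlonglongrightarrow> 0 \<and> (\<forall>N P. degree P \<le> k \<longrightarrow> cmod (wavg T f \<psi> P x N) \<le> b N)"
  using assms(1)
proof induction
  case (monomial c j)
  have "cmod (wavg T f (\<lambda>t. c * ee (of_int j * t)) P x N) \<le> cmod c * wsup T f k N x" if "degree P \<le> k" for N P
  proof -
    have "wavg T f (\<lambda>t. c * ee (of_int j * t)) P x N = c * wavg T f ee (smult (of_int j) P) x N"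
      by (simp add: wavg_def sum_distrib_left mult_ac)
    moreover have "degree (smult (of_int j) P) \<le> k" using that degree_smult_le order_trans by blast
    ultimately show ?thesis using wavg_le_wsup[of _ k T f x N] by (simp add: norm_mult mult_left_mono)
  qed
  moreover have "(\<lambda>N. cmod c * wsup T f k N x) \<longlonglongrightarrow> 0" using tendsto_mult_left[OF lim, of "cmod c"] by simp
  ultimately show ?case by blast
next
  case (add \<phi> \<psi>)
  then obtain b b' where b: "b \<longlonglongrightarrow> 0" "\<And>N P. degree P \<le> k \<Longrightarrow> cmod (wavg T f \<phi> P x N) \<le> b N"
    and b': "b' \<longlonglongrightarrow> 0" "\<And>N P. degree P \<le> k \<Longrightarrow> cmod (wavg T f \<psi> P x N) \<le> b' N" by blast
  have "cmod (wavg T f (\<lambda>t. \<phi> t + \<psi> t) P x N) \<le> b N + b' N" if "degree P \<le> k" for N P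
  proof -
    have "wavg T f (\<lambda>t. \<phi> t + \<psi> t) P x N = wavg T f \<phi> P x N + wavg T f \<psi> P x N"
      by (simp add: wavg_def distrib_right sum.distrib add_divide_distrib)
    then show ?thesis using b(2)[OF that, of N] b'(2)[OF that, of N]
        norm_triangle_ineq[of "wavg T f \<phi> P x N" "wavg T f \<psi> P x N"] by simp
  qed
  moreover have "(\<lambda>N. b N + b' N) \<longlonglongrightarrow> 0" using tendsto_add[OF b(1) b'(1)] by simp
  ultimately show ?case by (intro exI[of _ "\<lambda>N. b N + b' N"]) blast
qed

lemma torus_cont_wavg_small:
  assumes \<phi>: "torus_cont \<phi>" and lim: "(\<lambda>N. wsup T f k N x) \<longlonglongrightarrow> 0"
    and avg: "(\<lambda>N. (\<Sum>n=1..N. cmod (f ((T ^^ n) x))) / real N) \<longlonglongrightarrow> C"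
  shows "(\<lambda>N. SUP P\<in>{P :: real poly. degree P \<le> k}. cmod (wavg T f \<phi> P x N)) \<longlonglongrightarrow> 0"
proof (rule LIMSEQ_I)
  fix r :: real assume r: "r > 0"
  define A where "A = (\<lambda>N. (\<Sum>n=1..N. cmod (f ((T ^^ n) x))) / real N)"
  have C0: "C \<ge> 0" by (rule LIMSEQ_le_const[OF avg]) (auto intro!: sum_nonneg divide_nonneg_nonneg)
  \<comment> \<open>The averages of |f| are eventually below \<open>C + 1\<close>, so the
    approximation costs at most \<open>r / 4\<close>.\<close>
  define \<epsilon> where "\<epsilon> = r / 4 / (C + 1)"
  have \<epsilon>: "\<epsilon> > 0" using r C0 by (simp add: \<epsilon>_def)
  obtain \<psi> where \<psi>: "trig_poly \<psi>" "\<And>t. cmod (\<phi> t - \<psi> t) \<le> \<epsilon>"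
    using torus_cont_approx[OF \<phi> \<epsilon>] by blast
  obtain b where b: "b \<longlonglongrightarrow> 0" "\<And>N P. degree P \<le> k \<Longrightarrow> cmod (wavg T f \<psi> P x N) \<le> b N"
    using trig_poly_wavg_small[OF \<psi>(1) lim] by blast
  have "\<forall>\<^sub>F N in sequentially. b N < r / 4" using r by (intro order_tendstoD(2)[OF b(1)]) simp
  moreover have "\<forall>\<^sub>F N in sequentially. A N < C + 1"
    unfolding A_def by (intro order_tendstoD(2)[OF avg]) simp
  ultimately have "\<forall>\<^sub>F N in sequentially. norm ((SUP P\<in>{P :: real poly. degree P \<le> k}. cmod (wavg T f \<phi> P x N)) - 0) < r"
  proof eventually_elim
    case (elim N)
    have le: "cmod (wavg T f \<phi> P x N) \<le> r / 2" if P: "degree P \<le> k" for P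
    proof -
      have "wavg T f \<phi> P x N = wavg T f (\<lambda>t. \<phi> t - \<psi> t) P x N + wavg T f \<psi> P x N"
        by (simp add: wavg_def left_diff_distrib sum_subtractf diff_divide_distrib)
      moreover have "cmod (wavg T f (\<lambda>t. \<phi> t - \<psi> t) P x N) \<le> \<epsilon> * A N"
        unfolding A_def by (rule cmod_wavg_le[OF \<psi>(2)])
      moreover have "\<epsilon> * A N \<le> \<epsilon> * (C + 1)" using elim(2) \<epsilon> by (intro mult_left_mono) auto
      moreover have "C + 1 \<noteq> 0" using C0 by simp
      then have "\<epsilon> * (C + 1) = r / 4" using eq_divide_eq[of \<epsilon> "r / 4" "C + 1"] \<epsilon>_def by metis
      ultimately show ?thesis
        using b(2)[OF P, of N] elim(1) norm_triangle_ineq[of "wavg T f (\<lambda>t. \<phi> t - \<psi> t) P x N" "wavg T f \<psi> P x N"]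
        by simp
    qed
    have z: "0 \<in> {P::real poly. degree P \<le> k}" by simp
    have "(SUP P\<in>{P :: real poly. degree P \<le> k}. cmod (wavg T f \<phi> P x N)) \<le> r / 2"
    proof (rule cSUP_least)
      show "{P::real poly. degree P \<le> k} \<noteq> {}" using z by blast
    qed (use le in auto)
    moreover have "cmod (wavg T f \<phi> 0 x N) \<le> (SUP P\<in>{P :: real poly. degree P \<le> k}. cmod (wavg T f \<phi> P x N))"
      by (rule cSUP_upper[OF z]) (auto intro!: bdd_aboveI2 le)
    from order_trans[OF norm_ge_zero this]
    have "0 \<le> (SUP P\<in>{P :: real poly. degree P \<le> k}. cmod (wavg T f \<phi> P x N))" .
    ultimately show ?case using r by simp
  qed
  then show "\<exists>no. \<forall>N\<ge>no. norm ((SUP P\<in>{P :: real poly. degree P \<le> k}. cmod (wavg T f \<phi> P x N)) - 0) < r"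
    unfolding eventually_sequentially .
qed

section \<open>Quasi-eigenfunctions along orbits\<close>

lemma sum_choose_lessThan: "(\<Sum>m<n. (m choose i)) = n choose Suc i"
  by (induction n) simp_all

lemma unimodular_cancel: "cmod w = 1 \<Longrightarrow> z * cnj w * w = z"
  using mult_cnj_unimodular[of w] by (simp add: mult.assoc mult.commute)

text \<open>The derivative is integrated along the orbit. Summing a binomial coefficient over m < n
  raises its lower index by one, so in this basis the induction merely shifts the coefficients and
  puts the phase of \<open>g x\<close> in front.\<close>

lemma qeig_orbit_binomial:
  assumes T: "mps M T" and "qeig M T (Suc d) g"
  shows "AE x in M. \<exists>c. \<forall>n. g ((T ^^ n) x) = ee (\<Sum>i\<le>d. c i * real (n choose i))"
  using assms(2)
proof (induction d arbitrary: g)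
  case 0
  then have "AE x in M. mder T g x = 1" by simp
  from mps_AE_funpow[OF T this] show ?case
  proof eventually_elim
    case (elim x)
    have "g ((T ^^ n) x) = g x" for n
    proof (induction n)
      case (Suc n)
      have "g ((T ^^ Suc n) x) * cnj (g ((T ^^ n) x)) = 1"
        using elim[rule_format, of n] by (simp add: mder_def)
      then show ?case
        using Suc unimodular_cancel[OF qeig_cmod[OF 0, of "(T ^^ n) x"], of "g ((T ^^ Suc n) x)"] by simp
    qed simp
    moreover obtain a where "ee a = g x" using ee_surj[OF qeig_cmod[OF 0]] by metis
    ultimately show ?case by (intro exI[of _ "\<lambda>_. a"]) simp
  qed
next
  case (Suc d)
  then have "qeig M T (Suc d) (mder T g)" by simp
  from Suc(1)[OF this] show ?case
  proof eventually_elim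
    case (elim x)
    then obtain c where c: "\<And>n. mder T g ((T ^^ n) x) = ee (\<Sum>i\<le>d. c i * real (n choose i))" by blast
    obtain a where a: "ee a = g x" using ee_surj[OF qeig_cmod[OF Suc(2)]] by metis
    define c' where "c' = (\<lambda>i. case i of 0 \<Rightarrow> a | Suc i \<Rightarrow> c i)"
    have eq: "(\<Sum>i\<le>Suc d. c' i * real (n choose i)) = a + (\<Sum>m<n. \<Sum>i\<le>d. c i * real (m choose i))" for n
    proof -
      have "(\<Sum>i\<le>Suc d. c' i * real (n choose i)) = a + (\<Sum>i\<le>d. c i * real (n choose Suc i))"
        by (simp only: sum.atMost_Suc_shift) (simp add: c'_def)
      also have "(\<Sum>i\<le>d. c i * real (n choose Suc i)) = (\<Sum>i\<le>d. \<Sum>m<n. c i * real (m choose i))"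
        by (simp only: sum_choose_lessThan[symmetric] of_nat_sum sum_distrib_left)
      also have "\<dots> = (\<Sum>m<n. \<Sum>i\<le>d. c i * real (m choose i))" by (rule sum.swap)
      finally show ?thesis .
    qed
    have "g ((T ^^ n) x) = ee (\<Sum>i\<le>Suc d. c' i * real (n choose i))" for n
      unfolding eq
    proof (induction n)
      case (Suc n)
      have "g ((T ^^ Suc n) x) = mder T g ((T ^^ n) x) * g ((T ^^ n) x)"
        using unimodular_cancel[OF qeig_cmod[OF \<open>qeig M T (Suc (Suc d)) g\<close>, of "(T ^^ n) x"]]
        by (simp add: mder_def)
      then show ?case unfolding c Suc by (simp flip: ee_add add: algebra_simps)
    qed (simp add: a)
    then show ?case by blast
  qed
qed

lemma binomial_sum_poly:
  obtains P :: "real poly" where "degree P \<le> d" "\<And>n. poly P (real n) = (\<Sum>i\<le>d. c i * real (n choose i))"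
proof -
  define B where "B = (\<lambda>i. smult (1 / fact i) (\<Prod>j<i. [:- real j, 1:]))"
  have B: "poly (B i) (real n) = real (n choose i)" for i n
    by (simp add: B_def poly_prod binomial_gbinomial gbinomial_prod_rev atLeast0LessThan)
  have dB: "degree (B i) \<le> i" for i
  proof -
    have "degree (B i) \<le> degree (\<Prod>j<i. [:- real j, 1:])" unfolding B_def by (rule degree_smult_le)
    also have "\<dots> \<le> (\<Sum>j<i. degree [:- real j, 1:])" using degree_prod_sum_le[of "{..<i}" "\<lambda>j. [:- real j, 1:]"] by simp
    finally show ?thesis by simp
  qed
  show thesis
  proof (rule that[of "\<Sum>i\<le>d. smult (c i) (B i)"])
    show "degree (\<Sum>i\<le>d. smult (c i) (B i)) \<le> d"
      by (rule degree_sum_le) (auto intro: order_trans[OF degree_smult_le] order_trans[OF dB])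
  qed (simp add: poly_sum B)
qed

lemma qeig_orbit_poly:
  assumes "mps M T" "qeig M T (Suc d) g"
  shows "AE x in M. \<exists>P. degree P \<le> d \<and> (\<forall>n. g ((T ^^ n) x) = ee (poly P (real n)))"
  using qeig_orbit_binomial[OF assms]
proof eventually_elim
  case (elim x)
  then obtain c where c: "\<And>n. g ((T ^^ n) x) = ee (\<Sum>i\<le>d. c i * real (n choose i))" by blast
  obtain P :: "real poly" where "degree P \<le> d" "\<And>n. poly P (real n) = (\<Sum>i\<le>d. c i * real (n choose i))"
    using binomial_sum_poly[of d c] by blast
  then show ?case using c by (intro exI[of _ P]) simp
qed

section \<open>The polynomial Wiener--Wintner theorem\<close>

theorem theorem1p2:
  fixes M :: "'a measure" and T :: "'a \<Rightarrow> 'a" and f :: "'a \<Rightarrow> complex" and k :: nat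
  assumes "totally_ergodic M T"
    and "integrable M f"
    and "k \<ge> 1"
  shows "(in_E_perp M T k f
          \<longleftrightarrow> (AE x in M. \<forall>\<phi> P. torus_cont \<phi> \<and> degree P \<le> k \<longrightarrow>
                 (wavg T f \<phi> P x \<longlonglongrightarrow> 0)))
       \<and> ((AE x in M. \<forall>\<phi> P. torus_cont \<phi> \<and> degree P \<le> k \<longrightarrow>
                 (wavg T f \<phi> P x \<longlonglongrightarrow> 0))
          \<longleftrightarrow> (AE x in M. \<forall>\<phi>. torus_cont \<phi> \<longrightarrow>
                 ((\<lambda>N. SUP P\<in>{P :: real poly. degree P \<le> k}. cmod (wavg T f \<phi> P x N))
                    \<longlonglongrightarrow> 0)))"
    (is "(?i \<longleftrightarrow> ?ii) \<and> (?ii \<longleftrightarrow> ?iii)")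
proof -
  note te = assms(1) and f = assms(2)
  have T: "mps M T" using te by (simp add: totally_ergodic_def)
  have "ergodic M (T ^^ 1)" using te unfolding totally_ergodic_def by blast
  then have erg: "ergodic M T" by simp
  interpret prob_space M by (rule mps_prob[OF T])
  have "?i \<Longrightarrow> ?iii"
  proof -
    assume "?i"
    then have "(\<integral>x. f x * g x \<partial>M) = 0" if "qeig M T (Suc k) g" for g
      by (rule integral_qeig_eq_0[OF erg _ assms(3) that])
    then have "AE x in M. (\<lambda>N. wsup T f k N x) \<longlonglongrightarrow> 0" by (rule AE_wsup_tendsto[OF te f])
    \<comment> \<open>Both limits concern x alone, so one set of full measure serves all
      \<phi>.\<close>
    from this ergodic_birkhoff_real_from_1[OF erg integrable_norm[OF f]]
    show "?iii" by eventually_elim (blast intro: torus_cont_wavg_small)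
  qed
  moreover have "?iii \<Longrightarrow> ?ii"
  proof -
    assume "?iii"
    then show "?ii"
    proof (rule AE_mp, intro AE_I2 impI allI)
      fix x \<phi> and P :: "real poly"
      assume sup: "\<forall>\<phi>. torus_cont \<phi> \<longrightarrow>
          (\<lambda>N. SUP P\<in>{P :: real poly. degree P \<le> k}. cmod (wavg T f \<phi> P x N)) \<longlonglongrightarrow> 0"
        and \<phi>P: "torus_cont \<phi> \<and> degree P \<le> k"
      \<comment> \<open>Boundedness of \<phi> makes the averages at x bounded in P, so that the
        supremum is an upper bound.\<close>
      obtain B where B: "\<And>t. cmod (\<phi> t) \<le> B" using torus_cont_bounded \<phi>P by blast
      have "cmod (wavg T f \<phi> P x N) \<le> (SUP P\<in>{P :: real poly. degree P \<le> k}. cmod (wavg T f \<phi> P x N))" for N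
        by (rule cSUP_upper) (use \<phi>P in \<open>auto intro!: bdd_aboveI2 cmod_wavg_le[OF B]\<close>)
      then show "wavg T f \<phi> P x \<longlonglongrightarrow> 0"
        by (rule Lim_null_comparison[OF always_eventually, OF allI sup[rule_format]]) (use \<phi>P in simp)
    qed
  qed
  moreover have "?ii \<Longrightarrow> ?i"
  proof -
    assume ii: "?ii"
    obtain j where k: "k = Suc j" using assms(3) by (cases k) auto
    show "?i"
      unfolding in_E_perp_def
    proof (intro conjI allI impI f)
      fix g assume "in_E M T k g"
      then obtain g' where g': "qeig M T (Suc k) g'" and gg': "AE x in M. g x = g' x"
        unfolding k by (rule in_E_representative[OF T])
      have [measurable]: "g \<in> borel_measurable M" "g' \<in> borel_measurable M" "f \<in> borel_measurable M"
        using in_E_measurable[OF \<open>in_E M T k g\<close>] qeig_measurable[OF g'] f by auto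
      let ?h = "\<lambda>x. f x * cnj (g' x)"
      have h: "integrable M ?h"
        by (rule Bochner_Integration.integrable_bound[OF f]) (auto simp: norm_mult qeig_cmod[OF g'])
      \<comment> \<open>The statement does not involve x, but it is derived at a generic point; one
        such point suffices. Conjugating the phase of \<open>g'\<close> replaces P by -P, of the
        same degree.\<close>
      have "AE x in M. (\<integral>x. ?h x \<partial>M) = 0"
        using ii qeig_orbit_poly[OF T g'] ergodic_birkhoff_from_1[OF erg h]
      proof eventually_elim
        case (elim x)
        then obtain P where P: "degree P \<le> k" "\<And>n. g' ((T ^^ n) x) = ee (poly P (real n))" by blast
        have "wavg T f ee (- P) x \<longlonglongrightarrow> 0" using elim(1) torus_cont_ee P(1) by simp
        moreover have "wavg T f ee (- P) x = (\<lambda>n. (\<Sum>i=1..n. ?h ((T ^^ i) x)) / of_nat n)"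
          by (simp add: fun_eq_iff wavg_def P(2) ee_cnj mult.commute)
        ultimately show ?case using elim(3) LIMSEQ_unique by metis
      qed
      then have "(\<integral>x. ?h x \<partial>M) = 0" by simp
      moreover have "(\<integral>x. f x * cnj (g x) \<partial>M) = (\<integral>x. ?h x \<partial>M)"
        by (rule integral_cong_AE) (use gg' in auto)
      ultimately show "(\<integral>x. f x * cnj (g x) \<partial>M) = 0" by simp
    qed
  qed
  ultimately show ?thesis by blast
qed

end
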